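(* Consider the Cauchy problem $$u_{tt}(x,t)=\int_{\mathbb{R}} \alpha(y-x)\, w\big(u(y,t)-u(x,t)\big)\,dy,\quad x\in\mathbb{R},\ t>0,\qquad u(x,0)=\varphi(x),\ u_t(x,0)=\psi(x),$$ with $\alpha\in L^1(\mathbb{R})$, $w(0)=0$, and suppose one of the following holds: (i) $w\in C^1(\mathbb{R})$ and $X=C_b(\mathbb{R})$; (ii) $w\in C^1(\mathbb{R})$ and $X=L^p(\mathbb{R})\cap L^\infty(\mathbb{R})$ for some $1\le p\le\infty$; (iii) $w\in C^2(\mathbb{R})$ and $X=C^1_b(\mathbb{R})$; (iv) $w\in C^2(\mathbb{R})$ and $X=W^{1,p}(\mathbb{R})$ for some $1\le p\le\infty$; and let $\varphi,\psi\in X$. If there are constants $a,b$ with $|w(\eta)|\le a|\eta|+b$ for all $\eta\in\mathbb{R}$, then the Cauchy problem has a global solution, i.e. the solution $u\in C^2([0,T],X)$ exists for every $T>0$.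
   Context: $C_b(\mathbb{R})$: bounded continuous functions, sup norm. $C^1_b(\mathbb{R})$: differentiable functions with $u,u'$ bounded continuous, norm $\|u\|_\infty+\|u'\|_\infty$. $L^p\cap L^\infty$ with norm $\|u\|_p+\|u\|_\infty$. $W^{1,p}(\mathbb{R})$: $L^p$ functions with distributional derivative in $L^p$, norm $\|u\|_p+\|u'\|_p$. In each case the problem has a unique local solution in $C^2([0,T],X)$ for some $T>0$, which can be continued to a maximal existence interval. *)

theory Defs
  imports "HOL-Analysis.Analysis" "HOL-Probability.Essential_Supremum"
begin

text \<open>A function space X on the real line, given by its carrier, its norm, and the
  notion of equality of its elements (pointwise for spaces of continuous functions,
  almost everywhere for Lebesgue/Sobolev spaces).\<close>
record fspace =
  fcarrier :: "(real \<Rightarrow> real) set"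
  fnorm :: "(real \<Rightarrow> real) \<Rightarrow> real"
  feq :: "(real \<Rightarrow> real) \<Rightarrow> (real \<Rightarrow> real) \<Rightarrow> bool"

definition Cb_space :: fspace where
  "Cb_space = \<lparr> fcarrier = {f. continuous_on UNIV f \<and> bounded (range f)},
               fnorm = (\<lambda>f. (SUP x. \<bar>f x\<bar>)),
               feq = (\<lambda>f g. \<forall>x. f x = g x) \<rparr>"

definition C1b_space :: fspace where
  "C1b_space = \<lparr> fcarrier = {f. (\<forall>x. f differentiable (at x)) \<and> continuous_on UNIV (deriv f)
                              \<and> bounded (range f) \<and> bounded (range (deriv f))},
               fnorm = (\<lambda>f. (SUP x. \<bar>f x\<bar>) + (SUP x. \<bar>deriv f x\<bar>)),
               feq = (\<lambda>f g. \<forall>x. f x = g x) \<rparr>"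

definition in_Lp :: "ereal \<Rightarrow> (real \<Rightarrow> real) \<Rightarrow> bool" where
  "in_Lp p f \<longleftrightarrow> f \<in> borel_measurable lborel \<and>
     (if p = \<infinity> then esssup lborel (\<lambda>x. ereal \<bar>f x\<bar>) < \<infinity>
      else integrable lborel (\<lambda>x. \<bar>f x\<bar> powr real_of_ereal p))"

definition Lp_norm :: "ereal \<Rightarrow> (real \<Rightarrow> real) \<Rightarrow> real" where
  "Lp_norm p f = (if p = \<infinity> then real_of_ereal (esssup lborel (\<lambda>x. ereal \<bar>f x\<bar>))
      else (LINT x|lborel. \<bar>f x\<bar> powr real_of_ereal p) powr (1 / real_of_ereal p))"

definition LpLinf_space :: "ereal \<Rightarrow> fspace" where
  "LpLinf_space p = \<lparr> fcarrier = {f. in_Lp p f \<and> in_Lp \<infinity> f},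
                     fnorm = (\<lambda>f. Lp_norm p f + Lp_norm \<infinity> f),
                     feq = (\<lambda>f g. AE x in lborel. f x = g x) \<rparr>"

definition test_fun :: "(real \<Rightarrow> real) \<Rightarrow> bool" where
  "test_fun \<phi> \<longleftrightarrow> (\<forall>k x. ((deriv ^^ k) \<phi>) differentiable (at x)) \<and>
                   (\<exists>r. \<forall>x. \<bar>x\<bar> > r \<longrightarrow> \<phi> x = 0)"

definition weak_deriv :: "(real \<Rightarrow> real) \<Rightarrow> (real \<Rightarrow> real) \<Rightarrow> bool" where
  "weak_deriv f g \<longleftrightarrow> (\<forall>\<phi>. test_fun \<phi> \<longrightarrow>
      (LINT x|lborel. f x * deriv \<phi> x) = - (LINT x|lborel. g x * \<phi> x))"

definition W1p_space :: "ereal \<Rightarrow> fspace" where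
  "W1p_space p = \<lparr> fcarrier = {f. in_Lp p f \<and> (\<exists>g. in_Lp p g \<and> weak_deriv f g)},
                  fnorm = (\<lambda>f. Lp_norm p f + Lp_norm p (SOME g. in_Lp p g \<and> weak_deriv f g)),
                  feq = (\<lambda>f g. AE x in lborel. f x = g x) \<rparr>"

definition X_has_deriv :: "fspace \<Rightarrow> real \<Rightarrow> (real \<Rightarrow> real \<Rightarrow> real) \<Rightarrow> (real \<Rightarrow> real \<Rightarrow> real) \<Rightarrow> bool" where
  "X_has_deriv X T u v \<longleftrightarrow> (\<forall>t\<in>{0..T}.
     ((\<lambda>s. fnorm X (\<lambda>x. (u s x - u t x) / (s - t) - v t x)) \<longlongrightarrow> 0) (at t within {0..T}))"

definition X_continuous :: "fspace \<Rightarrow> real \<Rightarrow> (real \<Rightarrow> real \<Rightarrow> real) \<Rightarrow> bool" where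
  "X_continuous X T u \<longleftrightarrow> (\<forall>t\<in>{0..T}.
     ((\<lambda>s. fnorm X (\<lambda>x. u s x - u t x)) \<longlongrightarrow> 0) (at t within {0..T}))"

definition C2_curve :: "fspace \<Rightarrow> real \<Rightarrow> (real \<Rightarrow> real \<Rightarrow> real) \<Rightarrow> (real \<Rightarrow> real \<Rightarrow> real)
    \<Rightarrow> (real \<Rightarrow> real \<Rightarrow> real) \<Rightarrow> bool" where
  "C2_curve X T u u1 u2 \<longleftrightarrow>
     (\<forall>t\<in>{0..T}. u t \<in> fcarrier X \<and> u1 t \<in> fcarrier X \<and> u2 t \<in> fcarrier X) \<and>
     X_has_deriv X T u u1 \<and> X_has_deriv X T u1 u2 \<and> X_continuous X T u2"

definition C1_fun :: "(real \<Rightarrow> real) \<Rightarrow> bool" where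
  "C1_fun w \<longleftrightarrow> (\<exists>w'. (\<forall>x. (w has_real_derivative w' x) (at x)) \<and> continuous_on UNIV w')"

definition C2_fun :: "(real \<Rightarrow> real) \<Rightarrow> bool" where
  "C2_fun w \<longleftrightarrow> (\<exists>w' w''. (\<forall>x. (w has_real_derivative w' x) (at x)) \<and>
      (\<forall>x. (w' has_real_derivative w'' x) (at x)) \<and> continuous_on UNIV w'')"

definition peri_op :: "(real \<Rightarrow> real) \<Rightarrow> (real \<Rightarrow> real) \<Rightarrow> (real \<Rightarrow> real) \<Rightarrow> real \<Rightarrow> real" where
  "peri_op \<alpha> w v x = (LINT y|lborel. \<alpha> (y - x) * w (v y - v x))"

end

theory Submission
  imports Defs "HOL-Computational_Algebra.Polynomial" "HOL-Probability.Distributions"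
begin

text \<open>
  The equation is solved pointwise, by Picard iteration for the second order equation
  \<open>u'' = F u\<close> on bounded measurable functions. Linear growth of \<open>w\<close> gives an exponential sup bound
  that the Picard map preserves, so every iterate stays where \<open>w\<close> is Lipschitz and the iteration
  converges on all of \<open>[0, T]\<close>.

  To reach the norm of \<open>X\<close>, all estimates are carried out against a weight \<open>M\<close> with
  \<open>\<integral> \<bar>\<alpha> z\<bar> * (M (x + z) + M x) dz \<le> \<lambda> * M x\<close>: if the data are bounded by \<open>M\<close>, then the solution, its time
  derivatives and the errors of the difference quotients are bounded by multiples of \<open>M\<close> pointwise. A
  constant is such a weight, and for \<open>p < \<infinity>\<close> there is one in \<open>L\<^sup>p\<close>. In the spaces with a derivative the
  pair \<open>(u, v)\<close>, \<open>v\<close> solving the linearised equation, is iterated jointly, and the relation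
  \<open>u y - u x = \<integral> v\<close> over \<open>[x, y]\<close> is a closed condition preserved by the iteration.
\<close>

section \<open>Picard iteration in a weighted sup norm\<close>

text \<open>Two features resist a direct Banach space argument. Superposition with \<open>w\<close>
  is Lipschitz only on sets bounded in the sup norm, so a bounded set valid up to time T has to be
  found before any Lipschitz constant is chosen; its growth rate may depend on \<alpha>, a and b
  only. And the elements of X are functions under four unlike norms, two of them with equality
  almost everywhere, so integration of X-valued curves would have to be set up anew in each space.
  Domination by a fixed weight is instead an order relation between values: it passes through
  integrals in t and in z and through limits, and becomes a norm bound only at the end, by
  monotonicity of the norms. W^{1,p} has its price: the spatial derivative need not be bounded, so
  differentiation under the integral sign cannot rest on a constant bound, and its link to u is kept
  as an identity of integrals. Moreover the norm selects a weak derivative by \<open>SOME\<close>,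
  so weak derivatives must be shown unique almost everywhere.\<close>

definition prim :: "real \<Rightarrow> (real \<Rightarrow> real) \<Rightarrow> real \<Rightarrow> real" where
  "prim c g t = c + integral {0..t} g"

lemma prim_0 [simp]: "prim c g 0 = c"
  by (simp add: prim_def)

lemma prim_diff:
  assumes "continuous_on {0..T} g" "continuous_on {0..T} h" "t \<in> {0..T}"
  shows "prim c g t - prim d h t = prim (c - d) (\<lambda>s. g s - h s) t"
proof -
  have "g integrable_on {0..t}" "h integrable_on {0..t}"
    using assms by (auto intro!: integrable_continuous_real intro: continuous_on_subset)
  then show ?thesis
    by (simp add: prim_def integral_diff)
qed

lemma has_real_derivative_prim:
  assumes "continuous_on {0..T} g" "t \<in> {0..T}"
  shows "(prim c g has_real_derivative g t) (at t within {0..T})"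
  unfolding prim_def using integral_has_real_derivative[OF assms]
  by (auto intro!: derivative_eq_intros)

lemma continuous_on_prim:
  assumes "continuous_on {0..T} g"
  shows "continuous_on {0..T} (prim c g)"
  using has_real_derivative_prim[OF assms] by (meson DERIV_continuous_on)

text \<open>\<open>B * exp (k * t)\<close> is the primitive of \<open>k * B * exp (k * t)\<close>
  with value \<open>B\<close> at 0, so bounds of this shape reproduce themselves. Each integration
  gains a factor \<open>1 / k\<close>; two of them undo a factor \<open>k^2\<close> in a bound on
  \<open>F\<close>. The same estimate yields the invariant bounds and the contraction.\<close>

lemma prim_exp_bound:
  assumes "continuous_on {0..T} g" "\<bar>c\<bar> \<le> B" "k > 0" "t \<in> {0..T}"
    and "\<And>s. s \<in> {0..T} \<Longrightarrow> \<bar>g s\<bar> \<le> k * B * exp (k * s)"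
  shows "\<bar>prim c g t\<bar> \<le> B * exp (k * t)"
proof -
  have "((\<lambda>s. k * B * exp (k * s)) has_integral (B * exp (k * t) - B * exp (k * 0))) {0..t}"
    using assms(4) by (intro fundamental_theorem_of_calculus)
      (auto intro!: derivative_eq_intros simp flip: has_real_derivative_iff_has_vector_derivative)
  then have I: "(\<lambda>s. k * B * exp (k * s)) integrable_on {0..t}"
     "integral {0..t} (\<lambda>s. k * B * exp (k * s)) = B * exp (k * t) - B"
    by (auto simp: has_integral_integrable dest: integral_unique simp del: integral_mult_right)
  have "g integrable_on {0..t}"
    using assms by (auto intro!: integrable_continuous_real intro: continuous_on_subset)
  then have "norm (integral {0..t} g) \<le> integral {0..t} (\<lambda>s. k * B * exp (k * s))"
    using assms by (intro integral_norm_bound_integral I) auto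
  then show ?thesis
    using assms(2) I(2) unfolding prim_def by auto
qed

lemma prim_lipschitz:
  assumes "continuous_on {0..T} g" "s \<in> {0..T}" "t \<in> {0..T}"
    and "\<And>r. r \<in> {0..T} \<Longrightarrow> \<bar>g r\<bar> \<le> C"
  shows "\<bar>prim c g s - prim c g t\<bar> \<le> C * \<bar>s - t\<bar>"
  using field_differentiable_bound[of "{0..T}" "prim c g" g C s t] has_real_derivative_prim[OF assms(1)] assms
  by auto

text \<open>After subtraction of the line \<open>g t * r\<close> the derivative is
  \<open>g r - g t\<close>, which is at most \<open>C * \<bar>s - t\<bar>\<close> for r between s
  and t.\<close>

lemma prim_quotient:
  assumes "continuous_on {0..T} g" "s \<in> {0..T}" "t \<in> {0..T}" "s \<noteq> t"
    and "\<And>r. r \<in> {0..T} \<Longrightarrow> \<bar>g r - g t\<bar> \<le> C * \<bar>r - t\<bar>"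
    and "C \<ge> 0"
  shows "\<bar>(prim c g s - prim c g t) / (s - t) - g t\<bar> \<le> C * \<bar>s - t\<bar>"
proof -
  let ?S = "{min s t..max s t}"
  have S: "?S \<subseteq> {0..T}" using assms by auto
  have "norm ((prim c g s - g t * s) - (prim c g t - g t * t)) \<le> (C * \<bar>s - t\<bar>) * norm (s - t)"
  proof (rule field_differentiable_bound[where S = ?S and f' = "\<lambda>r. g r - g t"])
    show "((\<lambda>r. prim c g r - g t * r) has_real_derivative g r - g t) (at r within ?S)" if "r \<in> ?S" for r
    proof -
      have "(prim c g has_real_derivative g r) (at r within ?S)"
        using DERIV_subset[OF has_real_derivative_prim[OF assms(1), of r c] S] that S by blast
      then show ?thesis by (auto intro!: derivative_eq_intros)
    qed
    show "norm (g r - g t) \<le> C * \<bar>s - t\<bar>" if "r \<in> ?S" for r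
    proof -
      have "\<bar>g r - g t\<bar> \<le> C * \<bar>r - t\<bar>" using that S assms(5) by blast
      also have "\<dots> \<le> C * \<bar>s - t\<bar>" using that assms(6) by (intro mult_left_mono) auto
      finally show ?thesis by simp
    qed
  qed (use assms in auto)
  moreover have "(prim c g s - prim c g t) / (s - t) - g t
     = ((prim c g s - g t * s) - (prim c g t - g t * t)) / (s - t)"
    using assms(4) by (simp add: field_simps)
  ultimately show ?thesis
    using assms(4) by (simp add: abs_divide pos_divide_le_eq)
qed

text \<open>Left endpoint sums: each of the n cells of length h contributes an error of at most
  \<open>C * h * h\<close>. This exhibits time integrals as limits of finite linear
  combinations.\<close>

lemma prim_riemann_sum:
  assumes "continuous_on {0..T} g" "h \<ge> 0" "C \<ge> 0" "real n * h \<le> T"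
    and "\<And>s t. s \<in> {0..T} \<Longrightarrow> t \<in> {0..T} \<Longrightarrow> \<bar>g s - g t\<bar> \<le> C * \<bar>s - t\<bar>"
  shows "\<bar>(\<Sum>i<n. h * g (real i * h)) - integral {0..real n * h} g\<bar> \<le> real n * C * h^2"
  using assms(4)
proof (induction n)
  case (Suc n)
  let ?a = "real n * h" and ?b = "real (Suc n) * h"
  have ab: "0 \<le> ?a" "?a \<le> ?b" "?b \<le> T" using Suc.prems assms(2) by (auto simp: algebra_simps)
  have c: "continuous_on {?a..?b} g"
    using assms(1) ab by (auto intro: continuous_on_subset)
  have "integral {0..?a} g + integral {?a..?b} g = integral {0..?b} g"
    using ab assms(1) by (intro Henstock_Kurzweil_Integration.integral_combine) (auto intro!: integrable_continuous_real intro: continuous_on_subset)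
  moreover have "norm (integral {?a..?b} (\<lambda>s. g s - g ?a)) \<le> (C * h) * (?b - ?a)"
  proof (rule integral_bound)
    fix t assume t: "t \<in> {?a..?b}"
    have "\<bar>g t - g ?a\<bar> \<le> C * \<bar>t - ?a\<bar>" using t ab by (intro assms(5)) auto
    also have "\<dots> \<le> C * h" using t assms(3) by (intro mult_left_mono) (auto simp: algebra_simps)
    finally show "norm (g t - g ?a) \<le> C * h" by simp
  qed (use ab c in \<open>auto intro!: continuous_intros\<close>)
  moreover have "integral {?a..?b} (\<lambda>s. g s - g ?a) = integral {?a..?b} g - h * g ?a"
    using c ab by (subst integral_diff) (auto intro!: integrable_continuous_real simp: algebra_simps)
  ultimately show ?case using Suc.IH ab by (simp add: algebra_simps power2_eq_square)
qed simp

section \<open>The fixed point argument for \<open>u'' = F u\<close>\<close>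

text \<open>The pointwise counterpart of a C^2 curve, with rates: bounds, errors of difference
  quotients and the modulus of continuity of the second derivative \<open>F (U t)\<close> are all
  multiples of \<open>W\<close>, hence turn into norm statements wherever the norm is controlled by
  \<open>W\<close>.\<close>

definition weighted_solution where
  "weighted_solution Cl F W T C U U1 \<longleftrightarrow> C \<ge> (0::real) \<and> (\<forall>t\<in>{0..T::real}.
     U t \<in> Cl \<and> U1 t \<in> Cl \<and> F (U t) \<in> Cl
     \<and> (\<forall>p. \<bar>U t p\<bar> \<le> C * W p \<and> \<bar>U1 t p\<bar> \<le> C * W p \<and> \<bar>F (U t) p\<bar> \<le> C * W p)
     \<and> (\<forall>s\<in>{0..T}. \<forall>p. \<bar>F (U s) p - F (U t) p\<bar> \<le> C * \<bar>s - t\<bar> * W p)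
     \<and> (\<forall>s\<in>{0..T} - {t}. \<forall>p. \<bar>(U s p - U t p) / (s - t) - U1 t p\<bar> \<le> C * \<bar>s - t\<bar> * W p
          \<and> \<bar>(U1 s p - U1 t p) / (s - t) - F (U t) p\<bar> \<le> C * \<bar>s - t\<bar> * W (p::'a)))"

text \<open>The growth assumption on \<open>F\<close> makes the bounds defining \<open>D\<close> invariant under the Picard map, so that
  the Lipschitz condition is needed only on \<open>D\<close>.\<close>

locale picard =
  fixes W :: "'a \<Rightarrow> real" and bnd :: "'a \<Rightarrow> (real \<times> real) set"
    and F :: "('a \<Rightarrow> real) \<Rightarrow> 'a \<Rightarrow> real" and Cl :: "('a \<Rightarrow> real) set"
    and T \<Lambda> k0 :: real and \<phi> \<psi> :: "'a \<Rightarrow> real" and D :: "real \<Rightarrow> ('a \<Rightarrow> real) set"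
  assumes D_def: "\<And>t U. U \<in> D t \<longleftrightarrow> U \<in> Cl \<and> (\<forall>p. \<forall>(k, B) \<in> bnd p. \<bar>U p\<bar> \<le> B * exp (k * t))"
    and T: "T > 0" and Lam: "\<Lambda> \<ge> 0" and W: "\<And>p. W p \<ge> 0"
    and bndW: "\<And>p. (k0, W p) \<in> bnd p"
    and bnd: "\<And>p k B. (k, B) \<in> bnd p \<Longrightarrow> k > 0 \<and> B \<ge> 0"
    and Cl_add: "\<And>U V. U \<in> Cl \<Longrightarrow> V \<in> Cl \<Longrightarrow> (\<lambda>p. U p + V p) \<in> Cl"
    and Cl_scale: "\<And>U c. U \<in> Cl \<Longrightarrow> (\<lambda>p. c * U p) \<in> Cl"
    and Cl_lim: "\<And>Us U e. \<lbrakk>\<And>n::nat. Us n \<in> Cl; \<And>n p. \<bar>Us n p - U p\<bar> \<le> e n * W p; e \<longlonglongrightarrow> 0\<rbrakk>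
          \<Longrightarrow> U \<in> Cl"
    and F_Cl: "\<And>t U. t \<in> {0..T} \<Longrightarrow> U \<in> D t \<Longrightarrow> F U \<in> Cl"
    and F_bnd: "\<And>t U p k B. t \<in> {0..T} \<Longrightarrow> U \<in> D t \<Longrightarrow> (k, B) \<in> bnd p
          \<Longrightarrow> \<bar>F U p\<bar> \<le> k^2 * B * exp (k * t)"
    and F_lip: "\<And>s t U V c p. \<lbrakk>s \<in> {0..T}; t \<in> {0..T}; U \<in> D s; V \<in> D t; c \<ge> 0;
          \<And>p. \<bar>U p - V p\<bar> \<le> c * W p\<rbrakk> \<Longrightarrow> \<bar>F U p - F V p\<bar> \<le> \<Lambda> * c * W p"
    and phi: "\<phi> \<in> Cl" "\<And>p k B. (k, B) \<in> bnd p \<Longrightarrow> \<bar>\<phi> p\<bar> \<le> B"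
    and psi: "\<psi> \<in> Cl" "\<And>p k B. (k, B) \<in> bnd p \<Longrightarrow> \<bar>\<psi> p\<bar> \<le> k * B"
begin

lemma kpos: "k0 > 0"
  using bnd[OF bndW] by blast

lemma D_bnd: "U \<in> D t \<Longrightarrow> (k, B) \<in> bnd p \<Longrightarrow> \<bar>U p\<bar> \<le> B * exp (k * t)"
  unfolding D_def by blast

definition lipc :: "real \<Rightarrow> (real \<Rightarrow> 'a \<Rightarrow> real) \<Rightarrow> bool" where
  "lipc C g \<longleftrightarrow> C \<ge> 0 \<and> (\<forall>s\<in>{0..T}. \<forall>t\<in>{0..T}. \<forall>p. \<bar>g s p - g t p\<bar> \<le> C * \<bar>s - t\<bar> * W p)"

lemma lipcD: "lipc C g \<Longrightarrow> s \<in> {0..T} \<Longrightarrow> t \<in> {0..T} \<Longrightarrow> \<bar>g s p - g t p\<bar> \<le> C * \<bar>s - t\<bar> * W p"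
  unfolding lipc_def by blast

lemma lipc_cont:
  assumes "lipc C g" shows "continuous_on {0..T} (\<lambda>s. g s p)"
proof -
  have "(C * W p)-lipschitz_on {0..T} (\<lambda>s. g s p)"
    using assms W[of p] unfolding lipc_def
    by (intro lipschitz_onI) (auto simp: dist_real_def algebra_simps)
  then show ?thesis by (rule lipschitz_on_continuous_on)
qed

text \<open>\<open>Cl\<close> is assumed closed under linear combinations and
  \<open>W\<close>-weighted uniform limits only; a time integral is such a limit, since by
  \<open>lipc\<close> the Riemann sums converge at a rate that is uniform in p relative to
  \<open>W\<close>.\<close>

lemma prim_Cl:
  assumes c: "c \<in> Cl" and g: "\<And>s. s \<in> {0..T} \<Longrightarrow> g s \<in> Cl" and L: "lipc C g" and t: "t \<in> {0..T}"
  shows "(\<lambda>p. prim (c p) (\<lambda>s. g s p) t) \<in> Cl"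
proof (rule Cl_lim)
  \<comment> \<open>\<open>Suc n\<close> cells rather than n, so that the step size is also defined
    for n = 0.\<close>
  define R where "R n p = c p + (\<Sum>i<Suc n. t / Suc n * g (real i * (t / Suc n)) p)" for n :: nat and p
  have tt: "real i * (t / Suc n) \<in> {0..T}" if "i \<le> Suc n" for i n
  proof -
    have "real i * (t / Suc n) \<le> real (Suc n) * (t / Suc n)"
      using that t by (intro mult_right_mono) auto
    then show ?thesis using t by auto
  qed
  show "R n \<in> Cl" for n
  proof -
    have "(\<lambda>p. c p + (\<Sum>i<m. t / Suc n * g (real i * (t / Suc n)) p)) \<in> Cl" if "m \<le> Suc n" for m
      using that
    proof (induction m)
      case (Suc m)
      have "(\<lambda>p. (c p + (\<Sum>i<m. t / Suc n * g (real i * (t / Suc n)) p)) + t / Suc n * g (real m * (t / Suc n)) p) \<in> Cl"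
        using Suc.prems tt[of m n] by (intro Cl_add[OF Suc.IH] Cl_scale g) auto
      then show ?case unfolding sum.lessThan_Suc add.assoc .
    qed (simp add: c)
    then show ?thesis unfolding R_def by blast
  qed
  show "\<bar>R n p - prim (c p) (\<lambda>s. g s p) t\<bar> \<le> C * t^2 * (1 / Suc n) * W p" for n p
  proof -
    have "\<bar>(\<Sum>i<Suc n. t / Suc n * g (real i * (t / Suc n)) p) - integral {0..real (Suc n) * (t / Suc n)} (\<lambda>s. g s p)\<bar>
       \<le> real (Suc n) * (C * W p) * (t / Suc n)^2"
    proof (rule prim_riemann_sum[OF lipc_cont[OF L]])
      show "real (Suc n) * (t / real (Suc n)) \<le> T" using tt[of "Suc n" n] by (simp only: atLeastAtMost_iff)
      show "\<bar>g r p - g s p\<bar> \<le> C * W p * \<bar>r - s\<bar>" if "r \<in> {0..T}" "s \<in> {0..T}" for r s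
        using lipcD[OF L that] by (simp add: mult_ac)
    qed (use t L W[of p] in \<open>auto simp: lipc_def\<close>)
    moreover have "N * (C * W p) * (t / N)^2 = C * t^2 * (1 / N) * W p" if "N > 0" for N :: real
      using that by (simp add: power2_eq_square)
    then have "real (Suc n) * (C * W p) * (t / Suc n)^2 = C * t^2 * (1 / Suc n) * W p" by (simp del: of_nat_Suc)
    ultimately show ?thesis unfolding R_def prim_def by simp
  qed
  show "(\<lambda>n. C * t^2 * (1 / Suc n)) \<longlonglongrightarrow> 0"
    using tendsto_mult[OF tendsto_const LIMSEQ_inverse_real_of_nat, of "C * t^2"] by (simp add: inverse_eq_divide)
qed

abbreviation \<Gamma> :: "(real \<Rightarrow> 'a \<Rightarrow> real) \<Rightarrow> real \<Rightarrow> 'a \<Rightarrow> real" where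
  "\<Gamma> U t p \<equiv> prim (\<phi> p) (prim (\<psi> p) (\<lambda>s. F (U s) p)) t"

primrec it :: "nat \<Rightarrow> real \<Rightarrow> 'a \<Rightarrow> real" where
  "it 0 = (\<lambda>t. \<phi>)"
| "it (Suc n) = (\<lambda>t p. \<Gamma> (it n) t p)"

lemma it_Suc: "it (Suc n) t p = \<Gamma> (it n) t p"
  by simp

text \<open>One constant for the solution and its first two time derivatives, which are bounded by
  \<open>k0^j * exp (k0 * t) * W p\<close> for j = 0, 1, 2.\<close>

definition KT :: real where "KT = (1 + k0 + k0^2) * exp (k0 * T)"

lemma KT: "1 \<le> KT" "k0 * exp (k0 * T) \<le> KT" "k0^2 * exp (k0 * T) \<le> KT" "exp (k0 * T) \<le> KT"
proof -
  have e: "exp (k0 * T) \<ge> 1" using kpos T by simp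
  show "k0 * exp (k0 * T) \<le> KT" "k0^2 * exp (k0 * T) \<le> KT" "exp (k0 * T) \<le> KT"
    unfolding KT_def using kpos by (auto intro!: mult_right_mono simp: mult_le_cancel_right)
  then show "1 \<le> KT" using e by linarith
qed

lemma expT: "t \<in> {0..T} \<Longrightarrow> exp (k0 * t) \<le> exp (k0 * T)"
  using kpos by auto

lemma le_KT_W:
  assumes "x \<le> a * W p * exp (k0 * t)" "t \<in> {0..T}" "a \<ge> 0" "a * exp (k0 * T) \<le> KT"
  shows "x \<le> KT * W p"
proof -
  have "a * W p * exp (k0 * t) \<le> a * W p * exp (k0 * T)"
    using expT[OF assms(2)] assms W[of p] by (intro mult_left_mono) auto
  also have "\<dots> = (a * exp (k0 * T)) * W p" by simp
  also have "\<dots> \<le> KT * W p" using assms W[of p] by (intro mult_right_mono)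
  finally show ?thesis using assms(1) by linarith
qed

lemma D_le_W: "U \<in> D t \<Longrightarrow> t \<in> {0..T} \<Longrightarrow> \<bar>U p\<bar> \<le> KT * W p"
  using D_bnd[OF _ bndW] KT by (intro le_KT_W[where a = 1 and t = t]) auto

lemma F_le_W: "U \<in> D t \<Longrightarrow> t \<in> {0..T} \<Longrightarrow> \<bar>F U p\<bar> \<le> KT * W p"
  using F_bnd[OF _ _ bndW] KT kpos by (intro le_KT_W[where a = "k0^2" and t = t]) auto

text \<open>\<open>F_lip\<close> compares elements of \<open>D s\<close> and \<open>D t\<close> for
  different times, so it applies to two points of one curve.\<close>

lemma F_curve:
  assumes "lipc C U" "\<And>t. t \<in> {0..T} \<Longrightarrow> U t \<in> D t"
  shows "lipc (\<Lambda> * C) (\<lambda>t. F (U t))"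
proof -
  have "\<bar>F (U s) p - F (U t) p\<bar> \<le> \<Lambda> * (C * \<bar>s - t\<bar>) * W p" if "s \<in> {0..T}" "t \<in> {0..T}" for s t p
    by (rule F_lip[OF that assms(2)[OF that(1)] assms(2)[OF that(2)]])
      (use that assms(1) in \<open>auto simp: lipc_def\<close>)
  then show ?thesis
    using assms Lam by (auto simp: lipc_def algebra_simps)
qed

text \<open>One Picard step. The bound \<open>k^2 * B * exp (k * s)\<close> on
  \<open>F (U s)\<close> integrates to \<open>k * B * exp (k * t)\<close> for \<open>V1\<close> and
  then to \<open>B * exp (k * t)\<close> for \<open>V\<close>, so \<open>D\<close> is preserved. The
  Lipschitz constant \<open>KT\<close> of the image comes from these bounds and not from the
  constant \<open>C\<close> of the input, so one constant serves all iterates.\<close>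

lemma step_facts:
  assumes L: "lipc C U" and D: "\<And>t. t \<in> {0..T} \<Longrightarrow> U t \<in> D t"
  defines "V1 \<equiv> \<lambda>t p. prim (\<psi> p) (\<lambda>s. F (U s) p) t"
  defines "V \<equiv> \<lambda>t p. prim (\<phi> p) (\<lambda>s. V1 s p) t"
  shows "\<And>t k B p. t \<in> {0..T} \<Longrightarrow> (k, B) \<in> bnd p \<Longrightarrow> \<bar>V1 t p\<bar> \<le> k * B * exp (k * t)"
    and "lipc KT V1" "\<And>t. t \<in> {0..T} \<Longrightarrow> V1 t \<in> Cl"
    and "lipc KT V" "\<And>t. t \<in> {0..T} \<Longrightarrow> V t \<in> D t"
    and "\<And>t p. t \<in> {0..T} \<Longrightarrow> \<bar>V1 t p\<bar> \<le> KT * W p"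
proof -
  have FL: "lipc (\<Lambda> * C) (\<lambda>t. F (U t))" by (rule F_curve[OF L D])
  note Fc = lipc_cont[OF FL]
  show 1: "\<bar>V1 t p\<bar> \<le> k * B * exp (k * t)" if "t \<in> {0..T}" "(k, B) \<in> bnd p" for t k B p
    unfolding V1_def
  proof (rule prim_exp_bound[OF Fc])
    show "\<bar>F (U s) p\<bar> \<le> k * (k * B) * exp (k * s)" if "s \<in> {0..T}" for s
      using F_bnd[OF that D[OF that] \<open>(k, B) \<in> bnd p\<close>] by (simp add: power2_eq_square algebra_simps)
  qed (use psi(2) that bnd in auto)
  show 2: "\<bar>V1 t p\<bar> \<le> KT * W p" if "t \<in> {0..T}" for t p
    using 1[OF that bndW] KT kpos that by (intro le_KT_W[where a = "k0" and t = t]) auto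
  show L1: "lipc KT V1"
    unfolding lipc_def
  proof (intro conjI ballI allI)
    fix s t p assume st: "s \<in> {0..T}" "t \<in> {0..T}"
    have "\<bar>V1 s p - V1 t p\<bar> \<le> (KT * W p) * \<bar>s - t\<bar>"
      unfolding V1_def by (rule prim_lipschitz[OF Fc st]) (rule F_le_W[OF D])
    then show "\<bar>V1 s p - V1 t p\<bar> \<le> KT * \<bar>s - t\<bar> * W p" by (simp add: algebra_simps)
  qed (use KT in auto)
  show 3: "V1 t \<in> Cl" if "t \<in> {0..T}" for t
    unfolding V1_def using psi(1) F_Cl[OF _ D] FL that by (intro prim_Cl) auto
  note Vc = lipc_cont[OF L1]
  show "lipc KT V"
    unfolding lipc_def
  proof (intro conjI ballI allI)
    fix s t p assume st: "s \<in> {0..T}" "t \<in> {0..T}"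
    have "\<bar>V s p - V t p\<bar> \<le> (KT * W p) * \<bar>s - t\<bar>"
      unfolding V_def by (rule prim_lipschitz[OF Vc st]) (rule 2)
    then show "\<bar>V s p - V t p\<bar> \<le> KT * \<bar>s - t\<bar> * W p" by (simp add: algebra_simps)
  qed (use KT in auto)
  show "V t \<in> D t" if t: "t \<in> {0..T}" for t
    unfolding D_def
  proof (intro conjI allI ballI, safe)
    show "V t \<in> Cl"
      unfolding V_def using phi(1) 3 L1 t by (intro prim_Cl) auto
    fix p k B assume b: "(k, B) \<in> bnd p"
    show "\<bar>V t p\<bar> \<le> B * exp (k * t)"
      unfolding V_def using phi(2)[OF b] bnd[OF b] 1[OF _ b] t by (intro prim_exp_bound[OF Vc]) auto
  qed
qed

lemma it_facts: "(\<exists>C. lipc C (it n)) \<and> (\<forall>t\<in>{0..T}. it n t \<in> D t)"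
proof (induction n)
  case 0
  have "lipc 0 (it 0)" by (auto simp: lipc_def)
  moreover have "it 0 t \<in> D t" if "t \<in> {0..T}" for t
    unfolding D_def
  proof (intro conjI allI ballI, safe)
    fix p k B assume b: "(k, B) \<in> bnd p"
    have "\<bar>it 0 t p\<bar> \<le> B * 1" using phi(2)[OF b] by simp
    also have "\<dots> \<le> B * exp (k * t)" using bnd[OF b] that by (intro mult_left_mono) auto
    finally show "\<bar>it 0 t p\<bar> \<le> B * exp (k * t)" .
  qed (use phi(1) in simp)
  ultimately show ?case by blast
next
  case (Suc n)
  then obtain C where "lipc C (it n)" "\<And>t. t \<in> {0..T} \<Longrightarrow> it n t \<in> D t" by blast
  from step_facts(4,5)[OF this] show ?case by auto
qed

lemma it_lipc: "lipc KT (it n)"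
proof (cases n)
  case 0
  then show ?thesis using KT(1) W by (auto simp: lipc_def)
next
  case (Suc m)
  obtain C where "lipc C (it m)" "\<And>t. t \<in> {0..T} \<Longrightarrow> it m t \<in> D t" using it_facts by blast
  from step_facts(4)[OF this] show ?thesis using Suc by auto
qed

lemma it_D: "t \<in> {0..T} \<Longrightarrow> it n t \<in> D t"
  using it_facts by blast

text \<open>Rate of a Bielecki norm. Two integrations against \<open>exp (\<mu> * t)\<close> divide
  by \<open>\<mu>^2 \<ge> 2 * \<Lambda>\<close>, so the Picard map contracts by 1/2 on [0, T]
  however large \<open>T\<close> is.\<close>

definition \<mu> :: real where "\<mu> = 1 + 2 * \<Lambda>"

lemma mu: "\<mu> > 0" "2 * \<Lambda> \<le> \<mu>^2"
  using Lam by (auto simp: \<mu>_def power2_eq_square algebra_simps)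

lemma double_prim_contract:
  assumes "lipc C U" "\<And>t. t \<in> {0..T} \<Longrightarrow> U t \<in> D t"
    and "lipc C' V" "\<And>t. t \<in> {0..T} \<Longrightarrow> V t \<in> D t"
    and c: "c \<ge> 0" "\<And>t p. t \<in> {0..T} \<Longrightarrow> \<bar>U t p - V t p\<bar> \<le> c * exp (\<mu> * t) * W p"
    and t: "t \<in> {0..T}"
  shows "\<bar>\<Gamma> U t p - \<Gamma> V t p\<bar>
     \<le> c / 2 * exp (\<mu> * t) * W p"
proof -
  have Uc: "continuous_on {0..T} (\<lambda>s. F (U s) p)"
    by (rule lipc_cont, rule F_curve[OF assms(1,2)])
  have Vc: "continuous_on {0..T} (\<lambda>s. F (V s) p)"
    by (rule lipc_cont, rule F_curve[OF assms(3,4)])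
  have 1: "\<bar>F (U s) p - F (V s) p\<bar> \<le> \<mu> * (\<mu> * (c/2 * W p)) * exp (\<mu> * s)" if s: "s \<in> {0..T}" for s
  proof -
    have "\<bar>F (U s) p - F (V s) p\<bar> \<le> \<Lambda> * (c * exp (\<mu> * s)) * W p"
      using s assms by (intro F_lip) auto
    also have "\<dots> = (2 * \<Lambda>) * (c / 2 * exp (\<mu> * s) * W p)" by simp
    also have "\<dots> \<le> \<mu>^2 * (c / 2 * exp (\<mu> * s) * W p)"
      using mu c W[of p] by (intro mult_right_mono) auto
    finally show ?thesis by (simp add: power2_eq_square algebra_simps)
  qed
  have 2: "\<bar>prim (\<psi> p) (\<lambda>s. F (U s) p) s - prim (\<psi> p) (\<lambda>s. F (V s) p) s\<bar> \<le> \<mu> * (c/2 * W p) * exp (\<mu> * s)"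
    if s: "s \<in> {0..T}" for s
    by (subst prim_diff[OF Uc Vc s], rule prim_exp_bound[OF continuous_on_diff[OF Uc Vc] _ mu(1) s 1]) (use mu c W[of p] in auto)
  have "\<bar>\<Gamma> U t p - \<Gamma> V t p\<bar>
     \<le> (c/2 * W p) * exp (\<mu> * t)"
    by (subst prim_diff[OF continuous_on_prim[OF Uc] continuous_on_prim[OF Vc] t], rule prim_exp_bound[OF continuous_on_diff[OF continuous_on_prim[OF Uc] continuous_on_prim[OF Vc]] _ mu(1) t 2])
      (use c W[of p] in auto)
  then show ?thesis by (simp add: algebra_simps)
qed

lemma it_diff: "t \<in> {0..T} \<Longrightarrow> \<bar>it (Suc n) t p - it n t p\<bar> \<le> 2 * KT * (1/2)^n * exp (\<mu> * t) * W p"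
proof (induction n arbitrary: t p)
  case 0
  have "\<bar>it (Suc 0) t p - it 0 t p\<bar> \<le> \<bar>it (Suc 0) t p\<bar> + \<bar>it 0 t p\<bar>" by linarith
  also have "\<dots> \<le> KT * W p + KT * W p"
    by (intro add_mono D_le_W[OF it_D]) (use 0 in auto)
  also have "\<dots> = 2 * KT * W p * 1" by simp
  also have "\<dots> \<le> 2 * KT * W p * exp (\<mu> * t)"
    using KT(1) W[of p] mu 0 by (intro mult_left_mono) auto
  finally show ?case by (simp add: algebra_simps)
next
  case (Suc n)
  have "\<bar>it (Suc (Suc n)) t p - it (Suc n) t p\<bar> \<le> (2 * KT * (1/2)^n) / 2 * exp (\<mu> * t) * W p"
    unfolding it_Suc[of "Suc n" t p] it_Suc[of n t p]
    by (rule double_prim_contract[OF it_lipc it_D it_lipc it_D _ Suc.IH Suc.prems])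
      (use KT(1) in auto)
  then show ?case by simp
qed

definition sol :: "real \<Rightarrow> 'a \<Rightarrow> real" where
  "sol t p = lim (\<lambda>n. it n t p)"

lemma it_sol:
  assumes t: "t \<in> {0..T}"
  shows "(\<lambda>n. it n t p) \<longlonglongrightarrow> sol t p"
    and "\<bar>it n t p - sol t p\<bar> \<le> 4 * KT * (1/2)^n * exp (\<mu> * t) * W p"
proof -
  let ?d = "\<lambda>n. it (Suc n) t p - it n t p"
  let ?b = "\<lambda>n::nat. (2 * KT * exp (\<mu> * t) * W p) * (1/2)^n"
  have b: "\<bar>?d n\<bar> \<le> ?b n" for n using it_diff[OF t, of n p] by (simp only: mult_ac)
  have sb: "?b sums ((2 * KT * exp (\<mu> * t) * W p) * (1 / (1 - 1/2)))"
    by (intro sums_mult geometric_sums) simp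
  have sd: "summable ?d"
    by (rule summable_comparison_test'[OF sums_summable[OF sb]]) (use b in auto)
  have "(\<lambda>n. \<Sum>i<n. ?d i) \<longlonglongrightarrow> suminf ?d" by (rule summable_LIMSEQ[OF sd])
  then have "(\<lambda>n. it n t p - it 0 t p) \<longlonglongrightarrow> suminf ?d" unfolding sum_lessThan_telescope[of "\<lambda>n. it n t p"] .
  from tendsto_add[OF this tendsto_const[of "it 0 t p"]]
  have "convergent (\<lambda>n. it n t p)" by (auto simp: convergent_def simp del: it.simps)
  then show 1: "(\<lambda>n. it n t p) \<longlonglongrightarrow> sol t p"
    unfolding sol_def by (simp add: convergent_LIMSEQ_iff)
  have "\<bar>it (n + k) t p - it n t p\<bar> \<le> 4 * KT * (1/2)^n * exp (\<mu> * t) * W p" for k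
  proof -
    \<comment> \<open>As \<open>?b\<close> halves at each step,
      \<open>?b n = 2 * ?b n - 2 * ?b (n + 1)\<close>, and the sum of the bounds telescopes.\<close>
    have "\<bar>it (n + k) t p - it n t p\<bar> \<le> 2 * ?b n - 2 * ?b (n + k)"
    proof (induction k)
      case (Suc k)
      then show ?case using b[of "n + k"] by (simp del: it.simps)
    qed simp
    also have "\<dots> \<le> 2 * ?b n" using KT(1) W[of p] by simp
    finally show ?thesis by (simp add: mult_ac del: it.simps)
  qed
  moreover have "(\<lambda>k. \<bar>it (n + k) t p - it n t p\<bar>) \<longlonglongrightarrow> \<bar>sol t p - it n t p\<bar>"
    using LIMSEQ_ignore_initial_segment[OF 1, of n] by (intro tendsto_intros) (simp add: add.commute)
  ultimately have "\<bar>sol t p - it n t p\<bar> \<le> 4 * KT * (1/2)^n * exp (\<mu> * t) * W p"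
    by (intro LIMSEQ_le_const2) auto
  then show "\<bar>it n t p - sol t p\<bar> \<le> 4 * KT * (1/2)^n * exp (\<mu> * t) * W p" by linarith
qed

lemma sol_D:
  assumes t: "t \<in> {0..T}" shows "sol t \<in> D t"
  unfolding D_def
proof (intro conjI allI ballI, safe)
  show "sol t \<in> Cl"
  proof (rule Cl_lim)
    show "it n t \<in> Cl" for n using it_D[OF t] D_def by blast
    show "\<bar>it n t p - sol t p\<bar> \<le> (4 * KT * (1/2)^n * exp (\<mu> * t)) * W p" for n p
      using it_sol(2)[OF t] by simp
    have "(\<lambda>n. 4 * KT * (1/2::real)^n * exp (\<mu> * t)) \<longlonglongrightarrow> 4 * KT * 0 * exp (\<mu> * t)"
      by (intro tendsto_intros) auto
    then show "(\<lambda>n. 4 * KT * (1/2::real)^n * exp (\<mu> * t)) \<longlonglongrightarrow> 0" by simp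
  qed
  fix p k B assume b: "(k, B) \<in> bnd p"
  have "(\<lambda>n. \<bar>it n t p\<bar>) \<longlonglongrightarrow> \<bar>sol t p\<bar>" by (intro tendsto_intros it_sol t)
  then show "\<bar>sol t p\<bar> \<le> B * exp (k * t)"
    using D_bnd[OF it_D[OF t] b] by (intro LIMSEQ_le_const2) auto
qed

lemma sol_lipc: "lipc KT sol"
  unfolding lipc_def
proof (intro conjI ballI allI)
  fix s t p assume st: "s \<in> {0..T}" "t \<in> {0..T}"
  have "(\<lambda>n. \<bar>it n s p - it n t p\<bar>) \<longlonglongrightarrow> \<bar>sol s p - sol t p\<bar>" by (intro tendsto_intros it_sol st)
  then show "\<bar>sol s p - sol t p\<bar> \<le> KT * \<bar>s - t\<bar> * W p"
    using lipcD[OF it_lipc st] by (intro LIMSEQ_le_const2) auto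
qed (use KT in auto)

definition sol1 :: "real \<Rightarrow> 'a \<Rightarrow> real" where
  "sol1 t p = prim (\<psi> p) (\<lambda>s. F (sol s) p) t"

text \<open>The iterates \<open>it (Suc n)\<close> tend to \<open>sol\<close> and, by the
  contraction estimate for \<open>it n\<close> against \<open>sol\<close>, also to the image of
  \<open>sol\<close> under the Picard map.\<close>

lemma sol_eq:
  assumes t: "t \<in> {0..T}" shows "sol t p = prim (\<phi> p) (\<lambda>s. sol1 s p) t"
proof -
  let ?V = "prim (\<phi> p) (\<lambda>s. sol1 s p) t"
  have "(\<lambda>n. it (Suc n) t p - ?V) \<longlonglongrightarrow> 0"
  proof (rule Lim_null_comparison)
    show "\<forall>\<^sub>F n in sequentially. norm (it (Suc n) t p - ?V) \<le> (4 * KT * (1/2)^n) / 2 * exp (\<mu> * t) * W p"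
    proof (rule always_eventually, rule allI)
      fix n
      show "norm (it (Suc n) t p - ?V) \<le> (4 * KT * (1/2)^n) / 2 * exp (\<mu> * t) * W p"
        unfolding it.simps(2)[of n] sol1_def real_norm_def
        using KT(1) it_sol(2) t
        by (intro double_prim_contract[OF it_lipc it_D sol_lipc sol_D]) auto
    qed
    have "(\<lambda>n. (4 * KT * (1/2::real)^n) / 2 * exp (\<mu> * t) * W p) \<longlonglongrightarrow> (4 * KT * 0) / 2 * exp (\<mu> * t) * W p"
      by (intro tendsto_intros) auto
    then show "(\<lambda>n. (4 * KT * (1/2::real)^n) / 2 * exp (\<mu> * t) * W p) \<longlonglongrightarrow> 0" by simp
  qed
  then have "(\<lambda>n. it (Suc n) t p) \<longlonglongrightarrow> ?V" by (simp add: LIM_zero_iff del: it.simps)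
  moreover have "(\<lambda>n. it (Suc n) t p) \<longlonglongrightarrow> sol t p"
    using it_sol(1)[OF t] by (rule LIMSEQ_Suc)
  ultimately show ?thesis by (rule LIMSEQ_unique[symmetric])
qed

theorem picard_solution:
  "\<exists>U U1 C. U 0 = \<phi> \<and> U1 0 = \<psi> \<and> weighted_solution Cl F W T C U U1"
proof -
  \<comment> \<open>\<open>KT\<close> serves the bounds and the quotients of \<open>sol\<close>;
    \<open>\<Lambda> * KT\<close> is the Lipschitz constant of \<open>F\<close> along
    \<open>sol\<close> and serves the quotients of \<open>sol1\<close>.\<close>
  let ?C = "(1 + \<Lambda>) * KT"
  have sf: "lipc KT sol1" "\<And>t. t \<in> {0..T} \<Longrightarrow> sol1 t \<in> Cl"
      "\<And>t p. t \<in> {0..T} \<Longrightarrow> \<bar>sol1 t p\<bar> \<le> KT * W p"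
    unfolding sol1_def[abs_def]
    by (rule step_facts[OF sol_lipc sol_D]; assumption)+
  have C: "KT \<le> ?C" "\<Lambda> * KT \<le> ?C" "?C \<ge> 0" using Lam KT(1) by (auto simp: algebra_simps)
  have CW: "x \<le> KT * r * W p \<Longrightarrow> r \<ge> 0 \<Longrightarrow> x \<le> ?C * r * W p" for x r p
    using C(1) W[of p] by (smt (verit) mult_right_mono)
  have CW': "x \<le> (\<Lambda> * KT) * r * W p \<Longrightarrow> r \<ge> 0 \<Longrightarrow> x \<le> ?C * r * W p" for x r p
    using C(2) W[of p] by (smt (verit) mult_right_mono)
  note FL = F_curve[OF sol_lipc sol_D]
  have "weighted_solution Cl F W T ?C sol sol1"
    unfolding weighted_solution_def
  proof (intro conjI ballI allI)
    show "?C \<ge> 0" by (rule C)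
    fix t assume t: "t \<in> {0..T}"
    show "sol t \<in> Cl" "sol1 t \<in> Cl" "F (sol t) \<in> Cl"
      using sol_D[OF t] sf(2)[OF t] F_Cl[OF t sol_D[OF t]] D_def by blast+
    fix p
    show "\<bar>sol t p\<bar> \<le> ?C * W p" "\<bar>sol1 t p\<bar> \<le> ?C * W p" "\<bar>F (sol t) p\<bar> \<le> ?C * W p"
      using CW[of _ 1] D_le_W[OF sol_D[OF t] t] sf(3)[OF t] F_le_W[OF sol_D[OF t] t] by auto
    show "\<bar>F (sol s) p - F (sol t) p\<bar> \<le> ?C * \<bar>s - t\<bar> * W p" if s: "s \<in> {0..T}" for s
      using lipcD[OF FL s t] by (intro CW') auto
    fix s assume "s \<in> {0..T} - {t}"
    then have s: "s \<in> {0..T}" and st: "s \<noteq> t" by auto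
    have "\<bar>(prim (\<phi> p) (\<lambda>s. sol1 s p) s - prim (\<phi> p) (\<lambda>s. sol1 s p) t) / (s - t) - sol1 t p\<bar> \<le> (KT * W p) * \<bar>s - t\<bar>"
      using lipcD[OF sf(1) _ t, of _ p] KT(1) W[of p]
      by (intro prim_quotient[OF lipc_cont[OF sf(1)] s t st]) (auto simp: mult_ac)
    then show "\<bar>(sol s p - sol t p) / (s - t) - sol1 t p\<bar> \<le> ?C * \<bar>s - t\<bar> * W p"
      using sol_eq[OF s] sol_eq[OF t] by (intro CW) (auto simp: mult_ac)
    have "\<bar>(sol1 s p - sol1 t p) / (s - t) - F (sol t) p\<bar> \<le> (\<Lambda> * KT * W p) * \<bar>s - t\<bar>"
      unfolding sol1_def
      using lipcD[OF FL _ t, of _ p] KT(1) W[of p] Lam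
      by (intro prim_quotient[OF lipc_cont[OF FL] s t st]) (auto simp: mult_ac)
    then show "\<bar>(sol1 s p - sol1 t p) / (s - t) - F (sol t) p\<bar> \<le> ?C * \<bar>s - t\<bar> * W p"
      by (intro CW') (auto simp: mult_ac)
  qed
  moreover have "sol 0 = \<phi>" using sol_eq[of 0] T by auto
  moreover have "sol1 0 = \<psi>" by (auto simp: sol1_def)
  ultimately show ?thesis by blast
qed

end

section \<open>Integrals of locally integrable functions\<close>

text \<open>The range of V is divided, not the interval: points with equally spaced V-values exist
  by the intermediate value theorem, and the n + 1 increments of D add up to at most
  \<open>C * (V b - V a)^2 / (n + 1)\<close>. In the chain rule for absolutely continuous functions
  this takes the place of differentiation almost everywhere.\<close>

lemma quadratic_increment_imp_eq:
  fixes D V :: "real \<Rightarrow> real"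
  assumes ab: "a \<le> b" and V: "continuous_on {a..b} V"
    and mono: "\<And>x y. a \<le> x \<Longrightarrow> x \<le> y \<Longrightarrow> y \<le> b \<Longrightarrow> V x \<le> V y"
    and D: "\<And>x y. a \<le> x \<Longrightarrow> x \<le> y \<Longrightarrow> y \<le> b \<Longrightarrow> \<bar>D y - D x\<bar> \<le> C * (V y - V x)^2"
  shows "D a = D b"
proof -
  let ?d = "V b - V a"
  have d: "?d \<ge> 0" using mono ab by simp
  \<comment> \<open>Points with equal V-value have equal D-value. The first and last nodes share
    with a and b nothing but the value of V.\<close>
  have eq: "D x = D y" if "x \<in> {a..b}" "y \<in> {a..b}" "V x = V y" for x y
  proof (cases "x \<le> y")
    case True
    with that have "\<bar>D y - D x\<bar> \<le> C * (V y - V x)^2" by (intro D) auto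
    also have "V y - V x = 0" using that(3) by simp
    finally show ?thesis by simp
  next
    case False
    with that have "\<bar>D x - D y\<bar> \<le> C * (V x - V y)^2" by (intro D) auto
    also have "V x - V y = 0" using that(3) by simp
    finally show ?thesis by simp
  qed
  have "\<bar>D b - D a\<bar> \<le> C * ?d^2 * (1 / Suc n)" for n
  proof (cases "?d = 0")
    case True
    then show ?thesis using D[OF order_refl ab order_refl] by simp
  next
    case False
    let ?v = "\<lambda>i::nat. V a + real i * (?d / Suc n)"
    have "\<exists>x\<in>{a..b}. V x = ?v i" if "i \<le> Suc n" for i
    proof -
      have "real i * (?d / Suc n) \<le> real (Suc n) * (?d / Suc n)"
        using that d by (intro mult_right_mono) auto
      also have "\<dots> = ?d" by simp
      finally have "V a \<le> ?v i" "?v i \<le> V b" using d by auto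
      from IVT'[OF this ab V] show ?thesis by auto
    qed
    then obtain p where p: "\<And>i. i \<le> Suc n \<Longrightarrow> p i \<in> {a..b} \<and> V (p i) = ?v i" by metis
    have "\<bar>D (p i) - D (p 0)\<bar> \<le> real i * (C * (?d / Suc n)^2)" if "i \<le> Suc n" for i
      using that
    proof (induction i)
      case (Suc i)
      have "real (Suc i) * q = real i * q + q" for q :: real by (simp add: algebra_simps)
      then have pi: "p i \<in> {a..b}" "p (Suc i) \<in> {a..b}" "V (p (Suc i)) - V (p i) = ?d / Suc n"
        using p[of i] p[of "Suc i"] Suc.prems by (auto simp del: of_nat_Suc simp flip: diff_divide_distrib)
      have "?d / Suc n > 0" using False d by simp
      then have "p i \<le> p (Suc i)"
        using pi mono[of "p (Suc i)" "p i"] by (intro leI notI) (auto simp del: of_nat_Suc)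
      then have "\<bar>D (p (Suc i)) - D (p i)\<bar> \<le> C * (?d / Suc n)^2"
        using D[of "p i" "p (Suc i)"] pi by (simp del: of_nat_Suc)
      then show ?case using Suc.IH Suc.prems by (simp add: algebra_simps)
    qed simp
    from this[of "Suc n"] have "\<bar>D (p (Suc n)) - D (p 0)\<bar> \<le> real (Suc n) * (C * (?d / Suc n)^2)" by simp
    moreover have "N * (C * (?d / N)^2) = C * ?d^2 * (1 / N)" if "N > 0" for N :: real
      using that by (simp add: power2_eq_square)
    then have "real (Suc n) * (C * (?d / Suc n)^2) = C * ?d^2 * (1 / Suc n)" by (simp del: of_nat_Suc)
    ultimately have *: "\<bar>D (p (Suc n)) - D (p 0)\<bar> \<le> C * ?d^2 * (1 / Suc n)" by (rule ord_le_eq_trans)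
    have "D (p 0) = D a" "D (p (Suc n)) = D b"
      using p[of 0] p[of "Suc n"] ab by (auto intro!: eq)
    with * show ?thesis by simp
  qed
  moreover have "(\<lambda>n. C * ?d^2 * (1 / Suc n)) \<longlonglongrightarrow> C * ?d^2 * 0"
    using LIMSEQ_inverse_real_of_nat by (intro tendsto_intros) (simp add: inverse_eq_divide)
  ultimately have "\<bar>D b - D a\<bar> \<le> C * ?d^2 * 0"
    by (intro LIMSEQ_le_const) auto
  then show ?thesis by simp
qed

section \<open>Local absolute continuity\<close>

text \<open>Local absolute continuity with density v, stated through integrals: a measurable change
  of v on a null set does no harm, and the relation survives limits of v in L^1 on bounded
  intervals. Both are needed, since v is an L^p function produced by an iteration.\<close>

definition AC :: "(real \<Rightarrow> real) \<Rightarrow> (real \<Rightarrow> real) \<Rightarrow> bool" where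
  "AC u v \<longleftrightarrow> (\<forall>x y. x \<le> y \<longrightarrow> set_integrable lborel {x..y} v \<and> u y - u x = (LBINT s:{x..y}. v s))"

lemma AC_integrable: "AC u v \<Longrightarrow> set_integrable lborel {x..y} v"
  unfolding AC_def by (cases "x \<le> y") auto

lemma AC_diff: "AC u v \<Longrightarrow> x \<le> y \<Longrightarrow> u y - u x = (LBINT s:{x..y}. v s)"
  unfolding AC_def by blast

lemma AC_add: "AC u v \<Longrightarrow> AC u' v' \<Longrightarrow> AC (\<lambda>x. u x + u' x) (\<lambda>x. v x + v' x)"
  unfolding AC_def by (auto simp: set_integral_add algebra_simps)

lemma AC_scale: "AC u v \<Longrightarrow> AC (\<lambda>x. c * u x) (\<lambda>x. c * v x)"
  unfolding AC_def by (auto simp: set_integral_mult_right simp flip: right_diff_distrib)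

lemma AC_minus: "AC u v \<Longrightarrow> AC u' v' \<Longrightarrow> AC (\<lambda>x. u x - u' x) (\<lambda>x. v x - v' x)"
  using AC_add[of u v "\<lambda>x. (-1) * u' x" "\<lambda>x. (-1) * v' x"] AC_scale[of u' v' "-1"] by simp

lemma AC_shift:
  assumes "AC u v" shows "AC (\<lambda>x. u (x + z)) (\<lambda>x. v (x + z))"
  unfolding AC_def
proof (intro allI impI conjI)
  fix x y :: real assume xy: "x \<le> y"
  have ind: "indicator {x..y} s *\<^sub>R v (s + z) = indicator {x + z..y + z} (z + 1 * s) *\<^sub>R v (z + 1 * s)" for s
    by (auto simp: indicator_def add.commute)
  show "set_integrable lborel {x..y} (\<lambda>x. v (x + z))"
    using AC_integrable[OF assms, of "x + z" "y + z"]
      lborel_integrable_real_affine_iff[of 1 "\<lambda>s. indicator {x + z..y + z} s *\<^sub>R v s" z]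
    unfolding set_integrable_def ind by simp
  have "u (y + z) - u (x + z) = (LBINT s:{x + z..y + z}. v s)"
    using AC_diff[OF assms, of "x + z" "y + z"] xy by simp
  also have "\<dots> = (LBINT s:{x..y}. v (s + z))"
    unfolding set_lebesgue_integral_def ind
    by (subst lborel_integral_real_affine[of 1 _ z]) auto
  finally show "u (y + z) - u (x + z) = (LBINT s:{x..y}. v (s + z))" .
qed

lemma AC_cong_AE:
  assumes "AC u v" "AE x in lborel. v x = v' x" "v' \<in> borel_measurable borel"
  shows "AC u v'"
  unfolding AC_def
proof (intro allI impI conjI)
  fix x y :: real assume xy: "x \<le> y"
  have m: "set_borel_measurable lborel {x..y} v'"
    using assms(3) unfolding set_borel_measurable_def by simp
  have ae: "AE s in lborel. indicator {x..y} s *\<^sub>R v s = indicator {x..y} s *\<^sub>R v' s"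
    using assms(2) by eventually_elim simp
  note i = AC_integrable[OF assms(1), of x y]
  note m' = borel_measurable_integrable[OF i[unfolded set_integrable_def]]
  show "set_integrable lborel {x..y} v'"
    using iffD1[OF integrable_cong_AE[OF m' m[unfolded set_borel_measurable_def] ae]] i
    unfolding set_integrable_def by simp
  show "u y - u x = (LBINT s:{x..y}. v' s)"
    unfolding AC_diff[OF assms(1) xy] set_lebesgue_integral_def
    by (rule integral_cong_AE[OF m' m[unfolded set_borel_measurable_def] ae])
qed

lemma AC_bound:
  assumes "AC u v" "x \<le> y" shows "\<bar>u y - u x\<bar> \<le> (LBINT s:{x..y}. \<bar>v s\<bar>)"
  using set_integral_norm_bound[OF AC_integrable[OF assms(1)], of x y]
  by (simp add: AC_diff[OF assms])

lemma set_integral_mono_set: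
  fixes f :: "real \<Rightarrow> real"
  assumes "set_integrable lborel B f" "\<And>x. f x \<ge> 0" "A \<subseteq> B" "A \<in> sets lborel"
  shows "(LBINT x:A. f x) \<le> (LBINT x:B. f x)"
proof -
  have "set_integrable lborel A f" by (rule set_integrable_subset[OF assms(1,4,3)])
  then show ?thesis
    using assms unfolding set_lebesgue_integral_def set_integrable_def
    by (intro integral_mono) (auto simp: indicator_def)
qed

lemma set_integral_split:
  fixes f :: "real \<Rightarrow> real"
  assumes "set_integrable lborel {a..c} f" "a \<le> b" "b \<le> c"
  shows "(LBINT x:{a..c}. f x) = (LBINT x:{a..b}. f x) + (LBINT x:{b..c}. f x)"
proof -
  have i: "set_integrable lborel {a..b} f" "set_integrable lborel {b..c} f"
    using assms by (auto intro: set_integrable_subset)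
  have hk: "f integrable_on {a..c}" using set_borel_integral_eq_integral[OF assms(1)] by simp
  show ?thesis
    using Henstock_Kurzweil_Integration.integral_combine[OF assms(2,3) hk]
    by (simp add: set_borel_integral_eq_integral[OF assms(1)] set_borel_integral_eq_integral[OF i(1)]
        set_borel_integral_eq_integral[OF i(2)])
qed

lemma AC_indefinite:
  assumes "\<And>x y. set_integrable lborel {x..y} v"
  shows "AC (\<lambda>x. if 0 \<le> x then (LBINT s:{0..x}. v s) else - (LBINT s:{x..0}. v s)) v"
  unfolding AC_def
proof (intro allI impI conjI assms)
  fix x y :: real assume xy: "x \<le> y"
  let ?u = "\<lambda>x. if 0 \<le> x then (LBINT s:{0..x}. v s) else - (LBINT s:{x..0}. v s)"
  consider "0 \<le> x" | "x < 0" "0 \<le> y" | "y < 0" by linarith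
  then show "?u y - ?u x = (LBINT s:{x..y}. v s)"
  proof cases
    case 1
    then show ?thesis using set_integral_split[of 0 y v x] xy assms by auto
  next
    case 2
    then show ?thesis using set_integral_split[of x y v 0] xy assms by auto
  next
    case 3
    then show ?thesis using set_integral_split[of x 0 v y] xy assms by auto
  qed
qed

lemma continuous_on_indefinite:
  fixes v :: "real \<Rightarrow> real"
  assumes "set_integrable lborel {a..b} v"
  shows "continuous_on {a..b} (\<lambda>x. LBINT s:{a..x}. v s)"
proof -
  have "v integrable_on {a..b}" using set_borel_integral_eq_integral[OF assms] by simp
  then have "continuous_on {a..b} (\<lambda>x. integral {a..x} v)"
    by (rule indefinite_integral_continuous_1)
  moreover have "(LBINT s:{a..x}. v s) = integral {a..x} v" if "x \<in> {a..b}" for x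
    using that assms by (intro set_borel_integral_eq_integral) (auto intro: set_integrable_subset)
  ultimately show ?thesis by (metis (no_types, lifting) continuous_on_cong)
qed

lemma AC_continuous:
  assumes "AC u v" shows "continuous_on UNIV u"
proof (rule continuous_at_imp_continuous_on, intro ballI)
  fix x :: real
  have "continuous_on {x-1..x+1} u"
  proof -
    have "continuous_on {x-1..x+1} (\<lambda>y. u (x-1) + (LBINT s:{x-1..y}. v s))"
      by (intro continuous_intros continuous_on_indefinite AC_integrable[OF assms])
    moreover have "u (x-1) + (LBINT s:{x-1..y}. v s) = u y" if "y \<in> {x-1..x+1}" for y
      using AC_diff[OF assms, of "x-1" y] that by simp
    ultimately show ?thesis by (metis (no_types, lifting) continuous_on_cong)
  qed
  then show "isCont u x"
    by (rule continuous_on_interior) auto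
qed

section \<open>Chain and product rules for absolutely continuous functions\<close>

definition loc_lipschitz :: "(real \<Rightarrow> real) \<Rightarrow> bool" where
  "loc_lipschitz g \<longleftrightarrow> (\<forall>R. \<exists>L. \<forall>x y. \<bar>x\<bar> \<le> R \<longrightarrow> \<bar>y\<bar> \<le> R \<longrightarrow> \<bar>g x - g y\<bar> \<le> L * \<bar>x - y\<bar>)"

lemma loc_lipschitz_continuous:
  assumes "loc_lipschitz g" shows "continuous_on UNIV g"
proof (rule continuous_at_imp_continuous_on, intro ballI)
  fix x :: real
  obtain L where L: "\<And>a b. \<bar>a\<bar> \<le> \<bar>x\<bar> + 1 \<Longrightarrow> \<bar>b\<bar> \<le> \<bar>x\<bar> + 1 \<Longrightarrow> \<bar>g a - g b\<bar> \<le> L * \<bar>a - b\<bar>"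
    using assms unfolding loc_lipschitz_def by blast
  have "(max L 0)-lipschitz_on {x-1..x+1} g"
  proof (rule lipschitz_onI)
    fix a b assume "a \<in> {x-1..x+1}" "b \<in> {x-1..x+1}"
    then have "\<bar>g a - g b\<bar> \<le> L * \<bar>a - b\<bar>" by (intro L) auto
    also have "\<dots> \<le> max L 0 * \<bar>a - b\<bar>" by (intro mult_right_mono) auto
    finally show "dist (g a) (g b) \<le> max L 0 * dist a b" by (simp add: dist_real_def)
  qed auto
  then have "continuous_on {x-1..x+1} g" by (rule lipschitz_on_continuous_on)
  then show "isCont g x"
    by (rule continuous_on_interior) auto
qed

lemma set_integrable_continuous_mult:
  fixes g v :: "real \<Rightarrow> real"
  assumes "set_integrable lborel {x..y} v" "continuous_on UNIV g"
  shows "set_integrable lborel {x..y} (\<lambda>s. g s * v s)"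
proof -
  have "compact (g ` {x..y})"
    using assms(2) by (intro compact_continuous_image) (auto intro: continuous_on_subset)
  then obtain M where M: "\<And>s. s \<in> {x..y} \<Longrightarrow> \<bar>g s\<bar> \<le> M"
    using compact_imp_bounded bounded_real by (metis imageI)
  have gm: "g \<in> borel_measurable borel" using assms(2) by (rule borel_measurable_continuous_onI)
  have "integrable lborel (\<lambda>s. \<bar>M\<bar> * norm (indicator {x..y} s *\<^sub>R v s))"
    using assms(1) unfolding set_integrable_def by (intro integrable_mult_right integrable_norm)
  then have "integrable lborel (\<lambda>s. g s * (indicator {x..y} s *\<^sub>R v s))"
  proof (rule Bochner_Integration.integrable_bound)
    show "(\<lambda>s. g s * (indicator {x..y} s *\<^sub>R v s)) \<in> borel_measurable lborel"
      using borel_measurable_integrable[OF assms(1)[unfolded set_integrable_def]] gm by measurable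
    have "norm (g s * (indicator {x..y} s *\<^sub>R v s)) \<le> norm (\<bar>M\<bar> * norm (indicator {x..y} s *\<^sub>R v s))" for s
      using M[of s] by (auto simp: indicator_def abs_mult intro!: mult_right_mono)
    then show "AE s in lborel. norm (g s * (indicator {x..y} s *\<^sub>R v s)) \<le> norm (\<bar>M\<bar> * norm (indicator {x..y} s *\<^sub>R v s))"
      by simp
  qed
  then show ?thesis unfolding set_integrable_def by (simp add: mult_ac)
qed

text \<open>With V the integral of \<bar>v\<bar>, the mean value theorem writes the increment of
  \<open>w (u x)\<close> over [x, y] as \<open>w' \<xi>\<close> times the integral of v, and every
  \<open>u s\<close> in between is within \<open>V y - V x\<close> of \<xi>. Since \<open>w'\<close>
  is locally Lipschitz, the error against the integral of \<open>w' (u s) * v s\<close> is quadratic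
  in the increment of V.\<close>

lemma AC_chain:
  assumes u: "AC u v"
    and w: "\<And>x. (w has_real_derivative w' x) (at x)"
    and L: "loc_lipschitz w'"
  shows "AC (\<lambda>x. w (u x)) (\<lambda>x. w' (u x) * v x)"
  unfolding AC_def
proof (intro allI impI conjI)
  fix a b :: real assume ab: "a \<le> b"
  have uc: "continuous_on UNIV u" by (rule AC_continuous[OF u])
  have w'c: "continuous_on UNIV w'" by (rule loc_lipschitz_continuous[OF L])
  have "continuous_on UNIV (\<lambda>x. w' (u x))"
    using continuous_on_compose[OF uc, of w'] w'c by (auto simp: o_def intro: continuous_on_subset)
  then have int: "set_integrable lborel {x..y} (\<lambda>x. w' (u x) * v x)" for x y
    by (intro set_integrable_continuous_mult AC_integrable[OF u])
  show "set_integrable lborel {a..b} (\<lambda>x. w' (u x) * v x)" by (rule int)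
  define V where "V x = (LBINT s:{a..x}. \<bar>v s\<bar>)" for x
  have absi: "set_integrable lborel {x..y} (\<lambda>s. \<bar>v s\<bar>)" for x y
    using AC_integrable[OF u] by (rule set_integrable_abs)
  have Vd: "V y - V x = (LBINT s:{x..y}. \<bar>v s\<bar>)" if "a \<le> x" "x \<le> y" for x y
    unfolding V_def using set_integral_split[OF absi that] by simp
  have uV: "\<bar>u y - u x\<bar> \<le> V y - V x" if "a \<le> x" "x \<le> y" for x y
    using AC_bound[OF u that(2)] Vd[OF that] by simp
  have Vmono: "V x \<le> V y" if "a \<le> x" "x \<le> y" for x y using uV[OF that] by linarith
  define R where "R = \<bar>u a\<bar> + V b"
  have uR: "\<bar>u x\<bar> \<le> R" if "x \<in> {a..b}" for x
  proof -
    have "V a \<ge> 0" unfolding V_def set_lebesgue_integral_def by (intro integral_nonneg_AE) auto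
    then show ?thesis using uV[of a x] Vmono[of x b] that by (auto simp: R_def)
  qed
  obtain L0 where L0: "\<And>x y. \<bar>x\<bar> \<le> R \<Longrightarrow> \<bar>y\<bar> \<le> R \<Longrightarrow> \<bar>w' x - w' y\<bar> \<le> L0 * \<bar>x - y\<bar>"
    using L unfolding loc_lipschitz_def by blast
  define D where "D x = w (u x) - (LBINT s:{a..x}. w' (u s) * v s)" for x
  have "D a = D b"
  proof (rule quadratic_increment_imp_eq[OF ab, where V = V and C = "\<bar>L0\<bar>"])
    show "continuous_on {a..b} V"
      unfolding V_def by (rule continuous_on_indefinite[OF absi])
    show "V x \<le> V y" if "a \<le> x" "x \<le> y" for x y by (rule Vmono[OF that])
    fix x y assume xy: "a \<le> x" "x \<le> y" "y \<le> b"
    have "\<exists>\<xi>. w (u y) - w (u x) = w' \<xi> * (u y - u x) \<and> min (u x) (u y) \<le> \<xi> \<and> \<xi> \<le> max (u x) (u y)"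
    proof (cases "u x" "u y" rule: linorder_cases)
      case less
      from MVT2[OF less w] obtain z where "u x < z" "z < u y" "w (u y) - w (u x) = (u y - u x) * w' z"
        by blast
      then show ?thesis by (intro exI[of _ z]) (auto simp: mult_ac)
    next
      case greater
      from MVT2[OF greater w] obtain z where "u y < z" "z < u x" "w (u x) - w (u y) = (u x - u y) * w' z"
        by blast
      then show ?thesis by (intro exI[of _ z]) (auto simp: algebra_simps)
    qed auto
    then obtain \<xi> where xi: "w (u y) - w (u x) = w' \<xi> * (u y - u x)" "min (u x) (u y) \<le> \<xi>" "\<xi> \<le> max (u x) (u y)"
      by blast
    have wv: "set_integrable lborel {x..y} (\<lambda>s. w' \<xi> * v s)"
      by (rule set_integrable_mult_right, rule AC_integrable[OF u])
    note di = set_integral_diff(1)[OF wv int]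
    have "D y - D x = (w (u y) - w (u x)) - (LBINT s:{x..y}. w' (u s) * v s)"
      unfolding D_def using set_integral_split[OF int xy(1,2)] by simp
    also have "w (u y) - w (u x) = (LBINT s:{x..y}. w' \<xi> * v s)"
      by (simp add: xi(1) AC_diff[OF u xy(2)] set_integral_mult_right)
    also have "\<dots> - (LBINT s:{x..y}. w' (u s) * v s) = (LBINT s:{x..y}. w' \<xi> * v s - w' (u s) * v s)"
      by (rule set_integral_diff(2)[symmetric, OF wv int])
    also have "\<bar>\<dots>\<bar> \<le> (LBINT s:{x..y}. \<bar>w' \<xi> * v s - w' (u s) * v s\<bar>)"
      using set_integral_norm_bound[OF di] by simp
    also have "\<dots> \<le> (LBINT s:{x..y}. (\<bar>L0\<bar> * (V y - V x)) * \<bar>v s\<bar>)"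
    proof (rule set_integral_mono)
      fix s assume s: "s \<in> {x..y}"
      have us: "\<bar>u s - u x\<bar> \<le> V y - V x" "\<bar>u y - u s\<bar> \<le> V y - V x"
        using uV[of x s] uV[of s y] Vmono[of x s] Vmono[of s y] s xy by auto
      then have d: "\<bar>\<xi> - u s\<bar> \<le> V y - V x" using xi(2,3) by linarith
      have "\<bar>\<xi>\<bar> \<le> R" using xi(2,3) uR[of x] uR[of y] xy by auto
      moreover have "\<bar>u s\<bar> \<le> R" using uR[of s] s xy by auto
      ultimately have "\<bar>w' \<xi> - w' (u s)\<bar> \<le> L0 * \<bar>\<xi> - u s\<bar>" by (rule L0)
      also have "\<dots> \<le> \<bar>L0\<bar> * \<bar>\<xi> - u s\<bar>" by (intro mult_right_mono) auto
      also have "\<dots> \<le> \<bar>L0\<bar> * (V y - V x)" using d by (intro mult_left_mono) auto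
      finally have "\<bar>w' \<xi> - w' (u s)\<bar> * \<bar>v s\<bar> \<le> \<bar>L0\<bar> * (V y - V x) * \<bar>v s\<bar>"
        by (intro mult_right_mono) auto
      then show "\<bar>w' \<xi> * v s - w' (u s) * v s\<bar> \<le> \<bar>L0\<bar> * (V y - V x) * \<bar>v s\<bar>"
        by (simp flip: abs_mult left_diff_distrib)
    next
      show "set_integrable lborel {x..y} (\<lambda>s. \<bar>w' \<xi> * v s - w' (u s) * v s\<bar>)"
        by (rule set_integrable_abs[OF di])
      show "set_integrable lborel {x..y} (\<lambda>s. \<bar>L0\<bar> * (V y - V x) * \<bar>v s\<bar>)"
        by (rule set_integrable_mult_right, rule absi)
    qed
    also have "\<dots> = \<bar>L0\<bar> * (V y - V x)^2"
      by (simp add: set_integral_mult_right Vd[OF xy(1,2)] power2_eq_square)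
    finally show "\<bar>D y - D x\<bar> \<le> \<bar>L0\<bar> * (V y - V x)^2" .
  qed
  moreover have "(LBINT s:{a..a}. w' (u s) * v s) = 0"
    using set_integral_split[OF int, of a a a] by simp
  ultimately show "w (u b) - w (u a) = (LBINT s:{a..b}. w' (u s) * v s)"
    unfolding D_def by simp
qed

text \<open>Polarisation, with the chain rule for squares.\<close>

lemma AC_mult:
  assumes u: "AC u v" and f: "AC f g"
  shows "AC (\<lambda>x. u x * f x) (\<lambda>x. u x * g x + v x * f x)"
proof -
  have sq: "AC (\<lambda>x. (a x)^2) (\<lambda>x. 2 * a x * b x)" if "AC a b" for a b
  proof -
    have "AC (\<lambda>x. (a x)^2) (\<lambda>x. (2 * a x) * b x)"
    proof (rule AC_chain[OF that])
      show "((\<lambda>x. x^2) has_real_derivative 2 * x) (at x)" for x :: real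
        by (auto intro!: derivative_eq_intros)
      show "loc_lipschitz (\<lambda>x. 2 * x)"
        unfolding loc_lipschitz_def by (intro allI exI[of _ 2]) (auto simp: abs_if)
    qed
    then show ?thesis by (simp add: mult_ac)
  qed
  have "AC (\<lambda>x. 1/2 * ((u x + f x)^2 - (u x)^2 - (f x)^2))
      (\<lambda>x. 1/2 * (2 * (u x + f x) * (v x + g x) - 2 * u x * v x - 2 * f x * g x))"
    by (intro AC_scale AC_minus sq AC_add u f)
  moreover have "(\<lambda>x. 1/2 * ((u x + f x)^2 - (u x)^2 - (f x)^2)) = (\<lambda>x. u x * f x)"
    by (auto simp: power2_eq_square algebra_simps)
  moreover have "(\<lambda>x. 1/2 * (2 * (u x + f x) * (v x + g x) - 2 * u x * v x - 2 * f x * g x)) =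
     (\<lambda>x. u x * g x + v x * f x)"
    by (auto simp: algebra_simps)
  ultimately show ?thesis by simp
qed

lemma AC_C1:
  assumes "\<And>x. (f has_real_derivative g x) (at x)" "continuous_on UNIV g"
  shows "AC f g"
  unfolding AC_def
proof (intro allI impI conjI)
  fix x y :: real assume xy: "x \<le> y"
  show i: "set_integrable lborel {x..y} g"
    using assms(2) by (intro borel_integrable_atLeastAtMost') (auto intro: continuous_on_subset)
  have "(g has_integral f y - f x) {x..y}"
    using assms(1) xy by (intro fundamental_theorem_of_calculus)
      (auto simp flip: has_real_derivative_iff_has_vector_derivative intro: has_field_derivative_at_within)
  then show "f y - f x = (LBINT s:{x..y}. g s)"
    by (simp add: set_borel_integral_eq_integral[OF i] integral_unique)
qed

lemma AC_has_derivative: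
  assumes "AC u v" "continuous_on UNIV v"
  shows "(u has_real_derivative v x) (at x)"
proof -
  have "((\<lambda>y. integral {x-1..y} v) has_real_derivative v x) (at x within {x-1..x+1})"
    using assms(2) by (intro integral_has_real_derivative) (auto intro: continuous_on_subset)
  then have 1: "((\<lambda>y. u (x-1) + integral {x-1..y} v) has_real_derivative v x) (at x within {x-1..x+1})"
    by (auto intro!: derivative_eq_intros)
  have 2: "u (x-1) + integral {x-1..y} v = u y" if "y \<in> {x-1..x+1}" for y
    using AC_diff[OF assms(1), of "x-1" y] that set_borel_integral_eq_integral[OF AC_integrable[OF assms(1)], of "x-1" y]
    by simp
  have "(u has_real_derivative v x) (at x within {x-1..x+1})"
    by (rule has_field_derivative_transform_within[OF 1 zero_less_one]) (auto intro!: 2)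
  moreover have "at x within {x-1..x+1} = at x"
    by (rule at_within_interior) auto
  ultimately show ?thesis by simp
qed

section \<open>Test functions and weak derivatives\<close>

lemma has_real_derivative_imp_differentiable:
  "(f has_real_derivative D) (at x) \<Longrightarrow> f differentiable (at x)"
  by (auto simp: real_differentiable_def)

definition smooth :: "(real \<Rightarrow> real) \<Rightarrow> bool" where
  "smooth f \<longleftrightarrow> (\<forall>k x. ((deriv ^^ k) f) differentiable (at x))"

lemma smooth_deriv: "smooth f \<Longrightarrow> (f has_real_derivative deriv f x) (at x)" "smooth f \<Longrightarrow> smooth (deriv f)"
proof -
  assume f: "smooth f"
  have "f differentiable (at x)" using f unfolding smooth_def by (metis funpow_0)
  then show "(f has_real_derivative deriv f x) (at x)"
    by (simp add: DERIV_deriv_iff_real_differentiable)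
  have "(deriv ^^ k) (deriv f) = (deriv ^^ Suc k) f" for k by (simp only: funpow_Suc_right o_def)
  then show "smooth (deriv f)" using f unfolding smooth_def by metis
qed

lemma smooth_continuous: "smooth f \<Longrightarrow> continuous_on UNIV f"
  using smooth_deriv(1) by (intro DERIV_continuous_on) (auto intro: has_field_derivative_at_within)

lemma smooth_antideriv:
  assumes "\<And>x. (f has_real_derivative g x) (at x)" "smooth g"
  shows "smooth f"
  unfolding smooth_def
proof (intro allI)
  fix k x
  have df: "deriv f = g" using assms(1) DERIV_imp_deriv by blast
  show "(deriv ^^ k) f differentiable at x"
  proof (cases k)
    case 0
    then show ?thesis using assms(1) real_differentiable_def by auto
  next
    case (Suc j)
    then have "(deriv ^^ k) f = (deriv ^^ j) g" by (simp only: funpow_Suc_right o_def df)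
    then show ?thesis using assms(2) unfolding smooth_def by simp
  qed
qed

text \<open>Dilation and translation are part of the statement so that the k-th derivative keeps
  this shape, with a factor \<open>p^k\<close>, and the induction over k closes. Repeated use gives
  the steep ramps from which test functions are built.\<close>

lemma smooth_affine_combination:
  assumes f: "smooth f" and g: "smooth g"
  shows "smooth (\<lambda>x. a * f (p * x + q) + b * g x)"
proof -
  have F: "((deriv ^^ k) f has_real_derivative (deriv ^^ Suc k) f x) (at x)" for k x
    using f unfolding smooth_def by (simp add: DERIV_deriv_iff_real_differentiable)
  have G: "((deriv ^^ k) g has_real_derivative (deriv ^^ Suc k) g x) (at x)" for k x
    using g unfolding smooth_def by (simp add: DERIV_deriv_iff_real_differentiable)
  have D: "((\<lambda>x. a * p^k * (deriv ^^ k) f (p * x + q) + b * (deriv ^^ k) g x) has_real_derivative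
      a * p^Suc k * (deriv ^^ Suc k) f (p * x + q) + b * (deriv ^^ Suc k) g x) (at x)" for k x
  proof -
    have "((\<lambda>x. p * x + q) has_real_derivative p) (at x)" by (auto intro!: derivative_eq_intros)
    from DERIV_cmult[OF DERIV_chain2[OF F this], of "a * p^k" k] DERIV_cmult[OF G[of k x], of b]
    show ?thesis by (auto dest: DERIV_add simp: mult_ac simp del: funpow.simps)
  qed
  have "(deriv ^^ k) (\<lambda>x. a * f (p * x + q) + b * g x)
     = (\<lambda>x. a * p^k * (deriv ^^ k) f (p * x + q) + b * (deriv ^^ k) g x)" for k
  proof (induction k)
    case (Suc k)
    have "(deriv ^^ Suc k) (\<lambda>x. a * f (p * x + q) + b * g x)
      = deriv (\<lambda>x. a * p^k * (deriv ^^ k) f (p * x + q) + b * (deriv ^^ k) g x)"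
      using Suc by simp
    also have "\<dots> = (\<lambda>x. a * p^Suc k * (deriv ^^ Suc k) f (p * x + q) + b * (deriv ^^ Suc k) g x)"
      using D[THEN DERIV_imp_deriv] by blast
    finally show ?case .
  qed simp
  then show ?thesis
    unfolding smooth_def by (auto simp only: intro!: has_real_derivative_imp_differentiable[OF D])
qed

lemma smooth_zero: "smooth (\<lambda>x. 0)"
proof -
  have "(deriv ^^ k) (\<lambda>x::real. 0::real) = (\<lambda>x. 0)" for k by (induction k) auto
  then show ?thesis unfolding smooth_def by simp
qed

text \<open>A family containing \<open>exp (- 1 / (x * (1 - x)))\<close> and closed under derivatives.\<close>

definition bump_fam :: "real poly \<Rightarrow> nat \<Rightarrow> real \<Rightarrow> real" where
  "bump_fam p k x = (if 0 < x \<and> x < 1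
     then poly p x * inverse (x * (1 - x)) ^ k * exp (- inverse (x * (1 - x))) else 0)"

lemma power_exp_bound:
  fixes s :: real assumes "s > 0" "n > 0"
  shows "s ^ n * exp (- s) \<le> real n ^ n"
proof -
  have "s / n \<le> exp (s / n)" using exp_ge_add_one_self[of "s / n"] by linarith
  then have "(s / n) ^ n \<le> exp (s / n) ^ n" using assms by (intro power_mono) auto
  also have "\<dots> = exp s" using assms by (simp flip: exp_of_nat_mult)
  finally have "s ^ n \<le> real n ^ n * exp s" using assms by (simp add: power_divide field_simps)
  then show ?thesis by (simp add: exp_minus field_simps)
qed

text \<open>With \<open>q = y * (1 - y)\<close>, which is at most \<open>\<bar>y - x\<bar>\<close>,
  the exponential absorbs two powers of \<open>1 / q\<close> beyond the k present, leaving
  \<open>q^2\<close>. Contact of second order with 0 gives the derivative 0 at the end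
  points.\<close>

lemma bump_fam_bound:
  obtains K where "K \<ge> 0" "\<And>x y. x \<le> 0 \<or> 1 \<le> x \<Longrightarrow> \<bar>bump_fam p k y\<bar> \<le> K * (y - x)^2"
proof -
  have "bounded (poly p ` {0..1})"
    by (intro compact_imp_bounded compact_continuous_image continuous_intros compact_Icc)
  then obtain M where M: "\<And>y. y \<in> {0..1} \<Longrightarrow> \<bar>poly p y\<bar> \<le> M"
    unfolding bounded_real by blast
  have M0: "M \<ge> 0" using M[of 0] by auto
  let ?n = "k + 2"
  show thesis
  proof (rule that[of "M * real ?n ^ ?n"])
    fix x y :: real assume x: "x \<le> 0 \<or> 1 \<le> x"
    show "\<bar>bump_fam p k y\<bar> \<le> M * real ?n ^ ?n * (y - x)^2"
    proof (cases "0 < y \<and> y < 1")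
      case True
      define q where "q = y * (1 - y)"
      have q: "q > 0" using True by (simp add: q_def)
      have qy: "q \<le> \<bar>y - x\<bar>"
      proof -
        have "q \<le> y" "q \<le> 1 - y" using True unfolding q_def
          by (auto intro: mult_left_le mult_left_le_one_le)
        then show ?thesis using x by linarith
      qed
      have "inverse q ^ k * exp (- inverse q) = q^2 * (inverse q ^ ?n * exp (- inverse q))"
        using q by (simp add: power_add power2_eq_square field_simps)
      also have "\<dots> \<le> q^2 * real ?n ^ ?n"
        using power_exp_bound[of "inverse q" ?n] q by (intro mult_left_mono) auto
      also have "\<dots> \<le> (y - x)^2 * real ?n ^ ?n"
        using qy q by (intro mult_right_mono) (auto simp: abs_le_square_iff[symmetric])
      finally have e: "inverse q ^ k * exp (- inverse q) \<le> (y - x)^2 * real ?n ^ ?n" .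
      have "\<bar>bump_fam p k y\<bar> = \<bar>poly p y\<bar> * (inverse q ^ k * exp (- inverse q))"
        using True q by (simp add: bump_fam_def q_def[symmetric] abs_mult)
      also have "\<dots> \<le> M * ((y - x)^2 * real ?n ^ ?n)"
        by (rule mult_mono[OF _ e]) (use M[of y] True M0 q in auto)
      finally show ?thesis by (simp add: mult_ac)
    qed (use M0 in \<open>auto simp: bump_fam_def\<close>)
  qed (use M0 in simp)
qed

lemma bump_fam_deriv:
  "\<exists>p' k'. \<forall>x. (bump_fam p k has_real_derivative bump_fam p' k' x) (at x)"
proof -
  define Q where "Q = [:0, 1, -1::real:]"
  \<comment> \<open>The numerator when the derivative of \<open>p * Q^(-k) * exp (- 1 / Q)\<close>
    is written over the common denominator \<open>Q^(k + 2)\<close>.\<close>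
  define p' where "p' = pderiv p * Q^2 - of_nat k * p * pderiv Q * Q + p * pderiv Q"
  have Q: "poly Q x = x * (1 - x)" for x by (simp add: Q_def algebra_simps)
  have Q': "poly (pderiv Q) x = 1 - 2 * x" for x by (simp add: Q_def pderiv_pCons)
  have "(bump_fam p k has_real_derivative bump_fam p' (k + 2) x) (at x)" for x
  proof (cases "0 < x \<and> x < 1")
    case True
    define q where "q = x * (1 - x)"
    have q: "q > 0" using True by (simp add: q_def)
    have qi: "((\<lambda>y. inverse (y * (1 - y))) has_real_derivative - ((1 - 2 * x) * inverse q ^ 2)) (at x)"
    proof -
      have "((\<lambda>y. y * (1 - y)) has_real_derivative 1 - 2 * x) (at x)"
        by (auto intro!: derivative_eq_intros)
      from DERIV_inverse_fun[OF this] show ?thesis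
        using True by (auto simp add: q_def power2_eq_square mult_ac)
    qed
    have pw: "((\<lambda>y. inverse (y * (1 - y)) ^ k) has_real_derivative
       - (real k * (1 - 2 * x) * inverse q ^ Suc k)) (at x)"
    proof (cases k)
      case (Suc j)
      then show ?thesis
        using DERIV_power[OF qi, of k] by (simp add: q_def[symmetric] power2_eq_square mult_ac)
    qed simp
    let ?I = "\<lambda>j. inverse q ^ j" and ?e = "exp (- inverse q)" and ?q' = "1 - 2 * x"
      and ?p = "poly p x" and ?p' = "poly (pderiv p) x"
    have "((\<lambda>y. poly p y * inverse (y * (1 - y)) ^ k * exp (- inverse (y * (1 - y)))) has_real_derivative
       (?p' * ?I k + ?p * - (real k * ?q' * ?I (Suc k))) * ?e + ?p * ?I k * (?e * (?q' * ?I 2))) (at x)"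
      by (rule derivative_eq_intros poly_DERIV pw qi refl)+ (simp add: q_def mult_ac)
    also have "(?p' * ?I k + ?p * - (real k * ?q' * ?I (Suc k))) * ?e + ?p * ?I k * (?e * (?q' * ?I 2))
      = bump_fam p' (k + 2) x"
    proof -
      have AB: "?I k = q^2 * ?I (k + 2)" "?I (Suc k) = q * ?I (k + 2)"
        using q by (auto simp: power_add power2_eq_square field_simps)
      have C: "?I k * ?I 2 = ?I (k + 2)" by (simp only: power_add)
      have "(?p' * ?I k + ?p * - (real k * ?q' * ?I (Suc k))) * ?e + ?p * ?I k * (?e * (?q' * ?I 2))
        = (?p' * ?I k + ?p * - (real k * ?q' * ?I (Suc k))) * ?e + ?p * (?e * (?q' * (?I k * ?I 2)))"
        by (simp only: mult_ac)
      also have "\<dots> = (?p' * (q^2 * ?I (k + 2)) + ?p * - (real k * ?q' * (q * ?I (k + 2)))) * ?e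
          + ?p * (?e * (?q' * ?I (k + 2)))"
        unfolding C unfolding AB ..
      also have "\<dots> = bump_fam p' (k + 2) x"
        using True unfolding bump_fam_def p'_def
        by (simp add: Q Q' q_def[symmetric]) (simp add: algebra_simps)
      finally show ?thesis .
    qed
    finally show ?thesis
      by (rule has_field_derivative_transform_within_open[of _ _ _ "{0<..<1}"])
        (use True in \<open>auto simp: bump_fam_def\<close>)
  next
    case False
    then have x: "x \<le> 0 \<or> 1 \<le> x" by auto
    obtain K where K: "K \<ge> 0" "\<And>y. \<bar>bump_fam p k y\<bar> \<le> K * (y - x)^2"
      using bump_fam_bound[of p k] x by metis
    have z: "bump_fam p k x = 0" "bump_fam p' (k + 2) x = 0" using False by (auto simp: bump_fam_def)
    have "((\<lambda>h. (bump_fam p k (x + h) - bump_fam p k x) / h) \<longlongrightarrow> 0) (at 0)"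
    proof (rule Lim_null_comparison)
      have "norm ((bump_fam p k (x + h) - bump_fam p k x) / h) \<le> K * \<bar>h\<bar>" if "h \<noteq> 0" for h
        using K(2)[of "x + h"] that z by (simp add: power2_eq_square abs_divide pos_divide_le_eq mult.assoc flip: abs_mult)
      then show "\<forall>\<^sub>F h in at 0. norm ((bump_fam p k (x + h) - bump_fam p k x) / h) \<le> K * \<bar>h\<bar>"
        by (simp add: eventually_at_filter)
      show "((\<lambda>h. K * \<bar>h\<bar>) \<longlongrightarrow> 0) (at (0::real))" by (auto intro!: tendsto_eq_intros)
    qed
    then show ?thesis using z by (simp add: DERIV_def)
  qed
  then show ?thesis by blast
qed

lemma smooth_bump_fam: "smooth (bump_fam p k)"
proof -
  have "\<exists>p' k'. (deriv ^^ n) (bump_fam p k) = bump_fam p' k'" for n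
  proof (induction n)
    case (Suc n)
    then obtain p' k' where "(deriv ^^ n) (bump_fam p k) = bump_fam p' k'" by blast
    moreover obtain p'' k'' where "\<And>x. (bump_fam p' k' has_real_derivative bump_fam p'' k'' x) (at x)"
      using bump_fam_deriv by blast
    then have "deriv (bump_fam p' k') = bump_fam p'' k''" using DERIV_imp_deriv by blast
    ultimately show ?case by auto
  qed auto
  then show ?thesis
    unfolding smooth_def using bump_fam_deriv has_real_derivative_imp_differentiable by metis
qed

lemma antiderivative_exists:
  assumes "continuous_on UNIV (g :: real \<Rightarrow> real)"
  obtains f where "\<And>x. (f has_real_derivative g x) (at x)" "f 0 = 0"
proof -
  have "AC (\<lambda>x. if 0 \<le> x then (LBINT s:{0..x}. g s) else - (LBINT s:{x..0}. g s)) g"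
    (is "AC ?f g")
    using assms by (intro AC_indefinite borel_integrable_atLeastAtMost') (auto intro: continuous_on_subset)
  from AC_has_derivative[OF this assms]
  have "((\<lambda>x. ?f x - ?f 0) has_real_derivative g x) (at x)" for x
    by (auto intro!: derivative_eq_intros)
  then show thesis by (intro that[of "\<lambda>x. ?f x - ?f 0"]) auto
qed

text \<open>\<rho> is a normalised bump, S the smooth step with derivative \<rho>, and P a smooth
  ramp with derivative S. The value \<open>P 1\<close> is left open because it cancels in
  differences of two ramps.\<close>

lemma smooth_step_exists:
  obtains P S \<rho> :: "real \<Rightarrow> real"
  where "smooth P" "smooth S" "smooth \<rho>"
    and "\<And>x. (P has_real_derivative S x) (at x)" "\<And>x. (S has_real_derivative \<rho> x) (at x)"
    and "\<And>x. x \<le> 0 \<Longrightarrow> P x = 0" "\<And>x. x \<ge> 1 \<Longrightarrow> P x = P 1 + (x - 1)"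
    and "\<And>x. x \<le> 0 \<Longrightarrow> S x = 0" "\<And>x. x \<ge> 1 \<Longrightarrow> S x = 1" "\<And>x. 0 \<le> S x \<and> S x \<le> 1"
    and "\<And>x. x \<le> 0 \<or> 1 \<le> x \<Longrightarrow> \<rho> x = 0"
proof -
  let ?b = "bump_fam 1 0"
  have bs: "smooth ?b" by (rule smooth_bump_fam)
  have b0: "?b x \<ge> 0" for x by (simp add: bump_fam_def)
  obtain S0 where S0: "\<And>x. (S0 has_real_derivative ?b x) (at x)" "S0 0 = 0"
    using antiderivative_exists[OF smooth_continuous[OF bs]] by blast
  have S0mono: "S0 x \<le> S0 y" if "x \<le> y" for x y
    using that S0(1) b0 by (meson DERIV_nonneg_imp_nondecreasing)
  have const: "f x = f y" if "x \<le> y" "\<And>z. x \<le> z \<Longrightarrow> z \<le> y \<Longrightarrow> (f has_real_derivative 0) (at z)" for f :: "real \<Rightarrow> real" and x y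
  proof (cases "x < y")
    case True
    have "continuous_on {x..y} f"
      using that(2) by (intro continuous_at_imp_continuous_on ballI DERIV_isCont[where D = 0]) auto
    from DERIV_isconst_end[OF True this] show ?thesis using that(2) by simp
  qed (use that in auto)
  have S0l: "S0 x = 0" if "x \<le> 0" for x
    using const[of x 0 S0] that S0(1) S0(2) by (metis bump_fam_def less_le_not_le order_trans)
  have S0r: "S0 x = S0 1" if "x \<ge> 1" for x
    using const[of 1 x S0] that S0(1) by (metis bump_fam_def less_le_not_le order_trans)
  have c: "S0 1 > 0"
  proof -
    obtain z where "0 < z" "z < 1" "S0 1 - S0 0 = (1 - 0) * ?b z"
      using MVT2[OF zero_less_one S0(1)] by auto
    then show ?thesis using S0(2) by (simp add: bump_fam_def)
  qed
  define S where "S x = S0 x / S0 1" for x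
  define \<rho> where "\<rho> x = ?b x / S0 1" for x
  have S: "(S has_real_derivative \<rho> x) (at x)" for x
    unfolding S_def \<rho>_def using S0(1) c by (auto intro!: derivative_eq_intros)
  have rs: "smooth \<rho>"
    using smooth_affine_combination[OF smooth_zero bs, where b = "1 / S0 1"] unfolding \<rho>_def by simp
  have Ss: "smooth S" by (rule smooth_antideriv[OF S rs])
  obtain P where P: "\<And>x. (P has_real_derivative S x) (at x)" "P 0 = 0"
    using antiderivative_exists[OF smooth_continuous[OF Ss]] by blast
  have Ps: "smooth P" by (rule smooth_antideriv[OF P(1) Ss])
  have Sl: "S x = 0" if "x \<le> 0" for x using S0l[OF that] by (simp add: S_def)
  have Sr: "S x = 1" if "x \<ge> 1" for x using S0r[OF that] c by (simp add: S_def)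
  have S01: "0 \<le> S x \<and> S x \<le> 1" for x
    using S0mono[of "min x 0" x] S0l[of "min x 0"] S0mono[of x "max x 1"] S0r[of "max x 1"] c
    by (auto simp: S_def)
  have Pl: "P x = 0" if "x \<le> 0" for x
    using const[of x 0 P] that P Sl by (metis order_trans)
  have Pr: "P x = P 1 + (x - 1)" if "x \<ge> 1" for x
  proof -
    have "P 1 - 1 = P x - x"
    proof (rule const[OF that])
      fix z :: real assume "1 \<le> z" "z \<le> x"
      then show "((\<lambda>x. P x - x) has_real_derivative 0) (at z)"
        using P(1)[of z] Sr[of z] by (auto intro!: derivative_eq_intros)
    qed
    then show ?thesis by simp
  qed
  have r0: "\<rho> x = 0" if "x \<le> 0 \<or> 1 \<le> x" for x using that by (auto simp: \<rho>_def bump_fam_def)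
  show thesis by (rule that[OF Ps Ss rs P(1) S Pl Pr Sl Sr S01 r0])
qed

section \<open>The lemma of du Bois-Reymond\<close>

text \<open>The positive and the negative part of g are densities of two measures that are finite
  and equal on all rays, hence equal. As \<open>ennreal\<close> cuts negative values to 0, equality
  of the densities forces g = 0.\<close>

lemma AE_eq_0_if_integral_rays_eq_0:
  fixes g :: "real \<Rightarrow> real"
  assumes g: "integrable lborel g" and z: "\<And>a. (LBINT x. g x * indicator {a<..} x) = 0"
  shows "AE x in lborel. g x = 0"
proof -
  have [measurable]: "g \<in> borel_measurable borel" using g by simp
  let ?M = "density lborel (\<lambda>x. ennreal (g x))" and ?N = "density lborel (\<lambda>x. ennreal (- g x))"
  have e: "emeasure ?M {a<..} = emeasure ?N {a<..} \<and> emeasure ?M {a<..} < \<infinity>" for a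
  proof -
    have i: "integrable lborel (\<lambda>x. g x * indicator {a<..} x)"
      using integrable_mult_indicator[of "{a<..}" lborel g] g by (simp add: mult.commute)
    have fin: "(\<integral>\<^sup>+x. ennreal (g x * indicator {a<..} x) \<partial>lborel) < \<infinity>"
      "(\<integral>\<^sup>+x. ennreal (- (g x * indicator {a<..} x)) \<partial>lborel) < \<infinity>"
      using i unfolding real_integrable_def by (auto simp: top.not_eq_extremum)
    have "enn2real (\<integral>\<^sup>+x. ennreal (g x * indicator {a<..} x) \<partial>lborel)
        = enn2real (\<integral>\<^sup>+x. ennreal (- (g x * indicator {a<..} x)) \<partial>lborel)"
      using real_lebesgue_integral_def[OF i] z[of a] by simp
    then have "(\<integral>\<^sup>+x. ennreal (g x * indicator {a<..} x) \<partial>lborel)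
        = (\<integral>\<^sup>+x. ennreal (- (g x * indicator {a<..} x)) \<partial>lborel)"
      using fin by (metis ennreal_enn2real infinity_ennreal_def)
    moreover have "emeasure ?M {a<..} = (\<integral>\<^sup>+x. ennreal (g x * indicator {a<..} x) \<partial>lborel)"
      by (subst emeasure_density) (auto intro!: nn_integral_cong simp: indicator_def)
    moreover have "emeasure ?N {a<..} = (\<integral>\<^sup>+x. ennreal (- (g x * indicator {a<..} x)) \<partial>lborel)"
      by (subst emeasure_density) (auto intro!: nn_integral_cong simp: indicator_def)
    ultimately show ?thesis using fin by simp
  qed
  have "?M = ?N"
    by (rule measure_eqI_lessThan[OF _ _ e[THEN conjunct2] e[THEN conjunct1]]) auto
  then have "AE x in lborel. ennreal (g x) = ennreal (- g x)"
    by (intro sigma_finite_measure.density_unique[OF lborel.sigma_finite_measure_axioms]) auto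
  then show ?thesis
    by eventually_elim (metis ennreal_eq_0_iff ennreal_neg linorder_le_cases neg_0_le_iff_le neg_le_0_iff_le order_antisym)
qed

text \<open>Restriction to \<open>{-real n..real n}\<close> makes h - c integrable and turns rays
  into intervals; countably many n cover the line.\<close>

lemma AE_const_if_interval_integrals:
  fixes h :: "real \<Rightarrow> real"
  assumes h: "\<And>x y. set_integrable lborel {x..y} h"
    and z: "\<And>x y. x \<le> y \<Longrightarrow> (LBINT s:{x..y}. h s) = (y - x) * c"
  shows "AE x in lborel. h x = c"
proof -
  have "AE x in lborel. indicator {-real n..real n} x * (h x - c) = 0" for n :: nat
  proof (rule AE_eq_0_if_integral_rays_eq_0)
    have hc: "set_integrable lborel {x..y} (\<lambda>x. h x - c)" for x y
      by (intro set_integral_diff(1) h borel_integrable_atLeastAtMost') auto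
    show "integrable lborel (\<lambda>x. indicator {-real n..real n} x * (h x - c))"
      using hc unfolding set_integrable_def by simp
    have zz: "(LBINT s:{x..y}. h s - c) = 0" if "x \<le> y" for x y
    proof -
      have "set_integrable lborel {x..y} (\<lambda>_. c)" by (intro borel_integrable_atLeastAtMost') auto
      from set_integral_diff(2)[OF h this] show ?thesis
        using z[OF that] that by (simp add: set_lebesgue_integral_def)
    qed
    fix a :: real
    show "(LBINT x. indicator {-real n..real n} x * (h x - c) * indicator {a<..} x) = 0"
    proof (cases "a < real n")
      case True
      let ?a = "max a (-real n)"
      have "(LBINT x. indicator {-real n..real n} x * (h x - c) * indicator {a<..} x)
          = (LBINT s:{?a..real n}. h s - c)"
        unfolding set_lebesgue_integral_def
      proof (rule integral_cong_AE)
        show "(\<lambda>x. indicator {-real n..real n} x * (h x - c) * indicator {a<..} x) \<in> borel_measurable lborel"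
          using borel_measurable_integrable[OF hc[unfolded set_integrable_def], of "- real n" "real n"] by simp
        show "(\<lambda>x. indicator {?a..real n} x *\<^sub>R (h x - c)) \<in> borel_measurable lborel"
          using borel_measurable_integrable[OF hc[unfolded set_integrable_def], of ?a "real n"] by simp
        show "AE x in lborel. indicator {-real n..real n} x * (h x - c) * indicator {a<..} x
           = indicator {?a..real n} x *\<^sub>R (h x - c)"
          using AE_lborel_singleton[of a] by eventually_elim (auto simp: indicator_def)
      qed
      also have "\<dots> = 0" using True by (intro zz) auto
      finally show ?thesis .
    next
      case False
      then have "indicator {-real n..real n} x * (h x - c) * indicator {a<..} x = 0" for x
        by (auto simp: indicator_def)
      from Bochner_Integration.integral_cong[OF refl this] show ?thesis by simp
    qed
  qed
  then have "AE x in lborel. \<forall>n::nat. indicator {-real n..real n} x * (h x - c) = 0"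
    by (subst AE_all_countable) blast
  then show ?thesis
  proof eventually_elim
    case (elim x)
    obtain n :: nat where "\<bar>x\<bar> \<le> real n" using real_arch_simple by blast
    then show ?case using elim[rule_format, of n] by (auto simp: indicator_def split: if_splits)
  qed
qed

lemma set_integral_eq_integral_of_support:
  fixes f :: "real \<Rightarrow> real"
  assumes "\<And>x. x \<notin> A \<Longrightarrow> f x = 0"
  shows "(LBINT x:A. f x) = (LBINT x. f x)"
  unfolding set_lebesgue_integral_def using assms
  by (intro Bochner_Integration.integral_cong) (auto simp: indicator_def)

lemma test_fun_smooth: "test_fun \<phi> \<Longrightarrow> smooth \<phi>"
  by (simp add: test_fun_def smooth_def)

lemma test_fun_support:
  assumes "test_fun \<phi>"
  obtains r where "r > 0" "\<And>x. r \<le> \<bar>x\<bar> \<Longrightarrow> \<phi> x = 0" "\<And>x. r \<le> \<bar>x\<bar> \<Longrightarrow> deriv \<phi> x = 0"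
proof -
  obtain r where r: "\<And>x. \<bar>x\<bar> > r \<Longrightarrow> \<phi> x = 0" using assms by (auto simp: test_fun_def)
  have "deriv \<phi> x = 0" if "\<bar>r\<bar> + 1 \<le> \<bar>x\<bar>" for x
  proof (rule DERIV_imp_deriv, rule has_field_derivative_transform_within_open)
    show "((\<lambda>_. 0) has_real_derivative 0) (at x)" by simp
    show "open (- {-\<bar>r\<bar>..\<bar>r\<bar>})" by (intro open_Compl closed_atLeastAtMost)
    show "x \<in> - {-\<bar>r\<bar>..\<bar>r\<bar>}" using that by auto
    show "0 = \<phi> y" if "y \<in> - {-\<bar>r\<bar>..\<bar>r\<bar>}" for y using r[of y] that by auto
  qed
  moreover have "\<phi> x = 0" if "\<bar>r\<bar> + 1 \<le> \<bar>x\<bar>" for x using r[of x] that by auto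
  ultimately show thesis by (intro that[of "\<bar>r\<bar> + 1"]) auto
qed

lemma test_funI:
  assumes "smooth \<phi>" "\<And>x. r < \<bar>x\<bar> \<Longrightarrow> \<phi> x = 0"
  shows "test_fun \<phi>"
  using assms by (auto simp: test_fun_def smooth_def)

lemma test_fun_deriv: assumes "test_fun \<phi>" shows "test_fun (deriv \<phi>)"
proof -
  obtain r where "\<And>x. r \<le> \<bar>x\<bar> \<Longrightarrow> deriv \<phi> x = 0" using test_fun_support[OF assms] by metis
  then show ?thesis using smooth_deriv(2)[OF test_fun_smooth[OF assms]] by (intro test_funI[of _ r]) auto
qed

lemma integrable_mult_test:
  fixes v g :: "real \<Rightarrow> real"
  assumes v: "\<And>x y. set_integrable lborel {x..y} v"
    and g: "continuous_on UNIV g" "\<And>x. r \<le> \<bar>x\<bar> \<Longrightarrow> g x = 0"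
  shows "integrable lborel (\<lambda>x. v x * g x)"
proof -
  have "set_integrable lborel {-r..r} (\<lambda>x. g x * v x)"
    by (rule set_integrable_continuous_mult[OF v g(1)])
  moreover have "indicator {-r..r} x *\<^sub>R (g x * v x) = v x * g x" for x
  proof (cases "x \<in> {-r..r}")
    case False
    then have "r \<le> \<bar>x\<bar>" by auto
    from g(2)[OF this] show ?thesis by simp
  qed simp
  ultimately show ?thesis unfolding set_integrable_def by (simp only:)
qed

text \<open>The product rule for \<open>u * \<phi>\<close>, integrated over an interval at whose
  ends \<phi> vanishes.\<close>

lemma AC_weak_deriv:
  assumes u: "AC u v" shows "weak_deriv u v"
  unfolding weak_deriv_def
proof (intro allI impI)
  fix \<phi> assume t: "test_fun \<phi>"
  note s = test_fun_smooth[OF t]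
  have c: "continuous_on UNIV \<phi>" "continuous_on UNIV (deriv \<phi>)"
    using smooth_continuous[OF s] smooth_continuous[OF smooth_deriv(2)[OF s]] .
  obtain r where r: "r > 0" "\<And>x. r \<le> \<bar>x\<bar> \<Longrightarrow> \<phi> x = 0" "\<And>x. r \<le> \<bar>x\<bar> \<Longrightarrow> deriv \<phi> x = 0"
    using test_fun_support[OF t] by blast
  have "AC \<phi> (deriv \<phi>)" by (rule AC_C1[OF smooth_deriv(1)[OF s] c(2)])
  from AC_diff[OF AC_mult[OF u this], of "-r" r]
  have "(LBINT x:{-r..r}. u x * deriv \<phi> x + v x * \<phi> x) = 0" using r by simp
  then have "(LBINT x. u x * deriv \<phi> x + v x * \<phi> x) = 0"
    using r by (subst (asm) set_integral_eq_integral_of_support) auto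
  moreover have "set_integrable lborel {x..y} u" for x y
    using AC_continuous[OF u] by (intro borel_integrable_atLeastAtMost') (auto intro: continuous_on_subset)
  then have "integrable lborel (\<lambda>x. u x * deriv \<phi> x)"
    by (rule integrable_mult_test[OF _ c(2) r(3)])
  moreover have "integrable lborel (\<lambda>x. v x * \<phi> x)"
    by (rule integrable_mult_test[OF AC_integrable[OF u] c(1) r(2)])
  ultimately show "(LBINT x. u x * deriv \<phi> x) = - (LBINT x. v x * \<phi> x)" by simp
qed

text \<open>The test function is a difference of two steep ramps, corrected by
  \<open>(b - a) * S\<close>; its derivative is nearly the indicator of [a, b] minus
  \<open>(b - a) * \<rho>\<close>. Testing h and letting the ramps steepen shows that the integral
  of h over [a, b] is \<open>(b - a) * c\<close>, where c is the integral of
  \<open>h * \<rho>\<close>.\<close>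

lemma du_bois_reymond:
  assumes h: "\<And>x y. set_integrable lborel {x..y} h"
    and z: "\<And>\<phi>. test_fun \<phi> \<Longrightarrow> (LBINT x. h x * deriv \<phi> x) = 0"
  shows "\<exists>c. AE x in lborel. h x = c"
proof -
  obtain P S \<rho> :: "real \<Rightarrow> real"
    where sm: "smooth P" "smooth S" "smooth \<rho>"
    and P: "\<And>x. (P has_real_derivative S x) (at x)" and S: "\<And>x. (S has_real_derivative \<rho> x) (at x)"
    and P0: "\<And>x. x \<le> 0 \<Longrightarrow> P x = 0" and P1: "\<And>x. x \<ge> 1 \<Longrightarrow> P x = P 1 + (x - 1)"
    and S0: "\<And>x. x \<le> 0 \<Longrightarrow> S x = 0" and S1: "\<And>x. x \<ge> 1 \<Longrightarrow> S x = 1" and S01: "\<And>x. 0 \<le> S x \<and> S x \<le> 1"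
    and r0: "\<And>x. x \<le> 0 \<or> 1 \<le> x \<Longrightarrow> \<rho> x = 0"
    using smooth_step_exists by blast
  define c where "c = (LBINT x. h x * \<rho> x)"
  have "(LBINT s:{a..b}. h s) = (b - a) * c" if ab: "a \<le> b" for a b
  proof -
    \<comment> \<open>A smooth substitute for the indicator of [a, b]. The dilation
      \<open>real n + 1\<close> is at least 1, so it vanishes outside [a, b + 1] for every
      n.\<close>
    define ch where "ch n x = S ((real n + 1) * (x - a)) - S ((real n + 1) * (x - b))" for n :: nat and x
    have chi0: "ch n x = 0" if "x \<notin> {a..b+1}" for n x
    proof (cases "x < a")
      case True
      then have "(real n + 1) * (x - a) \<le> 0" "(real n + 1) * (x - b) \<le> 0"
        using ab by (auto intro!: mult_nonneg_nonpos)
      then show ?thesis by (simp add: ch_def S0)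
    next
      case False
      then have x: "x - b \<ge> 1" "x - a \<ge> 1" using that ab by auto
      have "1 * 1 \<le> (real n + 1) * (x - a)" "1 * 1 \<le> (real n + 1) * (x - b)"
        using x by (intro mult_mono; auto)+
      then show ?thesis by (simp add: ch_def S1)
    qed
    have chr: "ch n x = 0" if "\<bar>a\<bar> + \<bar>b\<bar> + 2 \<le> \<bar>x\<bar>" for n x
      by (rule chi0) (use that in auto)
    have chib: "\<bar>ch n x\<bar> \<le> 1" for n x
      using S01[of "(real n + 1) * (x - a)"] S01[of "(real n + 1) * (x - b)"] unfolding ch_def by linarith
    have chic: "continuous_on UNIV (ch n)" for n
      unfolding ch_def
      by (intro continuous_on_diff continuous_on_compose2[OF smooth_continuous[OF sm(2)]] continuous_intros) auto
    have int: "(LBINT x. h x * ch n x) = (b - a) * c" for n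
    proof -
      let ?N = "real n + 1"
      \<comment> \<open>Far to the left every term is 0; far to the right the ramps differ by
        \<open>b - a\<close> after division by \<open>?N\<close>, which the correction cancels. So
        the support is compact.\<close>
      define \<phi> where "\<phi> x = (P (?N * (x - a)) - P (?N * (x - b))) / ?N - (b - a) * S x" for x
      have N: "?N > 0" by simp
      have s1: "smooth (\<lambda>x. (1/?N) * P (?N * x + (- ?N * a)) + (-(b - a)) * S x)"
        by (rule smooth_affine_combination[OF sm(1,2)])
      have "smooth (\<lambda>x. (-1/?N) * P (?N * x + (- ?N * b)) + 1 * ((1/?N) * P (?N * x + (- ?N * a)) + (-(b - a)) * S x))"
        by (rule smooth_affine_combination[OF sm(1) s1])
      also have "(\<lambda>x. (-1/?N) * P (?N * x + (- ?N * b)) + 1 * ((1/?N) * P (?N * x + (- ?N * a)) + (-(b - a)) * S x)) = \<phi>"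
        unfolding \<phi>_def by (rule ext) (simp add: right_diff_distrib diff_divide_distrib algebra_simps)
      finally have sphi: "smooth \<phi>" .
      have tphi: "test_fun \<phi>"
      proof (rule test_funI[OF sphi])
        fix x assume x: "\<bar>a\<bar> + \<bar>b\<bar> + 1 < \<bar>x\<bar>"
        show "\<phi> x = 0"
        proof (cases "x < 0")
          case True
          then have "?N * (x - a) \<le> 0" "?N * (x - b) \<le> 0" using x by (auto intro!: mult_nonneg_nonpos)
          then show ?thesis using True by (simp add: \<phi>_def S0 P0)
        next
          case False
          have "1 * 1 \<le> ?N * (x - a)" "1 * 1 \<le> ?N * (x - b)"
            using x False by (intro mult_mono; auto)+
          then have "P (?N * (x - a)) = P 1 + (?N * (x - a) - 1)" "P (?N * (x - b)) = P 1 + (?N * (x - b) - 1)"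
            by (intro P1; simp)+
          moreover have "S x = 1" using x False by (intro S1) auto
          moreover have "((P 1 + (?N * (x - a) - 1)) - (P 1 + (?N * (x - b) - 1))) / ?N = b - a"
            using N by (simp add: field_simps)
          ultimately show ?thesis unfolding \<phi>_def by simp
        qed
      qed
      have dP: "((\<lambda>x. P (?N * (x - q))) has_real_derivative S (?N * (x - q)) * ?N) (at x)" for q x
        by (rule DERIV_chain2[OF P]) (auto intro!: derivative_eq_intros)
      have "(\<phi> has_real_derivative ch n x - (b - a) * \<rho> x) (at x)" for x
      proof -
        have "(\<phi> has_real_derivative (S (?N * (x - a)) * ?N - S (?N * (x - b)) * ?N) / ?N - (b - a) * \<rho> x) (at x)"
          unfolding \<phi>_def
          by (rule DERIV_diff[OF DERIV_cdivide[OF DERIV_diff[OF dP dP]] DERIV_cmult[OF S]])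
        also have "(S (?N * (x - a)) * ?N - S (?N * (x - b)) * ?N) / ?N = ch n x"
          using N unfolding ch_def left_diff_distrib[symmetric] by simp
        finally show ?thesis .
      qed
      then have "deriv \<phi> x = ch n x - (b - a) * \<rho> x" for x by (rule DERIV_imp_deriv)
      then have "(LBINT x. h x * ch n x - (b - a) * (h x * \<rho> x)) = 0"
        using z[OF tphi] by (simp add: right_diff_distrib mult.left_commute)
      moreover have "integrable lborel (\<lambda>x. h x * ch n x)"
        by (rule integrable_mult_test[OF h chic chr])
      moreover have "integrable lborel (\<lambda>x. h x * \<rho> x)"
        by (rule integrable_mult_test[OF h smooth_continuous[OF sm(3)], where r = 1], rule r0) arith
      ultimately show ?thesis
        unfolding c_def by simp
    qed
    have "(\<lambda>n. LBINT x. h x * ch n x) \<longlonglongrightarrow> (LBINT x. indicator {a..b} x *\<^sub>R h x)"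
    proof (rule integral_dominated_convergence[where w = "\<lambda>x. norm (indicator {a..b+1} x *\<^sub>R h x)"])
      show "(\<lambda>x. indicator {a..b} x *\<^sub>R h x) \<in> borel_measurable lborel"
        using h[of a b] unfolding set_integrable_def by (rule borel_measurable_integrable)
      show "(\<lambda>x. h x * ch n x) \<in> borel_measurable lborel" for n
        by (intro borel_measurable_integrable integrable_mult_test[OF h chic chr])
      show "integrable lborel (\<lambda>x. norm (indicator {a..b+1} x *\<^sub>R h x))"
        using h[of a "b+1"] unfolding set_integrable_def by (rule integrable_norm)
      show "AE x in lborel. norm (h x * ch n x) \<le> norm (indicator {a..b+1} x *\<^sub>R h x)" for n
      proof (rule AE_I2)
        fix x
        show "norm (h x * ch n x) \<le> norm (indicator {a..b+1} x *\<^sub>R h x)"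
          using chi0[of x n] mult_left_mono[OF chib[of n x], of "\<bar>h x\<bar>"]
          by (cases "x \<in> {a..b+1}") (auto simp: abs_mult)
      qed
      have lim1: "(\<lambda>n. S ((real n + 1) * y)) \<longlonglongrightarrow> 1" if "y > 0" for y
      proof (rule tendsto_eventually)
        have "\<forall>\<^sub>F n in sequentially. real n \<ge> 1 / y" using filterlim_real_sequentially by (simp add: filterlim_at_top)
        then show "\<forall>\<^sub>F n in sequentially. S ((real n + 1) * y) = 1"
        proof eventually_elim
          case (elim n)
          then have "1 \<le> real n * y" using that by (simp add: field_simps)
          then show ?case using that by (intro S1) (simp add: algebra_simps)
        qed
      qed
      have lim0: "S ((real n + 1) * y) = 0" if "y < 0" for y n
        using that by (intro S0) (auto intro!: mult_nonneg_nonpos)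
      show "AE x in lborel. (\<lambda>n. h x * ch n x) \<longlonglongrightarrow> indicator {a..b} x *\<^sub>R h x"
        using AE_lborel_singleton[of a] AE_lborel_singleton[of b]
      proof eventually_elim
        case (elim x)
        consider "x < a" | "a < x" "x < b" | "b < x" using elim by linarith
        then have "(\<lambda>n. ch n x) \<longlonglongrightarrow> indicator {a..b} x"
        proof cases
          case 1
          then show ?thesis unfolding ch_def using ab by (simp add: lim0)
        next
          case 2
          then show ?thesis unfolding ch_def using lim1[of "x - a"] by (simp add: lim0)
        next
          case 3
          then show ?thesis unfolding ch_def
            using ab tendsto_diff[OF lim1[of "x - a"] lim1[of "x - b"]] by simp
        qed
        then have "(\<lambda>n. h x * ch n x) \<longlonglongrightarrow> h x * indicator {a..b} x" by (rule tendsto_mult_left)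
        then show ?case by (simp add: mult.commute)
      qed
    qed
    then have "(\<lambda>n::nat. (b - a) * c) \<longlonglongrightarrow> (LBINT s:{a..b}. h s)"
      by (simp add: int set_lebesgue_integral_def)
    then show ?thesis by (simp add: LIMSEQ_const_iff)
  qed
  from AE_const_if_interval_integrals[OF h this] show ?thesis by blast
qed

text \<open>Du Bois-Reymond leaves an additive constant; testing with a bump of nonzero integral
  shows that it is 0. This is what makes the W^{1,p} norm, with its choice by \<open>SOME\<close>,
  computable from any known derivative.\<close>

lemma weak_deriv_unique:
  assumes f: "weak_deriv f g1" "weak_deriv f g2"
    and g: "\<And>x y. set_integrable lborel {x..y} g1" "\<And>x y. set_integrable lborel {x..y} g2"
  shows "AE x in lborel. g1 x = g2 x"
proof -
  have z: "(LBINT x. (g1 x - g2 x) * \<phi> x) = 0" if t: "test_fun \<phi>" for \<phi>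
  proof -
    obtain r where r: "\<And>x. r \<le> \<bar>x\<bar> \<Longrightarrow> \<phi> x = 0" using test_fun_support[OF t] by metis
    note c = smooth_continuous[OF test_fun_smooth[OF t]]
    show ?thesis
      using f t integrable_mult_test[OF g(1) c r] integrable_mult_test[OF g(2) c r]
      by (simp add: weak_deriv_def left_diff_distrib)
  qed
  have "\<exists>c. AE x in lborel. g1 x - g2 x = c"
    by (rule du_bois_reymond) (use z test_fun_deriv g in \<open>auto intro!: set_integral_diff\<close>)
  then obtain c where c: "AE x in lborel. g1 x - g2 x = c" by blast
  let ?b = "bump_fam 1 0"
  have tb: "test_fun ?b" by (rule test_funI[OF smooth_bump_fam, of 1]) (auto simp: bump_fam_def)
  have bi: "integrable lborel ?b"
  proof -
    have "integrable lborel (\<lambda>x. 1 * ?b x)"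
      by (rule integrable_mult_test[OF _ smooth_continuous[OF smooth_bump_fam], where r = 1])
        (auto intro!: borel_integrable_atLeastAtMost' simp: bump_fam_def)
    then show ?thesis by simp
  qed
  have "0 = (LBINT x. (g1 x - g2 x) * ?b x)" using z[OF tb] by simp
  also have "\<dots> = (LBINT x. c * ?b x)"
  proof (rule integral_cong_AE)
    show "(\<lambda>x. (g1 x - g2 x) * ?b x) \<in> borel_measurable lborel"
      by (intro borel_measurable_integrable integrable_mult_test[where r = 1] set_integral_diff g
          smooth_continuous[OF smooth_bump_fam]) (auto simp: bump_fam_def)
    show "AE x in lborel. (g1 x - g2 x) * ?b x = c * ?b x" using c by eventually_elim simp
  qed (use bi in auto)
  finally have "c = 0 \<or> (LBINT x. ?b x) = 0" by simp
  moreover have "(LBINT x. ?b x) \<noteq> 0"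
  proof
    assume "(LBINT x. ?b x) = 0"
    moreover have "AE x in lborel. ?b x \<ge> 0" by (simp add: bump_fam_def)
    ultimately have ae: "AE x in lborel. ?b x = 0"
      using integral_nonneg_eq_0_iff_AE[OF bi] by simp
    have "AE x in lborel. x \<notin> {0<..<1::real}" using ae by eventually_elim (auto simp: bump_fam_def)
    then have "emeasure lborel {0<..<1::real} = 0"
      by (subst AE_iff_measurable[symmetric, where P = "\<lambda>x. x \<notin> {0<..<1::real}"]) auto
    then show False by simp
  qed
  ultimately show ?thesis using c by simp
qed

text \<open>The difference of f and an indefinite integral of g has weak derivative 0, so f is
  almost everywhere that integral plus a constant.\<close>

lemma weak_deriv_imp_AC:
  assumes f: "weak_deriv f g"
    and fi: "\<And>x y. set_integrable lborel {x..y} f" and g: "\<And>x y. set_integrable lborel {x..y} g"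
  obtains u where "AC u g" "AE x in lborel. u x = f x"
proof -
  obtain F where F: "AC F g" using AC_indefinite[OF g] by blast
  have Fi: "set_integrable lborel {x..y} F" for x y
    using AC_continuous[OF F] by (intro borel_integrable_atLeastAtMost') (auto intro: continuous_on_subset)
  have "\<exists>c. AE x in lborel. f x - F x = c"
  proof (rule du_bois_reymond)
    fix \<phi> assume t: "test_fun \<phi>"
    obtain r where r: "\<And>x. r \<le> \<bar>x\<bar> \<Longrightarrow> deriv \<phi> x = 0" using test_fun_support[OF t] by metis
    note c = smooth_continuous[OF smooth_deriv(2)[OF test_fun_smooth[OF t]]]
    show "(LBINT x. (f x - F x) * deriv \<phi> x) = 0"
      using f AC_weak_deriv[OF F] t integrable_mult_test[OF fi c r] integrable_mult_test[OF Fi c r]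
      by (simp add: weak_deriv_def left_diff_distrib)
  qed (intro set_integral_diff fi Fi)
  then obtain c where c: "AE x in lborel. f x - F x = c" by blast
  have "AC (\<lambda>_. c) (\<lambda>_. 0)" by (simp add: AC_def set_integrable_def)
  from AC_add[OF F this] have "AC (\<lambda>x. F x + c) g" by simp
  moreover have "AE x in lborel. F x + c = f x" using c by eventually_elim simp
  ultimately show thesis by (rule that)
qed

section \<open>The peridynamic operator\<close>

lemma le_one_plus_square: "p \<ge> 0 \<Longrightarrow> p \<le> (1 + p)^2" for p :: real
  by (simp add: power2_eq_square algebra_simps)

lemma abs_mult_le: "\<bar>y\<bar> \<le> C \<Longrightarrow> \<bar>x * y\<bar> \<le> C * \<bar>x\<bar>" for x y C :: real
  by (simp add: abs_mult mult.commute[of C] mult_left_mono)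

lemma integral_dominated_bound:
  fixes f g :: "real \<Rightarrow> real"
  assumes g: "integrable lborel g" and f: "f \<in> borel_measurable lborel" and le: "\<And>z. \<bar>f z\<bar> \<le> C * g z"
  shows "integrable lborel f" "\<bar>LBINT z. f z\<bar> \<le> C * (LBINT z. g z)"
proof -
  have Cg: "integrable lborel (\<lambda>z. C * g z)" using g by simp
  show i: "integrable lborel f"
  proof (rule Bochner_Integration.integrable_bound[OF Cg f], rule AE_I2)
    show "norm (f z) \<le> norm (C * g z)" for z using le[of z] by simp
  qed
  have "\<bar>LBINT z. f z\<bar> \<le> (LBINT z. \<bar>f z\<bar>)" by (rule integral_abs_bound)
  also have "\<dots> \<le> (LBINT z. C * g z)"
    using i Cg le by (intro integral_mono) auto
  finally show "\<bar>LBINT z. f z\<bar> \<le> C * (LBINT z. g z)" by simp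
qed

lemma continuous_on_integral_dominated:
  fixes f :: "real \<Rightarrow> real \<Rightarrow> real"
  assumes f: "\<And>z. continuous_on UNIV (\<lambda>x. f x z)" and m: "\<And>x. f x \<in> borel_measurable lborel"
    and g: "integrable lborel g" and le: "\<And>x z. \<bar>f x z\<bar> \<le> g z"
  shows "continuous_on UNIV (\<lambda>x. LBINT z. f x z)"
  unfolding continuous_on_sequentially o_def
proof (intro allI ballI impI, elim conjE)
  fix X :: "nat \<Rightarrow> real" and a assume X: "X \<longlonglongrightarrow> a"
  show "(\<lambda>n. LBINT z. f (X n) z) \<longlonglongrightarrow> (LBINT z. f a z)"
  proof (rule integral_dominated_convergence[OF m m g])
    show "AE z in lborel. (\<lambda>n. f (X n) z) \<longlonglongrightarrow> f a z"
    proof (rule AE_I2)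
      fix z
      show "(\<lambda>n. f (X n) z) \<longlonglongrightarrow> f a z"
        using X f[of z] unfolding continuous_on_sequentially o_def by auto
    qed
  qed (use le in auto)
qed

lemma loc_lipschitz_obtain:
  assumes "loc_lipschitz g"
  obtains L where "L \<ge> 0" "\<And>x y. \<bar>x\<bar> \<le> R \<Longrightarrow> \<bar>y\<bar> \<le> R \<Longrightarrow> \<bar>g x - g y\<bar> \<le> L * \<bar>x - y\<bar>"
    "\<And>x. \<bar>x\<bar> \<le> R \<Longrightarrow> \<bar>g x\<bar> \<le> L"
proof -
  obtain L where L: "\<And>x y. \<bar>x\<bar> \<le> R \<Longrightarrow> \<bar>y\<bar> \<le> R \<Longrightarrow> \<bar>g x - g y\<bar> \<le> L * \<bar>x - y\<bar>"
    using assms unfolding loc_lipschitz_def by meson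
  define L' where "L' = \<bar>L\<bar> + \<bar>g 0\<bar> + \<bar>L\<bar> * \<bar>R\<bar>"
  have L': "L' \<ge> \<bar>L\<bar>" by (simp add: L'_def)
  show thesis
  proof (rule that[of L'])
    show "L' \<ge> 0" using L' by linarith
    show "\<bar>g x - g y\<bar> \<le> L' * \<bar>x - y\<bar>" if "\<bar>x\<bar> \<le> R" "\<bar>y\<bar> \<le> R" for x y
    proof -
      have "L * \<bar>x - y\<bar> \<le> L' * \<bar>x - y\<bar>" using L' by (intro mult_right_mono) auto
      then show ?thesis using L[OF that] by linarith
    qed
    show "\<bar>g x\<bar> \<le> L'" if "\<bar>x\<bar> \<le> R" for x
    proof -
      have "\<bar>g x - g 0\<bar> \<le> L * \<bar>x - 0\<bar>" using that by (intro L) auto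
      also have "\<dots> \<le> \<bar>L\<bar> * \<bar>R\<bar>" using that by (intro mult_mono) auto
      finally show ?thesis unfolding L'_def by linarith
    qed
  qed
qed

lemma loc_lipschitz_C1:
  assumes "\<And>x. (g has_real_derivative g' x) (at x)" "continuous_on UNIV g'"
  shows "loc_lipschitz g"
  unfolding loc_lipschitz_def
proof
  fix R :: real
  have "compact (g' ` {-R..R})"
    using assms(2) by (intro compact_continuous_image) (auto intro: continuous_on_subset)
  then obtain M where M: "\<And>s. s \<in> {-R..R} \<Longrightarrow> \<bar>g' s\<bar> \<le> M"
    using compact_imp_bounded bounded_real by (metis imageI)
  show "\<exists>L. \<forall>x y. \<bar>x\<bar> \<le> R \<longrightarrow> \<bar>y\<bar> \<le> R \<longrightarrow> \<bar>g x - g y\<bar> \<le> L * \<bar>x - y\<bar>"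
  proof (intro exI[of _ M] allI impI)
    fix x y assume xy: "\<bar>x\<bar> \<le> R" "\<bar>y\<bar> \<le> R"
    have "norm (g x - g y) \<le> M * norm (x - y)"
    proof (rule field_differentiable_bound[of "{-R..R}" g g' M])
      show "x \<in> {-R..R}" "y \<in> {-R..R}" using xy by auto
    qed (use assms(1) M in \<open>auto intro: has_field_derivative_at_within\<close>)
    then show "\<bar>g x - g y\<bar> \<le> M * \<bar>x - y\<bar>" by simp
  qed
qed

lemma loc_lipschitz_measurable: "loc_lipschitz g \<Longrightarrow> g \<in> borel_measurable borel"
  by (intro borel_measurable_continuous_onI loc_lipschitz_continuous)

text \<open>A function on the disjoint union of two lines encodes a pair: \<open>U \<circ> Inl\<close> is the displacement
  and \<open>U \<circ> Inr\<close> its spatial derivative, or 0 in the spaces without derivatives. The weight \<open>Mv\<close> of the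
  derivative may be infinite off the set \<open>G\<close> of full measure, and is replaced by 0 there.\<close>

locale peridynamic =
  fixes \<alpha> w h Mu Mv :: "real \<Rightarrow> real" and G :: "real set" and a b R lam :: real and cu cv ac :: bool
  assumes alpha: "integrable lborel \<alpha>"
    and w: "loc_lipschitz w" "w 0 = 0" and h: "loc_lipschitz h"
    and ab: "a \<ge> 0" "b \<ge> 0" and growth: "\<And>\<eta>. \<bar>w \<eta>\<bar> \<le> a * \<bar>\<eta>\<bar> + b"
    and R: "R \<ge> 1" and lam: "lam \<ge> 0"
    and Mu: "Mu \<in> borel_measurable borel" "\<And>x. 0 \<le> Mu x" "\<And>x. Mu x \<le> R"
    and Mu_lam: "\<And>x. (LBINT z. \<bar>\<alpha> z\<bar> * (Mu (x + z) + Mu x)) \<le> lam * Mu x"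
    and Mv: "Mv \<in> borel_measurable borel" "\<And>x. 0 \<le> Mv x" "\<And>x. x \<notin> G \<Longrightarrow> Mv x = 0"
    and Mv_int: "\<And>x. x \<in> G \<Longrightarrow> integrable lborel (\<lambda>z. \<alpha> z * Mv (x + z))"
    and Mv_lam: "\<And>x. x \<in> G \<Longrightarrow> (LBINT z. \<bar>\<alpha> z\<bar> * (Mv (x + z) + Mv x)) \<le> lam * Mv x"
    and Mv_loc: "\<And>x y. set_integrable lborel {x..y} Mv"
    and G: "G \<in> sets borel" "AE x in lborel. x \<in> G"
    and cv: "cv \<Longrightarrow> cu \<and> G = UNIV \<and> (\<exists>K. \<forall>x. Mv x \<le> K)"
    and w_deriv: "\<And>x. ac \<Longrightarrow> (w has_real_derivative h x) (at x)"
begin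

lemmas [measurable] = Mu(1) Mv(1) G(1) loc_lipschitz_measurable[OF w(1)] loc_lipschitz_measurable[OF h]

lemma alpha_measurable [measurable]: "\<alpha> \<in> borel_measurable borel"
  using alpha by simp

section \<open>Estimates for the operator and its linearisation\<close>

definition N :: real where "N = (LBINT z. \<bar>\<alpha> z\<bar>)"

lemma N: "N \<ge> 0"
  unfolding N_def by (intro integral_nonneg_AE) auto

definition Fu :: "(real \<Rightarrow> real) \<Rightarrow> real \<Rightarrow> real" where
  "Fu u x = (LBINT z. \<alpha> z * w (u (x + z) - u x))"

abbreviation Kv :: "(real \<Rightarrow> real) \<Rightarrow> (real \<Rightarrow> real) \<Rightarrow> real \<Rightarrow> real \<Rightarrow> real" where
  "Kv u v x z \<equiv> \<alpha> z * (h (u (x + z) - u x) * (v (x + z) - v x))"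

text \<open>Off \<open>G\<close> the integral is not controlled; the value 0 there matches
  \<open>Mv = 0\<close>, so the weighted bounds hold at every point and not merely almost
  everywhere.\<close>

definition Fv :: "(real \<Rightarrow> real) \<Rightarrow> (real \<Rightarrow> real) \<Rightarrow> real \<Rightarrow> real" where
  "Fv u v x = indicator G x * (LBINT z. Kv u v x z)"

lemma Fu_measurable [measurable]:
  assumes [measurable]: "u \<in> borel_measurable borel"
  shows "Fu u \<in> borel_measurable borel"
  unfolding Fu_def[abs_def] by measurable

lemma Fv_measurable [measurable]:
  assumes [measurable]: "u \<in> borel_measurable borel" "v \<in> borel_measurable borel"
  shows "Fv u v \<in> borel_measurable borel"
  unfolding Fv_def[abs_def] by measurable

lemma Mu_integrable: "integrable lborel (\<lambda>z. \<bar>\<alpha> z\<bar> * (Mu (x + z) + Mu x))"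
proof (rule integral_dominated_bound(1)[where g = "\<lambda>z. \<bar>\<alpha> z\<bar>" and C = "2 * R"])
  fix z
  have "\<bar>\<alpha> z\<bar> * (Mu (x + z) + Mu x) \<le> \<bar>\<alpha> z\<bar> * (2 * R)"
    using Mu(3)[of "x + z"] Mu(3)[of x] by (intro mult_left_mono) auto
  then show "\<bar>\<bar>\<alpha> z\<bar> * (Mu (x + z) + Mu x)\<bar> \<le> 2 * R * \<bar>\<alpha> z\<bar>"
    using Mu(2) by (simp add: abs_mult mult_ac)
qed (use alpha in simp_all)

lemma Mv_integrable:
  assumes "x \<in> G" shows "integrable lborel (\<lambda>z. \<bar>\<alpha> z\<bar> * (Mv (x + z) + Mv x))"
proof -
  have "integrable lborel (\<lambda>z. \<bar>\<alpha> z * Mv (x + z)\<bar> + \<bar>\<alpha> z\<bar> * Mv x)"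
    using Mv_int[OF assms] alpha by (intro Bochner_Integration.integrable_add) auto
  then show ?thesis using Mv(2) by (simp add: abs_mult distrib_left)
qed

lemma Fu_integrand_le:
  assumes "\<And>x. \<bar>u x\<bar> \<le> S"
  shows "\<bar>\<alpha> z * w (u (x + z) - u x)\<bar> \<le> (a * (2 * S) + b) * \<bar>\<alpha> z\<bar>"
proof (rule abs_mult_le)
  have "\<bar>w (u (x + z) - u x)\<bar> \<le> a * \<bar>u (x + z) - u x\<bar> + b" by (rule growth)
  also have "\<dots> \<le> a * (2 * S) + b"
    using assms[of x] assms[of "x + z"] ab by (intro add_mono mult_left_mono) auto
  finally show "\<bar>w (u (x + z) - u x)\<bar> \<le> a * (2 * S) + b" .
qed

context
  fixes S L :: real
  assumes S: "S \<ge> 0" and L: "L \<ge> 0"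
    and wL: "\<And>x y. \<bar>x\<bar> \<le> 2 * S \<Longrightarrow> \<bar>y\<bar> \<le> 2 * S \<Longrightarrow> \<bar>w x - w y\<bar> \<le> L * \<bar>x - y\<bar>"
    and hL: "\<And>x y. \<bar>x\<bar> \<le> 2 * S \<Longrightarrow> \<bar>y\<bar> \<le> 2 * S \<Longrightarrow> \<bar>h x - h y\<bar> \<le> L * \<bar>x - y\<bar>"
    and hB: "\<And>x. \<bar>x\<bar> \<le> 2 * S \<Longrightarrow> \<bar>h x\<bar> \<le> L"
begin

text \<open>\<open>w\<close> and \<open>h\<close> are evaluated at differences of two values of a
  function bounded by \<open>S\<close>, hence the radius \<open>2 * S\<close> in the constants of
  this context.\<close>

lemma diff_le_2S: "(\<And>x. \<bar>u x\<bar> \<le> S) \<Longrightarrow> \<bar>u y - u x\<bar> \<le> 2 * S" for u :: "real \<Rightarrow> real"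
proof -
  assume u: "\<And>x. \<bar>u x\<bar> \<le> S"
  show "\<bar>u y - u x\<bar> \<le> 2 * S" using u[of x] u[of y] by linarith
qed

lemma Fu_integrable:
  assumes [measurable]: "u \<in> borel_measurable borel" and u: "\<And>x. \<bar>u x\<bar> \<le> S"
  shows "integrable lborel (\<lambda>z. \<alpha> z * w (u (x + z) - u x))"
  by (rule integral_dominated_bound(1)[OF _ _ Fu_integrand_le[OF u]]) (use alpha in simp_all)

text \<open>No Lipschitz constant enters the bound. It can therefore fix the rate of the sup bound
  before \<open>L\<close>, which depends on that rate, is chosen.\<close>

lemma Fu_growth:
  assumes [measurable]: "u \<in> borel_measurable borel" and u: "\<And>x. \<bar>u x\<bar> \<le> S'" and S': "S' \<le> S"
  shows "\<bar>Fu u x\<bar> \<le> N * (2 * a * S' + b)"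
proof -
  have "\<bar>Fu u x\<bar> \<le> (a * (2 * S') + b) * (LBINT z. \<bar>\<alpha> z\<bar>)"
    unfolding Fu_def
    by (rule integral_dominated_bound(2)[OF _ _ Fu_integrand_le[OF u]]) (use alpha in simp_all)
  then show ?thesis by (simp add: N_def algebra_simps)
qed

text \<open>The errors \<open>c * Mu\<close> at \<open>x\<close> and at \<open>x + z\<close>
  integrate, by \<open>Mu_lam\<close>, to a multiple of \<open>Mu x\<close> alone.\<close>

lemma Fu_lipschitz:
  assumes [measurable]: "u \<in> borel_measurable borel" "u' \<in> borel_measurable borel"
    and u: "\<And>x. \<bar>u x\<bar> \<le> S" and u': "\<And>x. \<bar>u' x\<bar> \<le> S"
    and c: "c \<ge> 0" and le: "\<And>x. \<bar>u x - u' x\<bar> \<le> c * Mu x"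
  shows "\<bar>Fu u x - Fu u' x\<bar> \<le> L * lam * c * Mu x"
proof -
  have "Fu u x - Fu u' x = (LBINT z. \<alpha> z * w (u (x + z) - u x) - \<alpha> z * w (u' (x + z) - u' x))"
    unfolding Fu_def using Fu_integrable u u' by simp
  also have "\<bar>\<dots>\<bar> \<le> (L * c) * (LBINT z. \<bar>\<alpha> z\<bar> * (Mu (x + z) + Mu x))"
  proof (rule integral_dominated_bound(2)[OF Mu_integrable])
    fix z
    have "\<bar>w (u (x + z) - u x) - w (u' (x + z) - u' x)\<bar> \<le> L * \<bar>(u (x + z) - u x) - (u' (x + z) - u' x)\<bar>"
      by (intro wL diff_le_2S u u')
    also have "\<dots> \<le> L * (c * Mu (x + z) + c * Mu x)"
      using le[of x] le[of "x + z"] L by (intro mult_left_mono) auto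
    finally have "\<bar>\<alpha> z\<bar> * \<bar>w (u (x + z) - u x) - w (u' (x + z) - u' x)\<bar> \<le> \<bar>\<alpha> z\<bar> * (L * (c * Mu (x + z) + c * Mu x))"
      by (intro mult_left_mono) auto
    then show "\<bar>\<alpha> z * w (u (x + z) - u x) - \<alpha> z * w (u' (x + z) - u' x)\<bar>
        \<le> L * c * (\<bar>\<alpha> z\<bar> * (Mu (x + z) + Mu x))"
      by (simp add: algebra_simps flip: abs_mult)
  qed simp
  also have "\<dots> \<le> (L * c) * (lam * Mu x)"
    using L c Mu_lam by (intro mult_left_mono) auto
  finally show ?thesis by (simp add: mult_ac)
qed

text \<open>Comparison with the zero function, which \<open>Fu\<close> maps to 0 because
  \<open>w 0 = 0\<close>. This preserves the decay of the weight, which the growth bound with its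
  constant \<open>b\<close> would destroy.\<close>

lemma Fu_bound:
  assumes [measurable]: "u \<in> borel_measurable borel" and u: "\<And>x. \<bar>u x\<bar> \<le> S"
    and c: "c \<ge> 0" and le: "\<And>x. \<bar>u x\<bar> \<le> c * Mu x"
  shows "\<bar>Fu u x\<bar> \<le> L * lam * c * Mu x"
  using Fu_lipschitz[of u "\<lambda>_. 0" c x] u le S c by (simp add: Fu_def w(2))

text \<open>In the second estimate the absolute value stands inside the integral: besides bounding
  \<open>Fv\<close>, it is the integrability condition for Fubini in \<open>Fu_AC\<close>.\<close>

lemma Fv_integrable:
  assumes [measurable]: "u \<in> borel_measurable borel" "v \<in> borel_measurable borel"
    and u: "\<And>x. \<bar>u x\<bar> \<le> S" and v: "\<And>x. \<bar>v x\<bar> \<le> c * Mv x" and c: "c \<ge> 0" and x: "x \<in> G"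
  shows "integrable lborel (\<lambda>z. Kv u v x z)" (is "integrable _ ?f")
    and "(LBINT z. \<bar>Kv u v x z\<bar>) \<le> (L * c) * (lam * Mv x)"
proof -
  have le: "\<bar>?f z\<bar> \<le> (L * c) * (\<bar>\<alpha> z\<bar> * (Mv (x + z) + Mv x))" for z
  proof -
    have "\<bar>h (u (x + z) - u x) * (v (x + z) - v x)\<bar> \<le> L * (c * Mv (x + z) + c * Mv x)"
      unfolding abs_mult using v[of x] v[of "x + z"] L
      by (intro mult_mono hB diff_le_2S[OF u]) auto
    from abs_mult_le[OF this, of "\<alpha> z"]
    show ?thesis by (simp add: algebra_simps)
  qed
  show "integrable lborel ?f"
    by (rule integral_dominated_bound(1)[OF Mv_integrable[OF x] _ le]) simp
  have "\<bar>LBINT z. \<bar>?f z\<bar>\<bar> \<le> (L * c) * (LBINT z. \<bar>\<alpha> z\<bar> * (Mv (x + z) + Mv x))"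
    by (rule integral_dominated_bound(2)[OF Mv_integrable[OF x]]) (use le in auto)
  also have "\<dots> \<le> (L * c) * (lam * Mv x)"
    using L c Mv_lam[OF x] by (intro mult_left_mono) auto
  finally show "(LBINT z. \<bar>?f z\<bar>) \<le> (L * c) * (lam * Mv x)"
    by simp
qed

lemma Fv_bound:
  assumes "u \<in> borel_measurable borel" "v \<in> borel_measurable borel"
    and u: "\<And>x. \<bar>u x\<bar> \<le> S" and v: "\<And>x. \<bar>v x\<bar> \<le> c * Mv x" and c: "c \<ge> 0"
  shows "\<bar>Fv u v x\<bar> \<le> L * lam * c * Mv x"
proof (cases "x \<in> G")
  case True
  have "\<bar>Fv u v x\<bar> \<le> (LBINT z. \<bar>Kv u v x z\<bar>)"
    using True by (simp add: Fv_def integral_abs_bound)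
  then show ?thesis using Fv_integrable(2)[OF assms True] by (simp add: mult_ac)
next
  case False
  then show ?thesis by (simp add: Fv_def Mv(3))
qed

text \<open>A difference of products is split in two. In one term the displacements enter through
  the sup bound \<open>c * R\<close> on their difference and \<open>v\<close> through its weight; in
  the other \<open>h\<close> enters through its bound and \<open>v - v'\<close> through its weight.
  Thus each term carries \<open>Mv\<close> once and never a product of weights.\<close>

lemma Fv_lipschitz:
  assumes [measurable]: "u \<in> borel_measurable borel" "u' \<in> borel_measurable borel"
      "v \<in> borel_measurable borel" "v' \<in> borel_measurable borel"
    and u: "\<And>x. \<bar>u x\<bar> \<le> S" and u': "\<And>x. \<bar>u' x\<bar> \<le> S"
    and v: "\<And>x. \<bar>v x\<bar> \<le> c1 * Mv x" and v': "\<And>x. \<bar>v' x\<bar> \<le> c1 * Mv x"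
    and c: "c \<ge> 0" "c1 \<ge> 0"
    and leu: "\<And>x. \<bar>u x - u' x\<bar> \<le> c * Mu x" and lev: "\<And>x. \<bar>v x - v' x\<bar> \<le> c * Mv x"
  shows "\<bar>Fv u v x - Fv u' v' x\<bar> \<le> L * lam * (1 + 2 * R * c1) * c * Mv x"
proof (cases "x \<in> G")
  case True
  have e: "Fv u v x - Fv u' v' x = (LBINT z. Kv u v x z - Kv u' v' x z)"
    unfolding Fv_def using Fv_integrable(1)[OF assms(1,3) u v c(2) True] Fv_integrable(1)[OF assms(2,4) u' v' c(2) True] True
    by (subst Bochner_Integration.integral_diff) auto
  have "\<bar>Fv u v x - Fv u' v' x\<bar> \<le> (L * (1 + 2 * R * c1) * c) * (LBINT z. \<bar>\<alpha> z\<bar> * (Mv (x + z) + Mv x))"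
    unfolding e
  proof (rule integral_dominated_bound(2)[OF Mv_integrable[OF True]])
    fix z
    let ?du = "u (x + z) - u x" and ?du' = "u' (x + z) - u' x"
      and ?dv = "v (x + z) - v x" and ?dv' = "v' (x + z) - v' x"
    let ?M = "Mv (x + z) + Mv x"
    have M: "?M \<ge> 0" using Mv(2) by simp
    have "\<bar>h ?du - h ?du'\<bar> \<le> L * \<bar>?du - ?du'\<bar>" by (intro hL diff_le_2S u u')
    also have "\<dots> \<le> L * (2 * R * c)"
    proof (rule mult_left_mono[OF _ L])
      have "c * Mu y \<le> c * R" for y using Mu(3) c by (intro mult_left_mono)
      then have "\<bar>u y - u' y\<bar> \<le> c * R" for y using leu[of y] order_trans by blast
      from this[of x] this[of "x + z"] show "\<bar>?du - ?du'\<bar> \<le> 2 * R * c" by (simp add: mult_ac)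
    qed
    finally have 1: "\<bar>h ?du - h ?du'\<bar> \<le> L * (2 * R * c)" .
    have 2: "\<bar>?dv\<bar> \<le> c1 * ?M" using v[of x] v[of "x + z"] by (simp add: algebra_simps)
    have 3: "\<bar>h ?du'\<bar> \<le> L" by (intro hB diff_le_2S u')
    have 4: "\<bar>?dv - ?dv'\<bar> \<le> c * ?M" using lev[of x] lev[of "x + z"] by (simp add: algebra_simps)
    have "h ?du * ?dv - h ?du' * ?dv' = (h ?du - h ?du') * ?dv + h ?du' * (?dv - ?dv')"
      by (simp add: algebra_simps)
    then have "\<bar>h ?du * ?dv - h ?du' * ?dv'\<bar> \<le> \<bar>h ?du - h ?du'\<bar> * \<bar>?dv\<bar> + \<bar>h ?du'\<bar> * \<bar>?dv - ?dv'\<bar>"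
      by (metis abs_mult abs_triangle_ineq)
    also have "\<dots> \<le> (L * (2 * R * c)) * (c1 * ?M) + L * (c * ?M)"
      using 1 2 3 4 L c R M by (intro add_mono mult_mono) auto
    also have "\<dots> = L * (1 + 2 * R * c1) * c * ?M" by (simp add: algebra_simps)
    finally have "\<bar>\<alpha> z\<bar> * \<bar>h ?du * ?dv - h ?du' * ?dv'\<bar> \<le> \<bar>\<alpha> z\<bar> * (L * (1 + 2 * R * c1) * c * ?M)"
      by (intro mult_left_mono) auto
    then show "\<bar>Kv u v x z - Kv u' v' x z\<bar> \<le> L * (1 + 2 * R * c1) * c * (\<bar>\<alpha> z\<bar> * ?M)"
      by (simp only: right_diff_distrib[symmetric] abs_mult[symmetric] mult_ac)
  qed simp
  also have "\<dots> \<le> (L * (1 + 2 * R * c1) * c) * (lam * Mv x)"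
    by (rule mult_left_mono[OF Mv_lam[OF True]], intro mult_nonneg_nonneg add_nonneg_nonneg)
      (use L c R in auto)
  finally show ?thesis by (simp add: mult_ac)
next
  case False
  then show ?thesis by (simp add: Fv_def Mv(3))
qed

lemma Fu_continuous:
  assumes u: "continuous_on UNIV u" "\<And>x. \<bar>u x\<bar> \<le> S"
  shows "continuous_on UNIV (Fu u)"
proof -
  have [measurable]: "u \<in> borel_measurable borel" using u(1) by (rule borel_measurable_continuous_onI)
  note cw = continuous_on_compose2[OF loc_lipschitz_continuous[OF w(1)]]
  note cc = continuous_on_compose2[OF u(1)]
  show ?thesis
    unfolding Fu_def[abs_def]
  proof (rule continuous_on_integral_dominated)
    show "continuous_on UNIV (\<lambda>x. \<alpha> z * w (u (x + z) - u x))" for z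
      by (intro continuous_on_mult continuous_on_const cw continuous_on_diff cc continuous_intros u) auto
    show "integrable lborel (\<lambda>z. (a * (2 * S) + b) * \<bar>\<alpha> z\<bar>)" using alpha by simp
    show "\<bar>\<alpha> z * w (u (x + z) - u x)\<bar> \<le> (a * (2 * S) + b) * \<bar>\<alpha> z\<bar>" for x z
      by (rule Fu_integrand_le[OF u(2)])
  qed simp
qed

lemma Fv_continuous:
  assumes u: "continuous_on UNIV u" "\<And>x. \<bar>u x\<bar> \<le> S"
    and v: "continuous_on UNIV v" "\<And>x. \<bar>v x\<bar> \<le> K" and GU: "G = UNIV"
  shows "continuous_on UNIV (Fv u v)"
proof -
  have [measurable]: "u \<in> borel_measurable borel" "v \<in> borel_measurable borel"
    using u(1) v(1) by (auto intro: borel_measurable_continuous_onI)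
  note ch = continuous_on_compose2[OF loc_lipschitz_continuous[OF h]]
  note cu = continuous_on_compose2[OF u(1)] and cv = continuous_on_compose2[OF v(1)]
  have e: "Fv u v = (\<lambda>x. LBINT z. Kv u v x z)"
    by (rule ext, subst Fv_def) (simp add: GU)
  show ?thesis
    unfolding e
  proof (rule continuous_on_integral_dominated)
    show "continuous_on UNIV (\<lambda>x. Kv u v x z)" for z
      by (intro continuous_on_mult continuous_on_const ch continuous_on_diff cu cv continuous_intros u v) auto
    show "integrable lborel (\<lambda>z. (L * (2 * K)) * \<bar>\<alpha> z\<bar>)" using alpha by simp
    fix x z
    have "\<bar>h (u (x + z) - u x) * (v (x + z) - v x)\<bar> \<le> L * (2 * K)"
      unfolding abs_mult using v(2)[of x] v(2)[of "x + z"] L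
      by (intro mult_mono hB diff_le_2S[OF u(2)]) auto
    then show "\<bar>Kv u v x z\<bar> \<le> (L * (2 * K)) * \<bar>\<alpha> z\<bar>"
      by (rule abs_mult_le)
  qed simp
qed

text \<open>For fixed z the chain rule writes the increment of \<open>w (u (x + z) - u x)\<close> as
  an integral over [x, y], and Fubini exchanges the integrals in s and z. The double integral
  converges absolutely because for almost every s the integral in z is at most a multiple of
  \<open>Mv s\<close>, and \<open>Mv\<close> is locally integrable.\<close>

lemma Fu_AC:
  assumes ac: "ac" and uv: "AC u v" and u: "\<And>x. \<bar>u x\<bar> \<le> S"
    and [measurable]: "v \<in> borel_measurable borel" and v: "\<And>x. \<bar>v x\<bar> \<le> c * Mv x" and c: "c \<ge> 0"
  shows "AC (Fu u) (Fv u v)"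
  unfolding AC_def
proof (intro allI impI conjI)
  have [measurable]: "u \<in> borel_measurable borel"
    using AC_continuous[OF uv] by (rule borel_measurable_continuous_onI)
  fix x y :: real assume xy: "x \<le> y"
  have iM: "integrable lborel (\<lambda>s. L * lam * c * (indicator {x..y} s * Mv s))"
    using Mv_loc[of x y] unfolding set_integrable_def by simp
  show "set_integrable lborel {x..y} (Fv u v)"
    unfolding set_integrable_def
  proof (rule Bochner_Integration.integrable_bound[OF iM])
    have "norm (indicator {x..y} s *\<^sub>R Fv u v s) \<le> norm (L * lam * c * (indicator {x..y} s * Mv s))" for s
      using Fv_bound[of u v c s] u v c by (auto simp: indicator_def intro: order_trans[OF _ abs_ge_self])
    then show "AE s in lborel. norm (indicator {x..y} s *\<^sub>R Fv u v s) \<le> norm (L * lam * c * (indicator {x..y} s * Mv s))"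
      by simp
  qed simp
  let ?f = "\<lambda>s z. \<alpha> z * (h (u (s + z) - u s) * (v (s + z) - v s))"
  let ?k = "\<lambda>s z. indicator {x..y} s * ?f s z"
  have km: "(\<lambda>(s, z). ?k s z) \<in> borel_measurable (lborel \<Otimes>\<^sub>M lborel)" by measurable
  have ki: "integrable (lborel \<Otimes>\<^sub>M lborel) (\<lambda>(s, z). ?k s z)"
  proof (rule lborel_pair.Fubini_integrable[OF km])
    show "integrable lborel (\<lambda>s. LBINT z. norm (case (s, z) of (s, z) \<Rightarrow> ?k s z))"
    proof (rule Bochner_Integration.integrable_bound[OF iM])
      show "(\<lambda>s. LBINT z. norm (case (s, z) of (s, z) \<Rightarrow> ?k s z)) \<in> borel_measurable lborel"
        by measurable
      show "AE s in lborel. norm (LBINT z. norm (case (s, z) of (s, z) \<Rightarrow> ?k s z))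
          \<le> norm (L * lam * c * (indicator {x..y} s * Mv s))"
        using G(2)
      proof eventually_elim
        case (elim s)
        have "(LBINT z. norm (?k s z)) = indicator {x..y} s * (LBINT z. \<bar>?f s z\<bar>)"
          by (simp add: abs_mult)
        also have "\<dots> \<le> indicator {x..y} s * ((L * c) * (lam * Mv s))"
          by (intro mult_left_mono Fv_integrable(2)[OF _ _ u v c elim]) auto
        finally have 1: "(LBINT z. norm (?k s z)) \<le> L * lam * c * (indicator {x..y} s * Mv s)"
          by (simp add: mult_ac)
        have 2: "(LBINT z. norm (?k s z)) \<ge> 0" by (intro integral_nonneg_AE) auto
        show ?case using 1 2 by simp
      qed
    qed
    show "AE s in lborel. integrable lborel (\<lambda>z. case (s, z) of (s, z) \<Rightarrow> ?k s z)"
      using G(2) by eventually_elim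
        (use Fv_integrable(1)[OF \<open>u \<in> borel_measurable borel\<close> \<open>v \<in> borel_measurable borel\<close> u v c] in simp)
  qed
  have chain: "w (u (y + z) - u y) - w (u (x + z) - u x) = (LBINT s. indicator {x..y} s * (h (u (s + z) - u s) * (v (s + z) - v s)))" for z
  proof -
    have "AC (\<lambda>x. w (u (x + z) - u x)) (\<lambda>x. h (u (x + z) - u x) * (v (x + z) - v x))"
      by (rule AC_chain[OF AC_minus[OF AC_shift[OF uv] uv] w_deriv[OF ac] h])
    from AC_diff[OF this xy] show ?thesis by (simp add: set_lebesgue_integral_def)
  qed
  have "Fu u y - Fu u x = (LBINT z. \<alpha> z * w (u (y + z) - u y) - \<alpha> z * w (u (x + z) - u x))"
    unfolding Fu_def
    by (rule Bochner_Integration.integral_diff[symmetric]; rule Fu_integrable[OF _ u]; measurable)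
  also have "\<dots> = (LBINT z. (LBINT s. ?k s z))"
  proof (rule Bochner_Integration.integral_cong[OF refl])
    fix z
    have "\<alpha> z * w (u (y + z) - u y) - \<alpha> z * w (u (x + z) - u x)
      = \<alpha> z * (LBINT s. indicator {x..y} s * (h (u (s + z) - u s) * (v (s + z) - v s)))"
      unfolding chain[symmetric] by (rule right_diff_distrib[symmetric])
    also have "\<dots> = (LBINT s. \<alpha> z * (indicator {x..y} s * (h (u (s + z) - u s) * (v (s + z) - v s))))"
      by (rule integral_mult_right_zero[symmetric])
    finally show "\<alpha> z * w (u (y + z) - u y) - \<alpha> z * w (u (x + z) - u x) = (LBINT s. ?k s z)"
      by (simp only: mult_ac)
  qed
  also have "\<dots> = (LBINT s. (LBINT z. ?k s z))"
    by (rule lborel_pair.Fubini_integral[OF ki])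
  also have "\<dots> = (LBINT s:{x..y}. Fv u v s)"
    unfolding set_lebesgue_integral_def
  proof (rule integral_cong_AE)
    show "AE s in lborel. (LBINT z. ?k s z) = indicator {x..y} s *\<^sub>R Fv u v s"
      using G(2) by eventually_elim (simp add: Fv_def)
  qed measurable
  finally show "Fu u y - Fu u x = (LBINT s:{x..y}. Fv u v s)" .
qed

end

section \<open>The closed class of pairs\<close>

text \<open>The flags choose the space: \<open>cu\<close> alone for C_b, none for the intersection
  of L^p and L^\<infinity>, all three for C^1_b, and \<open>cu\<close> with \<open>ac\<close> for
  W^{1,p}, where the derivative component need not be continuous.\<close>

definition Cl :: "(real + real \<Rightarrow> real) set" where
  "Cl = {U. U \<circ> Inl \<in> borel_measurable borel \<and> U \<circ> Inr \<in> borel_measurable borel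
      \<and> (cu \<longrightarrow> continuous_on UNIV (U \<circ> Inl)) \<and> (cv \<longrightarrow> continuous_on UNIV (U \<circ> Inr))
      \<and> (ac \<longrightarrow> AC (U \<circ> Inl) (U \<circ> Inr))}"

lemma ClD:
  "U \<in> Cl \<Longrightarrow> cu \<Longrightarrow> continuous_on UNIV (U \<circ> Inl)"
  "U \<in> Cl \<Longrightarrow> cv \<Longrightarrow> continuous_on UNIV (U \<circ> Inr)"
  "U \<in> Cl \<Longrightarrow> ac \<Longrightarrow> AC (U \<circ> Inl) (U \<circ> Inr)"
  unfolding Cl_def by blast+

definition F :: "(real + real \<Rightarrow> real) \<Rightarrow> real + real \<Rightarrow> real" where
  "F U = case_sum (Fu (U \<circ> Inl)) (Fv (U \<circ> Inl) (U \<circ> Inr))"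

definition W :: "real + real \<Rightarrow> real" where "W = case_sum Mu Mv"

lemma F_o [simp]: "F U \<circ> Inl = Fu (U \<circ> Inl)" "F U \<circ> Inr = Fv (U \<circ> Inl) (U \<circ> Inr)"
  by (auto simp: F_def)

lemma W_nonneg: "W p \<ge> 0"
  using Mu(2) Mv(2) by (cases p) (auto simp: W_def)

lemma Cl_add:
  assumes "U \<in> Cl" "V \<in> Cl" shows "(\<lambda>p. U p + V p) \<in> Cl"
proof -
  have "(\<lambda>p. U p + V p) \<circ> i = (\<lambda>x. (U \<circ> i) x + (V \<circ> i) x)" for i :: "real \<Rightarrow> real + real" by auto
  then show ?thesis
    using assms unfolding Cl_def mem_Collect_eq
    by (simp only:) (intro conjI impI borel_measurable_add continuous_on_add AC_add; blast)
qed

lemma Cl_scale: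
  assumes "U \<in> Cl" shows "(\<lambda>p. c * U p) \<in> Cl"
proof -
  have "(\<lambda>p. c * U p) \<circ> i = (\<lambda>x. c * (U \<circ> i) x)" for i :: "real \<Rightarrow> real + real" by auto
  then show ?thesis
    using assms unfolding Cl_def mem_Collect_eq
    by (simp only:) (intro conjI impI borel_measurable_times borel_measurable_const continuous_on_mult_left AC_scale; blast)
qed

text \<open>Weighted convergence under a bounded weight is uniform.\<close>

lemma continuous_of_bounded_limit:
  fixes f :: "nat \<Rightarrow> real \<Rightarrow> real"
  assumes f: "\<And>n. continuous_on UNIV (f n)" and M: "\<And>x. M x \<le> K"
    and le: "\<And>n x. \<bar>f n x - g x\<bar> \<le> e n * M x" and e: "e \<longlonglongrightarrow> 0" and M0: "\<And>x. M x \<ge> 0"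
  shows "continuous_on UNIV g"
proof (rule uniform_limit_theorem[where F = sequentially and f = f])
  show "uniform_limit UNIV f g sequentially"
  proof (rule uniform_limitI)
    fix d :: real assume d: "d > 0"
    have "(\<lambda>n. \<bar>e n\<bar> * \<bar>K\<bar>) \<longlonglongrightarrow> \<bar>0\<bar> * \<bar>K\<bar>" by (intro tendsto_intros e)
    then have "\<forall>\<^sub>F n in sequentially. \<bar>e n\<bar> * \<bar>K\<bar> < d" using d by (intro order_tendstoD) auto
    then show "\<forall>\<^sub>F n in sequentially. \<forall>x\<in>UNIV. dist (f n x) (g x) < d"
    proof eventually_elim
      case (elim n)
      have "\<bar>f n x - g x\<bar> \<le> \<bar>e n\<bar> * \<bar>K\<bar>" for x
      proof -
        have "e n * M x \<le> \<bar>e n\<bar> * \<bar>K\<bar>"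
          using M[of x] M0[of x] by (intro mult_mono) auto
        then show ?thesis using le[of n x] by linarith
      qed
      then show ?case using elim by (auto simp: dist_real_def intro: le_less_trans)
    qed
  qed
qed (use f in auto)

lemma Cl_lim:
  assumes Us: "\<And>n::nat. Us n \<in> Cl" and le: "\<And>n p. \<bar>Us n p - U p\<bar> \<le> e n * W p" and e: "e \<longlonglongrightarrow> 0"
  shows "U \<in> Cl"
proof -
  have lim: "(\<lambda>n. Us n p) \<longlonglongrightarrow> U p" for p
  proof (rule LIM_zero_cancel, rule Lim_null_comparison)
    show "\<forall>\<^sub>F n in sequentially. norm (Us n p - U p) \<le> e n * W p" using le by simp
    show "(\<lambda>n. e n * W p) \<longlonglongrightarrow> 0" using tendsto_mult_left_zero[OF e] .
  qed
  have leu: "\<bar>(Us n \<circ> Inl) x - (U \<circ> Inl) x\<bar> \<le> e n * Mu x" for n x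
    using le[of n "Inl x"] by (simp add: W_def)
  have lev: "\<bar>(Us n \<circ> Inr) x - (U \<circ> Inr) x\<bar> \<le> e n * Mv x" for n x
    using le[of n "Inr x"] by (simp add: W_def)
  have mu: "Us n \<circ> Inl \<in> borel_measurable borel" and mv: "Us n \<circ> Inr \<in> borel_measurable borel" for n
    using Us[of n] by (auto simp: Cl_def)
  have 1: "U \<circ> Inl \<in> borel_measurable borel"
    by (rule borel_measurable_LIMSEQ_real[where u = "\<lambda>n. Us n \<circ> Inl", OF _ mu]) (simp add: lim)
  have 2: "U \<circ> Inr \<in> borel_measurable borel"
    by (rule borel_measurable_LIMSEQ_real[where u = "\<lambda>n. Us n \<circ> Inr", OF _ mv]) (simp add: lim)
  have 3: "continuous_on UNIV (U \<circ> Inl)" if cu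
    by (rule continuous_of_bounded_limit[OF ClD(1)[OF Us that] Mu(3) leu e Mu(2)])
  have 4: "continuous_on UNIV (U \<circ> Inr)" if c: cv
  proof -
    obtain K where K: "\<And>x. Mv x \<le> K" using cv[OF c] by blast
    show ?thesis
      by (rule continuous_of_bounded_limit[OF ClD(2)[OF Us c] K lev e Mv(2)])
  qed
  \<comment> \<open>The bound \<open>e n * Mv\<close> on the error of the derivatives gives
    convergence of their integrals over [x, y], as \<open>Mv\<close> is integrable there and
    \<open>e\<close>, being convergent, is bounded; so the identity of integrals passes to the
    limit.\<close>
  have 5: "AC (U \<circ> Inl) (U \<circ> Inr)" if ac
    unfolding AC_def
  proof (intro allI impI)
    fix x y :: real assume xy: "x \<le> y"
    obtain K where K: "\<And>n. \<bar>e n\<bar> \<le> K"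
      using e convergent_imp_Bseq[of e] unfolding Bseq_def convergent_def by auto
    have AU: "AC (Us n \<circ> Inl) (Us n \<circ> Inr)" for n by (rule ClD(3)[OF Us that])
    note iU = AC_integrable[OF AU, of x y]
    have i2: "integrable lborel (\<lambda>s. indicator {x..y} s *\<^sub>R ((Us 0 \<circ> Inr) s - (U \<circ> Inr) s))"
    proof (rule integral_dominated_bound(1)[where C = K])
      show "integrable lborel (\<lambda>s. indicator {x..y} s *\<^sub>R Mv s)"
        using Mv_loc[of x y] unfolding set_integrable_def .
      show "(\<lambda>s. indicator {x..y} s *\<^sub>R ((Us 0 \<circ> Inr) s - (U \<circ> Inr) s)) \<in> borel_measurable lborel"
      proof -
        have "(\<lambda>s. indicator {x..y} s *\<^sub>R ((Us 0 \<circ> Inr) s - (U \<circ> Inr) s)) \<in> borel_measurable borel"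
          by (rule borel_measurable_scaleR[OF _ borel_measurable_diff[OF mv[of 0] 2]]) simp
        then show ?thesis by simp
      qed
      show "\<bar>indicator {x..y} s *\<^sub>R ((Us 0 \<circ> Inr) s - (U \<circ> Inr) s)\<bar> \<le> K * (indicator {x..y} s *\<^sub>R Mv s)" for s
        using order_trans[OF lev[of 0 s] mult_right_mono[of "e 0" K "Mv s"]] K[of 0] Mv(2)[of s]
        by (auto simp: indicator_def)
    qed
    have i: "set_integrable lborel {x..y} (U \<circ> Inr)"
      using set_integral_diff(1)[OF iU[of 0] i2[folded set_integrable_def]] by (simp add: o_def)
    have "(\<lambda>n. LBINT s:{x..y}. (Us n \<circ> Inr) s) \<longlonglongrightarrow> (LBINT s:{x..y}. (U \<circ> Inr) s)"
      unfolding set_lebesgue_integral_def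
    proof (rule integral_dominated_convergence)
      show "integrable lborel (\<lambda>s. norm (indicator {x..y} s *\<^sub>R (U \<circ> Inr) s) + K * (indicator {x..y} s *\<^sub>R Mv s))"
        using i Mv_loc[of x y] unfolding set_integrable_def
        by (intro Bochner_Integration.integrable_add integrable_norm integrable_mult_right) auto
      show "AE s in lborel. norm (indicator {x..y} s *\<^sub>R (Us n \<circ> Inr) s) \<le>
         norm (indicator {x..y} s *\<^sub>R (U \<circ> Inr) s) + K * (indicator {x..y} s *\<^sub>R Mv s)" for n
      proof (rule AE_I2)
        fix s
        have "e n * Mv s \<le> K * Mv s" using K[of n] Mv(2)[of s] by (intro mult_right_mono) auto
        then show "norm (indicator {x..y} s *\<^sub>R (Us n \<circ> Inr) s) \<le>
         norm (indicator {x..y} s *\<^sub>R (U \<circ> Inr) s) + K * (indicator {x..y} s *\<^sub>R Mv s)"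
          using lev[of n s] by (auto simp: indicator_def)
      qed
      show "AE s in lborel. (\<lambda>n. indicator {x..y} s *\<^sub>R (Us n \<circ> Inr) s) \<longlonglongrightarrow> indicator {x..y} s *\<^sub>R (U \<circ> Inr) s"
        by (intro AE_I2 tendsto_intros) (simp add: lim)
    qed (use 2 mv in \<open>simp_all add: o_def\<close>)
    moreover have "(LBINT s:{x..y}. (Us n \<circ> Inr) s) = Us n (Inl y) - Us n (Inl x)" for n
      using AC_diff[OF AU xy] by simp
    moreover have "(\<lambda>n. Us n (Inl y) - Us n (Inl x)) \<longlonglongrightarrow> U (Inl y) - U (Inl x)"
      by (intro tendsto_intros lim)
    ultimately show "set_integrable lborel {x..y} (U \<circ> Inr) \<and>
        (U \<circ> Inl) y - (U \<circ> Inl) x = (LBINT s:{x..y}. (U \<circ> Inr) s)"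
      using i LIMSEQ_unique by auto
  qed
  show ?thesis using 1 2 3 4 5 by (simp add: Cl_def)
qed

theorem solution_exists:
  assumes T: "T > 0"
    and phi: "\<phi> \<in> Cl" "\<And>p. \<bar>\<phi> p\<bar> \<le> W p" and psi: "\<psi> \<in> Cl" "\<And>p. \<bar>\<psi> p\<bar> \<le> W p"
  shows "\<exists>U U1 C. U 0 = \<phi> \<and> U1 0 = \<psi> \<and> weighted_solution Cl F W T C U U1"
proof -
  text \<open>The growth of \<open>w\<close> fixes the rate \<open>k1\<close> of the sup bound, this the Lipschitz constant \<open>L\<close>,
    and this the rate \<open>k2\<close> of the weighted bounds.\<close>
  define k1 where "k1 = 1 + N * (2 * a + b)"
  have k1: "k1 \<ge> 1" "N * (2 * a + b) \<le> k1^2"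
  proof -
    have p: "N * (2 * a + b) \<ge> 0" using N ab by simp
    then show "k1 \<ge> 1" by (simp add: k1_def)
    show "N * (2 * a + b) \<le> k1^2" unfolding k1_def by (rule le_one_plus_square[OF p])
  qed
  define S where "S = R * exp (k1 * T)"
  have S: "S \<ge> 0" using R by (simp add: S_def)
  obtain Lw where Lw: "Lw \<ge> 0" "\<And>x y. \<bar>x\<bar> \<le> 2 * S \<Longrightarrow> \<bar>y\<bar> \<le> 2 * S \<Longrightarrow> \<bar>w x - w y\<bar> \<le> Lw * \<bar>x - y\<bar>"
    using loc_lipschitz_obtain[OF w(1), of "2 * S"] by metis
  obtain Lh where Lh: "Lh \<ge> 0" "\<And>x y. \<bar>x\<bar> \<le> 2 * S \<Longrightarrow> \<bar>y\<bar> \<le> 2 * S \<Longrightarrow> \<bar>h x - h y\<bar> \<le> Lh * \<bar>x - y\<bar>"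
    "\<And>x. \<bar>x\<bar> \<le> 2 * S \<Longrightarrow> \<bar>h x\<bar> \<le> Lh"
    using loc_lipschitz_obtain[OF h, of "2 * S"] by metis
  define L where "L = Lw + Lh"
  have L: "L \<ge> 0" "Lw \<le> L" "Lh \<le> L" using Lw(1) Lh(1) by (auto simp: L_def)
  have wL: "\<bar>w x - w y\<bar> \<le> L * \<bar>x - y\<bar>" if "\<bar>x\<bar> \<le> 2 * S" "\<bar>y\<bar> \<le> 2 * S" for x y
    using Lw(2)[OF that] mult_right_mono[OF L(2), of "\<bar>x - y\<bar>"] by linarith
  have hL: "\<bar>h x - h y\<bar> \<le> L * \<bar>x - y\<bar>" if "\<bar>x\<bar> \<le> 2 * S" "\<bar>y\<bar> \<le> 2 * S" for x y
    using Lh(2)[OF that] mult_right_mono[OF L(3), of "\<bar>x - y\<bar>"] by linarith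
  have hB: "\<bar>h x\<bar> \<le> L" if "\<bar>x\<bar> \<le> 2 * S" for x using Lh(3)[OF that] L(3) by linarith
  note ctx = S L(1) wL hL hB
  define k2 where "k2 = 1 + L * lam"
  have k2: "k2 \<ge> 1" "L * lam \<le> k2^2"
  proof -
    have p: "L * lam \<ge> 0" using L lam by simp
    then show "k2 \<ge> 1" by (simp add: k2_def)
    show "L * lam \<le> k2^2" unfolding k2_def by (rule le_one_plus_square[OF p])
  qed
  \<comment> \<open>The displacement carries two bounds: the uniform one, with rate
    \<open>k1\<close>, confines it to the range where \<open>L\<close> is valid, and the weighted
    one, with rate \<open>k2\<close>, leads to norm bounds. The derivative may be unbounded and
    carries the weighted one only.\<close>
  define bnd where "bnd = case_sum (\<lambda>x. {(k1, R), (k2, Mu x)}) (\<lambda>x. {(k2, Mv x)})"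
  define D where "D t = {U \<in> Cl. \<forall>p. \<forall>(k, B) \<in> bnd p. \<bar>U p\<bar> \<le> B * exp (k * t)}" for t
  have D: "U \<circ> Inl \<in> borel_measurable borel" "U \<circ> Inr \<in> borel_measurable borel"
     "\<bar>(U \<circ> Inl) x\<bar> \<le> R * exp (k1 * t)"
     "\<bar>(U \<circ> Inl) x\<bar> \<le> exp (k2 * t) * Mu x" "\<bar>(U \<circ> Inr) x\<bar> \<le> exp (k2 * t) * Mv x"
     "\<bar>(U \<circ> Inl) x\<bar> \<le> S" "\<bar>(U \<circ> Inr) x\<bar> \<le> exp (k2 * T) * Mv x" "U \<in> Cl"
    if U: "U \<in> D t" and t: "t \<in> {0..T}" for U t x
  proof -
    have d: "(k, B) \<in> bnd p \<Longrightarrow> \<bar>U p\<bar> \<le> B * exp (k * t)" for k B p using U by (auto simp: D_def)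
    show 1: "\<bar>(U \<circ> Inl) x\<bar> \<le> R * exp (k1 * t)" using d[of k1 R "Inl x"] by (simp add: bnd_def)
    show "\<bar>(U \<circ> Inl) x\<bar> \<le> exp (k2 * t) * Mu x" using d[of k2 "Mu x" "Inl x"] by (simp add: bnd_def mult.commute)
    show 2: "\<bar>(U \<circ> Inr) x\<bar> \<le> exp (k2 * t) * Mv x" using d[of k2 "Mv x" "Inr x"] by (simp add: bnd_def mult.commute)
    have "R * exp (k1 * t) \<le> S" unfolding S_def using R k1 t by (intro mult_left_mono) auto
    then show "\<bar>(U \<circ> Inl) x\<bar> \<le> S" using 1 by linarith
    have "exp (k2 * t) * Mv x \<le> exp (k2 * T) * Mv x" using Mv(2) k2 t by (intro mult_right_mono) auto
    then show "\<bar>(U \<circ> Inr) x\<bar> \<le> exp (k2 * T) * Mv x" using 2 by linarith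
    show "U \<in> Cl" using U by (simp add: D_def)
    then show "U \<circ> Inl \<in> borel_measurable borel" "U \<circ> Inr \<in> borel_measurable borel" by (auto simp: Cl_def)
  qed
  \<comment> \<open>The constant of \<open>Fv_lipschitz\<close> with
    \<open>c1 = exp (k2 * T)\<close>, the factor by which \<open>v\<close> may exceed its weight on
    [0, T]; it also covers \<open>Fu_lipschitz\<close>.\<close>
  define Lam where "Lam = L * lam * (1 + 2 * R * exp (k2 * T))"
  have Lam: "L * lam \<le> Lam" "Lam \<ge> 0"
  proof -
    have p: "L * lam \<ge> 0" using L lam by simp
    have "L * lam * 1 \<le> Lam" unfolding Lam_def using R p by (intro mult_left_mono) auto
    then show "L * lam \<le> Lam" "Lam \<ge> 0" using p by auto
  qed
  interpret picard W bnd F Cl T Lam k2 \<phi> \<psi> D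
  proof
    show "U \<in> D t \<longleftrightarrow> U \<in> Cl \<and> (\<forall>p. \<forall>(k, B) \<in> bnd p. \<bar>U p\<bar> \<le> B * exp (k * t))" for t U
      by (simp add: D_def)
    show "T > 0" "Lam \<ge> 0" "W p \<ge> 0" for p by (fact T Lam W_nonneg)+
    show "(k2, W p) \<in> bnd p" for p by (cases p) (auto simp: bnd_def W_def)
    show "k > 0 \<and> B \<ge> 0" if "(k, B) \<in> bnd p" for p k B
      using that k1 k2 R Mu(2) Mv(2) by (cases p) (auto simp: bnd_def)
    show "(\<lambda>p. U p + V p) \<in> Cl" if "U \<in> Cl" "V \<in> Cl" for U V by (rule Cl_add[OF that])
    show "(\<lambda>p. c * U p) \<in> Cl" if "U \<in> Cl" for U c by (rule Cl_scale[OF that])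
    show "U \<in> Cl" if "\<And>n::nat. Us n \<in> Cl" "\<And>n p. \<bar>Us n p - U p\<bar> \<le> e n * W p" "e \<longlonglongrightarrow> 0" for Us U e
      by (rule Cl_lim[OF that])
    show "F U \<in> Cl" if t: "t \<in> {0..T}" and U: "U \<in> D t" for t U
    proof -
      note d = D[OF U t]
      have "cu \<Longrightarrow> continuous_on UNIV (Fu (U \<circ> Inl))"
        by (rule Fu_continuous[OF ctx ClD(1)[OF d(8)] d(6)])
      moreover have "continuous_on UNIV (Fv (U \<circ> Inl) (U \<circ> Inr))" if c: cv
      proof -
        obtain K where K: "\<And>x. Mv x \<le> K" using cv[OF c] by blast
        have "\<bar>(U \<circ> Inr) x\<bar> \<le> exp (k2 * T) * K" for x
          using d(7)[of x] mult_left_mono[OF K[of x], of "exp (k2 * T)"] by (auto intro: order_trans)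
        from Fv_continuous[OF ctx ClD(1)[OF d(8)] d(6) ClD(2)[OF d(8) c] this] show ?thesis
          using cv[OF c] by blast
      qed
      moreover have "ac \<Longrightarrow> AC (Fu (U \<circ> Inl)) (Fv (U \<circ> Inl) (U \<circ> Inr))"
        by (rule Fu_AC[OF ctx _ ClD(3)[OF d(8)] d(6) d(2) d(7)]) auto
      ultimately show ?thesis
        using Fu_measurable[OF d(1)] Fv_measurable[OF d(1,2)] unfolding Cl_def mem_Collect_eq F_o by blast
    qed
    show "\<bar>F U p\<bar> \<le> k^2 * B * exp (k * t)"
      if t: "t \<in> {0..T}" and U: "U \<in> D t" and b: "(k, B) \<in> bnd p" for t U p k B
    proof -
      note d = D[OF U t]
      have e: "exp (k2 * t) \<ge> 0" by simp
      have k2M: "L * lam * exp (k2 * t) * M \<le> k2^2 * M * exp (k2 * t)" if "M \<ge> 0" for M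
        using mult_right_mono[OF k2(2), of "exp (k2 * t) * M"] that by (simp add: mult_ac)
      show ?thesis
      proof (cases p)
        case (Inl x)
        with b consider "k = k1" "B = R" | "k = k2" "B = Mu x" by (auto simp: bnd_def)
        then show ?thesis
        proof cases
          case 1
          let ?E = "R * exp (k1 * t)"
          \<comment> \<open>This absorbs the additive constant \<open>b\<close> of the growth
            condition into \<open>b * ?E\<close>, which is the use of
            \<open>R \<ge> 1\<close>.\<close>
          have E: "?E \<ge> 1" using mult_mono[of 1 R 1 "exp (k1 * t)"] R k1 t by auto
          have ES: "?E \<le> S" unfolding S_def using R k1 t by (intro mult_left_mono) auto
          have "\<bar>Fu (U \<circ> Inl) x\<bar> \<le> N * (2 * a * ?E + b)"
            by (rule Fu_growth[OF ctx d(1) d(3) ES])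
          also have "\<dots> \<le> N * (2 * a * ?E + b * ?E)"
            using N ab E mult_left_mono[OF E ab(2)] by (intro mult_left_mono) auto
          also have "\<dots> = N * (2 * a + b) * ?E" by (simp add: algebra_simps)
          also have "\<dots> \<le> k1^2 * ?E" using k1 E by (intro mult_right_mono) auto
          finally show ?thesis using 1 Inl by (simp add: F_def mult.assoc)
        next
          case 2
          have "\<bar>Fu (U \<circ> Inl) x\<bar> \<le> L * lam * exp (k2 * t) * Mu x"
            by (rule Fu_bound[OF ctx d(1) d(6) e d(4)])
          from order_trans[OF this k2M[OF Mu(2)[of x]]] show ?thesis using 2 Inl by (simp add: F_def)
        qed
      next
        case (Inr x)
        have "\<bar>Fv (U \<circ> Inl) (U \<circ> Inr) x\<bar> \<le> L * lam * exp (k2 * t) * Mv x"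
          by (rule Fv_bound[OF ctx d(1,2) d(6) d(5) e])
        from order_trans[OF this k2M[OF Mv(2)[of x]]] show ?thesis using b Inr by (simp add: F_def bnd_def)
      qed
    qed
    show "\<bar>F U p - F V p\<bar> \<le> Lam * c * W p"
      if st: "s \<in> {0..T}" "t \<in> {0..T}" and UV: "U \<in> D s" "V \<in> D t" and c: "c \<ge> 0"
        and le: "\<And>p. \<bar>U p - V p\<bar> \<le> c * W p" for s t U V c p
    proof -
      note d = D[OF UV(1) st(1)] and d' = D[OF UV(2) st(2)]
      have leu: "\<bar>(U \<circ> Inl) x - (V \<circ> Inl) x\<bar> \<le> c * Mu x" for x using le[of "Inl x"] by (simp add: W_def)
      have lev: "\<bar>(U \<circ> Inr) x - (V \<circ> Inr) x\<bar> \<le> c * Mv x" for x using le[of "Inr x"] by (simp add: W_def)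
      show ?thesis
      proof (cases p)
        case (Inl x)
        have "\<bar>Fu (U \<circ> Inl) x - Fu (V \<circ> Inl) x\<bar> \<le> L * lam * c * Mu x"
          by (rule Fu_lipschitz[OF ctx d(1) d'(1) d(6) d'(6) c leu])
        also have "\<dots> \<le> Lam * c * Mu x"
          using Lam c Mu(2)[of x] by (intro mult_right_mono) auto
        finally show ?thesis using Inl by (simp add: F_def W_def)
      next
        case (Inr x)
        have "\<bar>Fv (U \<circ> Inl) (U \<circ> Inr) x - Fv (V \<circ> Inl) (V \<circ> Inr) x\<bar>
            \<le> L * lam * (1 + 2 * R * exp (k2 * T)) * c * Mv x"
          by (rule Fv_lipschitz[OF ctx d(1) d'(1) d(2) d'(2) d(6) d'(6) d(7) d'(7) c _ leu lev]) simp_all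
        then show ?thesis using Inr by (simp add: F_def W_def Lam_def)
      qed
    qed
    show "\<phi> \<in> Cl" "\<psi> \<in> Cl" by (fact phi psi)+
    \<comment> \<open>Both rates are at least 1, so initial velocities bounded by \<open>W\<close>
      meet the bound \<open>k * B\<close>.\<close>
    have WB: "W p \<le> B" "B \<le> k * B" if "(k, B) \<in> bnd p" for p k B
    proof -
      show "W p \<le> B" using that Mu(3) by (cases p) (auto simp: bnd_def W_def)
      have "k \<ge> 1" "B \<ge> 0" using that k1 k2 R Mu(2) Mv(2) by (cases p; auto simp: bnd_def)+
      then show "B \<le> k * B" using mult_right_mono[of 1 k B] by simp
    qed
    show "\<bar>\<phi> p\<bar> \<le> B" if "(k, B) \<in> bnd p" for p k B
      using phi(2)[of p] WB[OF that] by linarith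
    show "\<bar>\<psi> p\<bar> \<le> k * B" if "(k, B) \<in> bnd p" for p k B
      using psi(2)[of p] WB[OF that] by linarith
  qed
  show ?thesis by (rule picard_solution)
qed

lemma Fu_eq_peri_op: "Fu u x = peri_op \<alpha> w u x"
  unfolding Fu_def peri_op_def
  by (subst (2) lborel_integral_real_affine[of 1 _ x]) auto

text \<open>The assumption \<open>X\<close> is the interface to the function space: within
  \<open>Cl\<close>, domination by the weight gives membership and a norm bound, with
  \<open>K\<close> in the role of the norm of the weight. The initial pair holds representatives,
  tied to the given data by \<open>feq\<close>.\<close>

theorem C2_curve_exists:
  assumes T: "T > 0" and phi: "\<phi> \<in> Cl" "\<And>p. \<bar>\<phi> p\<bar> \<le> W p" and psi: "\<psi> \<in> Cl" "\<And>p. \<bar>\<psi> p\<bar> \<le> W p"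
    and X: "\<And>U c. U \<in> Cl \<Longrightarrow> c \<ge> 0 \<Longrightarrow> (\<And>p. \<bar>U p\<bar> \<le> c * W p)
         \<Longrightarrow> U \<circ> Inl \<in> fcarrier X \<and> \<bar>fnorm X (U \<circ> Inl)\<bar> \<le> c * K"
    and refl: "\<And>f. feq X f f"
    and init: "feq X (\<phi> \<circ> Inl) \<phi>0" "feq X (\<psi> \<circ> Inl) \<psi>0"
  shows "\<exists>u u1 u2. C2_curve X T u u1 u2 \<and> (\<forall>t\<in>{0..T}. feq X (u2 t) (peri_op \<alpha> w (u t)))
            \<and> feq X (u 0) \<phi>0 \<and> feq X (u1 0) \<psi>0"
proof -
  obtain U U1 C where U0: "U 0 = \<phi>" "U1 0 = \<psi>" and U: "weighted_solution Cl F W T C U U1"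
    using solution_exists[OF T phi psi] by blast
  note sol = U[unfolded weighted_solution_def]
  have C: "C \<ge> 0" using sol by blast
  have Cl_minus: "(\<lambda>p. V p - V' p) \<in> Cl" if "V \<in> Cl" "V' \<in> Cl" for V V'
    using Cl_add[OF that(1) Cl_scale[OF that(2), of "-1"]] by simp
  have Cl_quot: "(\<lambda>p. (V p - V' p) / r - V'' p) \<in> Cl" if "V \<in> Cl" "V' \<in> Cl" "V'' \<in> Cl" for V V' V'' r
    using Cl_minus[OF Cl_scale[OF Cl_minus[OF that(1,2)], of "1 / r"] that(3)] by simp
  \<comment> \<open>Applied to the errors of both difference quotients and to the increments of the
    second derivative, all dominated by \<open>C * \<bar>s - t\<bar> * W\<close>.\<close>
  have lim: "((\<lambda>s. fnorm X (V s \<circ> Inl)) \<longlongrightarrow> 0) (at t within {0..T})"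
    if V: "\<And>s. s \<in> {0..T} \<Longrightarrow> s \<noteq> t \<Longrightarrow> V s \<in> Cl \<and> (\<forall>p. \<bar>V s p\<bar> \<le> C * \<bar>s - t\<bar> * W p)" for V t
  proof (rule Lim_null_comparison)
    have "norm (fnorm X (V s \<circ> Inl)) \<le> C * \<bar>s - t\<bar> * K" if "s \<in> {0..T}" "s \<noteq> t" for s
      using X[of "V s" "C * \<bar>s - t\<bar>"] V[OF that] C by simp
    then show "\<forall>\<^sub>F s in at t within {0..T}. norm (fnorm X (V s \<circ> Inl)) \<le> C * \<bar>s - t\<bar> * K"
      by (auto simp: eventually_at_filter)
    show "((\<lambda>s. C * \<bar>s - t\<bar> * K) \<longlongrightarrow> 0) (at t within {0..T})"
      by (auto intro!: tendsto_eq_intros)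
  qed
  let ?u = "\<lambda>t. U t \<circ> Inl" and ?u1 = "\<lambda>t. U1 t \<circ> Inl" and ?u2 = "\<lambda>t. F (U t) \<circ> Inl"
  have "C2_curve X T ?u ?u1 ?u2"
    unfolding C2_curve_def X_has_deriv_def X_continuous_def
  proof (intro conjI ballI)
    fix t assume t: "t \<in> {0..T}"
    show "U t \<circ> Inl \<in> fcarrier X" "U1 t \<circ> Inl \<in> fcarrier X" "F (U t) \<circ> Inl \<in> fcarrier X"
      using X[OF _ C] sol t by blast+
    show "((\<lambda>s. fnorm X (\<lambda>x. ((U s \<circ> Inl) x - (U t \<circ> Inl) x) / (s - t) - (U1 t \<circ> Inl) x)) \<longlongrightarrow> 0) (at t within {0..T})"
      using lim[of t "\<lambda>s p. (U s p - U t p) / (s - t) - U1 t p"] sol t Cl_quot by (simp add: o_def)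
    show "((\<lambda>s. fnorm X (\<lambda>x. ((U1 s \<circ> Inl) x - (U1 t \<circ> Inl) x) / (s - t) - (F (U t) \<circ> Inl) x)) \<longlongrightarrow> 0) (at t within {0..T})"
      using lim[of t "\<lambda>s p. (U1 s p - U1 t p) / (s - t) - F (U t) p"] sol t Cl_quot by (simp add: o_def del: F_o)
    show "((\<lambda>s. fnorm X (\<lambda>x. (F (U s) \<circ> Inl) x - (F (U t) \<circ> Inl) x)) \<longlongrightarrow> 0) (at t within {0..T})"
      using lim[of t "\<lambda>s p. F (U s) p - F (U t) p"] sol t Cl_minus by (simp add: o_def del: F_o)
  qed
  moreover have "?u2 t = peri_op \<alpha> w (?u t)" for t
    by (rule ext) (simp add: Fu_eq_peri_op)
  ultimately show ?thesis
    using refl init U0 by (intro exI[of _ ?u] exI[of _ ?u1] exI[of _ ?u2]) auto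
qed

end

section \<open>Weights and Lebesgue spaces\<close>

text \<open>The positive operator on the left of the weight inequality. Values in
  \<open>ennreal\<close> let the series of its powers exist at every point, with finiteness settled
  afterwards.\<close>

definition smear :: "(real \<Rightarrow> ennreal) \<Rightarrow> (real \<Rightarrow> ennreal) \<Rightarrow> real \<Rightarrow> ennreal" where
  "smear k f x = (\<integral>\<^sup>+z. k z * (f (x + z) + f x) \<partial>lborel)"

lemma smear_measurable [measurable]:
  assumes [measurable]: "k \<in> borel_measurable borel" "f \<in> borel_measurable borel"
  shows "smear k f \<in> borel_measurable borel"
  unfolding smear_def[abs_def] by measurable

lemma nn_integral_smear:
  assumes [measurable]: "k \<in> borel_measurable borel" "f \<in> borel_measurable borel"
  shows "(\<integral>\<^sup>+x. smear k f x \<partial>lborel) = 2 * (\<integral>\<^sup>+z. k z \<partial>lborel) * (\<integral>\<^sup>+x. f x \<partial>lborel)"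
proof -
  have "(\<integral>\<^sup>+x. smear k f x \<partial>lborel) = (\<integral>\<^sup>+z. (\<integral>\<^sup>+x. k z * (f (x + z) + f x) \<partial>lborel) \<partial>lborel)"
    unfolding smear_def by (rule lborel_pair.Fubini') measurable
  also have "\<dots> = (\<integral>\<^sup>+z. k z * (2 * (\<integral>\<^sup>+x. f x \<partial>lborel)) \<partial>lborel)"
  proof (rule nn_integral_cong)
    fix z
    have "(\<integral>\<^sup>+x. f (x + z) \<partial>lborel) = (\<integral>\<^sup>+x. f x \<partial>lborel)"
      using nn_integral_real_affine[of f 1 z] by (simp add: add.commute)
    then show "(\<integral>\<^sup>+x. k z * (f (x + z) + f x) \<partial>lborel) = k z * (2 * (\<integral>\<^sup>+x. f x \<partial>lborel))"
      by (simp add: nn_integral_cmult nn_integral_add mult_2)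
  qed
  also have "\<dots> = 2 * (\<integral>\<^sup>+z. k z \<partial>lborel) * (\<integral>\<^sup>+x. f x \<partial>lborel)"
    by (simp add: nn_integral_multc mult_ac)
  finally show ?thesis .
qed

lemma powr_le_one_plus:
  fixes t :: real assumes "t \<ge> 0" "0 < q" "q \<le> 1"
  shows "t powr q \<le> 1 + t"
proof (cases "t \<le> 1")
  case True
  then have "t powr q \<le> 1" using assms by (intro powr_le1) auto
  then show ?thesis using assms by linarith
next
  case False
  then have "t powr q \<le> t powr 1" using assms by (intro powr_mono) auto
  then show ?thesis using False by simp
qed

text \<open>For \<open>Q = (\<Sum>k. smear\<^sup>k f)\<close> one has \<open>smear Q \<le> Q\<close>. The weight \<open>Q powr (1/p)\<close> inherits a bound
  of this kind because \<open>(s/y) powr (1/p) \<le> 1 + s/y\<close>.\<close>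

definition weight :: "(real \<Rightarrow> real) \<Rightarrow> real set \<Rightarrow> real \<Rightarrow> (real \<Rightarrow> real) \<Rightarrow> bool" where
  "weight \<alpha> G lam M \<longleftrightarrow> G \<in> sets borel \<and> (AE x in lborel. x \<in> G) \<and> lam \<ge> 0
     \<and> M \<in> borel_measurable borel \<and> (\<forall>x. 0 \<le> M x) \<and> (\<forall>x. x \<notin> G \<longrightarrow> M x = 0)
     \<and> (\<forall>x\<in>G. integrable lborel (\<lambda>z. \<alpha> z * M (x + z))
          \<and> (LBINT z. \<bar>\<alpha> z\<bar> * (M (x + z) + M x)) \<le> lam * M x)"

lemma weight_powr_exists:
  fixes \<alpha> f :: "real \<Rightarrow> real" and p :: real
  assumes alpha: "integrable lborel \<alpha>" and f: "integrable lborel f" "\<And>x. f x > 0" and p: "p \<ge> 1"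
  shows "\<exists>M G lam. weight \<alpha> G lam M \<and> (\<forall>x\<in>G. f x powr (1 / p) \<le> M x)
    \<and> integrable lborel (\<lambda>x. M x powr p)
    \<and> (\<forall>K. (\<forall>x. f x \<le> K) \<longrightarrow> G = UNIV \<and> (\<forall>x. M x \<le> (2 * K) powr (1 / p)))"
proof -
  have [measurable]: "\<alpha> \<in> borel_measurable borel" "f \<in> borel_measurable borel"
    using alpha f by auto
  define N where "N = (LBINT z. \<bar>\<alpha> z\<bar>)"
  have N: "N \<ge> 0" unfolding N_def by (intro integral_nonneg_AE) auto
  \<comment> \<open>Scales the kernel so that twice its integral is at most 1/2: each application of
    \<open>smear k\<close> then at least halves the integral and, for bounded f, also the sup
    bound.\<close>
  define r where "r = 1 / (4 * (N + 1))"
  have r: "r > 0" using N by (simp add: r_def)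
  define k where "k z = ennreal (r * \<bar>\<alpha> z\<bar>)" for z
  have [measurable]: "k \<in> borel_measurable borel" unfolding k_def by measurable
  have kint: "2 * (\<integral>\<^sup>+z. k z \<partial>lborel) \<le> ennreal (1/2)"
  proof -
    have "(\<integral>\<^sup>+z. k z \<partial>lborel) = ennreal (LBINT z. r * \<bar>\<alpha> z\<bar>)"
      unfolding k_def using alpha r by (intro nn_integral_eq_integral) auto
    also have "(LBINT z. r * \<bar>\<alpha> z\<bar>) = r * N" by (simp add: N_def)
    finally have "2 * (\<integral>\<^sup>+z. k z \<partial>lborel) = ennreal (2 * (r * N))"
      using r N by (simp add: ennreal_mult)
    also have "\<dots> \<le> ennreal (1/2)" using N by (intro ennreal_leI) (simp add: r_def field_simps)
    finally show ?thesis .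
  qed
  define P where "P n = (smear k ^^ n) (\<lambda>x. ennreal (f x))" for n
  have P0: "P 0 x = ennreal (f x)" for x by (simp add: P_def)
  have PSuc: "P (Suc n) = smear k (P n)" for n by (simp add: P_def)
  have Pm [measurable]: "P n \<in> borel_measurable borel" for n
    by (induction n) (auto simp: PSuc P0[abs_def])
  define Q where "Q x = (\<Sum>n. P n x)" for x
  have Qm [measurable]: "Q \<in> borel_measurable borel" unfolding Q_def[abs_def] by measurable
  have sQ: "smear k Q x \<le> Q x" for x
  proof -
    have "smear k Q x = (\<integral>\<^sup>+z. (\<Sum>n. k z * (P n (x + z) + P n x)) \<partial>lborel)"
      unfolding smear_def Q_def by (simp add: suminf_add summableI)
    also have "\<dots> = (\<Sum>n. P (Suc n) x)"
      unfolding PSuc smear_def by (rule nn_integral_suminf) measurable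
    also have "\<dots> \<le> Q x"
      unfolding Q_def using suminf_offset[of "\<lambda>n. P n x" 1] by (simp add: summableI)
    finally show ?thesis .
  qed
  have half: "ennreal (1/2) * (ennreal ((1/2)^n) * X) = ennreal ((1/2)^Suc n) * X" for n X
    by (subst mult.assoc[symmetric], subst ennreal_mult[symmetric]) auto
  have PI: "(\<integral>\<^sup>+x. P n x \<partial>lborel) \<le> ennreal ((1/2)^n) * (\<integral>\<^sup>+x. ennreal (f x) \<partial>lborel)" for n
  proof (induction n)
    case (Suc n)
    have "(\<integral>\<^sup>+x. P (Suc n) x \<partial>lborel) = 2 * (\<integral>\<^sup>+z. k z \<partial>lborel) * (\<integral>\<^sup>+x. P n x \<partial>lborel)"
      unfolding PSuc by (rule nn_integral_smear) measurable
    also have "\<dots> \<le> ennreal (1/2) * (ennreal ((1/2)^n) * (\<integral>\<^sup>+x. ennreal (f x) \<partial>lborel))"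
      by (intro mult_mono kint Suc) auto
    also have "\<dots> = ennreal ((1/2)^Suc n) * (\<integral>\<^sup>+x. ennreal (f x) \<partial>lborel)"
      by (rule half)
    finally show ?case .
  qed (simp add: P0)
  have "(\<lambda>n. (1/2::real)^n) sums 2" using geometric_sums[of "1/2::real"] by simp
  then have "(\<Sum>n. ennreal ((1/2)^n)) = ennreal 2" by (intro suminf_ennreal_eq) auto
  then have geo: "(\<Sum>n. ennreal ((1/2)^n)) = 2" by (simp only: ennreal_numeral)
  have QI: "(\<integral>\<^sup>+x. Q x \<partial>lborel) < \<infinity>"
  proof -
    have "(\<integral>\<^sup>+x. Q x \<partial>lborel) = (\<Sum>n. \<integral>\<^sup>+x. P n x \<partial>lborel)"
      unfolding Q_def by (rule nn_integral_suminf) measurable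
    also have "\<dots> \<le> (\<Sum>n. ennreal ((1/2)^n) * (\<integral>\<^sup>+x. ennreal (f x) \<partial>lborel))"
      by (intro suminf_le PI summableI)
    also have "\<dots> = 2 * (\<integral>\<^sup>+x. ennreal (f x) \<partial>lborel)"
      by (simp only: ennreal_suminf_multc geo)
    also have "\<dots> < \<infinity>"
      using f by (subst nn_integral_eq_integral) (auto simp: less_imp_le ennreal_mult_less_top)
    finally show ?thesis .
  qed
  define G where "G = {x. Q x < \<infinity>}"
  have G: "G \<in> sets borel" unfolding G_def by measurable
  have GAE: "AE x in lborel. x \<in> G"
    using nn_integral_PInf_AE[of Q lborel] QI by (auto simp: G_def less_top)
  define q where "q x = enn2real (Q x)" for x
  have Qq: "Q x = ennreal (q x)" if "x \<in> G" for x using that by (simp add: G_def q_def)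
  have q0: "q x \<ge> 0" for x by (simp add: q_def)
  have fQ: "ennreal (f x) \<le> Q x" for x
    unfolding Q_def using sum_le_suminf[of "\<lambda>n. P n x" "{0}"] by (simp add: P0 summableI)
  have fq: "f x \<le> q x" if "x \<in> G" for x
    using fQ[of x] Qq[OF that] q0 by (simp add: ennreal_le_iff)
  have qpos: "q x > 0" if "x \<in> G" for x using fq[OF that] f(2)[of x] by linarith
  define M where "M x = indicator G x * q x powr (1 / p)" for x
  have [measurable]: "q \<in> borel_measurable borel" unfolding q_def[abs_def] by measurable
  have Mm [measurable]: "M \<in> borel_measurable borel" unfolding M_def[abs_def] using G by measurable
  have M0: "M x \<ge> 0" for x by (simp add: M_def)
  have key: "(\<integral>\<^sup>+z. ennreal (\<bar>\<alpha> z\<bar> * (M (x + z) + M x)) \<partial>lborel) \<le> ennreal (2 / r * M x)" if x: "x \<in> G" for x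
  proof -
    \<comment> \<open>The factor with \<open>c * q x = M x\<close>; division is possible since
      \<open>q x \<ge> f x > 0\<close>. Both \<open>M (x + z)\<close> and \<open>M x\<close> are at
      most \<open>c * (Q (x + z) + Q x)\<close>, whence a factor 2; undoing the scaling of the
      kernel gives \<open>1 / r\<close>. Together they make up the constant \<open>2 / r\<close> of
      the weight.\<close>
    define c where "c = q x powr (1 / p) / q x"
    have c: "c > 0" "c * q x = M x" using qpos[OF x] x by (auto simp: c_def M_def)
    have le: "ennreal (M (x + z)) \<le> ennreal c * (Q (x + z) + Q x)" for z
    proof (cases "x + z \<in> G")
      case True
      have "q (x + z) powr (1 / p) = (q x * (q (x + z) / q x)) powr (1 / p)" using qpos[OF x] by simp
      also have "\<dots> = q x powr (1 / p) * (q (x + z) / q x) powr (1 / p)"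
        by (subst powr_mult) (use q0 in auto)
      also have "\<dots> \<le> q x powr (1 / p) * (1 + q (x + z) / q x)"
        using p q0 by (intro mult_left_mono powr_le_one_plus) auto
      also have "\<dots> = c * (q (x + z) + q x)" using qpos[OF x] by (simp add: c_def field_simps)
      finally have "M (x + z) \<le> c * (q (x + z) + q x)" using True by (simp add: M_def)
      then have "ennreal (M (x + z)) \<le> ennreal (c * (q (x + z) + q x))" by (rule ennreal_leI)
      also have "\<dots> = ennreal c * (Q (x + z) + Q x)"
        using c q0 by (simp add: ennreal_mult Qq[OF True] Qq[OF x])
      finally show ?thesis .
    qed (simp add: M_def)
    have le2: "ennreal (M x) \<le> ennreal c * (Q (x + z) + Q x)" for z
    proof -
      have "ennreal (M x) = ennreal c * Q x" using c q0 by (simp add: ennreal_mult Qq[OF x] flip: c(2))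
      also have "\<dots> \<le> ennreal c * (Q (x + z) + Q x)" by (intro mult_left_mono) auto
      finally show ?thesis .
    qed
    have "(\<integral>\<^sup>+z. ennreal (\<bar>\<alpha> z\<bar> * (M (x + z) + M x)) \<partial>lborel)
       \<le> (\<integral>\<^sup>+z. ennreal (2 * c / r) * (k z * (Q (x + z) + Q x)) \<partial>lborel)"
    proof (rule nn_integral_mono)
      fix z
      have "ennreal (\<bar>\<alpha> z\<bar> * (M (x + z) + M x)) = ennreal \<bar>\<alpha> z\<bar> * (ennreal (M (x + z)) + ennreal (M x))"
        using M0 by (simp add: ennreal_mult)
      also have "\<dots> \<le> ennreal \<bar>\<alpha> z\<bar> * (ennreal c * (Q (x + z) + Q x) + ennreal c * (Q (x + z) + Q x))"
        by (intro mult_left_mono add_mono le le2) auto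
      also have "\<dots> = ennreal (2 * c * \<bar>\<alpha> z\<bar>) * (Q (x + z) + Q x)"
      proof -
        have "s * (t * X + t * X) = 2 * t * s * X" for s t X :: ennreal
          by (simp only: mult_2[symmetric]) (simp only: mult_ac)
        then show ?thesis using c by (simp add: ennreal_mult)
      qed
      also have "2 * c * \<bar>\<alpha> z\<bar> = 2 * c / r * (r * \<bar>\<alpha> z\<bar>)" using r by simp
      also have "ennreal (2 * c / r * (r * \<bar>\<alpha> z\<bar>)) = ennreal (2 * c / r) * k z"
        unfolding k_def using c r by (intro ennreal_mult) auto
      finally show "ennreal (\<bar>\<alpha> z\<bar> * (M (x + z) + M x)) \<le> ennreal (2 * c / r) * (k z * (Q (x + z) + Q x))"
        by (simp only: mult.assoc)
    qed
    also have "\<dots> = ennreal (2 * c / r) * smear k Q x"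
      unfolding smear_def by (rule nn_integral_cmult) measurable
    also have "\<dots> \<le> ennreal (2 * c / r) * Q x" by (intro mult_left_mono sQ) auto
    also have "\<dots> = ennreal (2 * c / r * q x)"
      unfolding Qq[OF x] using c r q0 by (intro ennreal_mult[symmetric]) auto
    also have "2 * c / r * q x = 2 / r * M x" using c(2) by (simp add: field_simps)
    finally show ?thesis .
  qed
  have "integrable lborel (\<lambda>z. \<alpha> z * M (x + z))" if x: "x \<in> G" for x
  proof (rule Bochner_Integration.integrable_bound)
    show "integrable lborel (\<lambda>z. \<bar>\<alpha> z\<bar> * (M (x + z) + M x))"
      using order_le_less_trans[OF key[OF x], of \<infinity>] M0 by (intro integrableI_bounded) auto
    have "norm (\<alpha> z * M (x + z)) \<le> norm (\<bar>\<alpha> z\<bar> * (M (x + z) + M x))" for z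
      using M0 by (simp add: abs_mult mult_left_mono)
    then show "AE z in lborel. norm (\<alpha> z * M (x + z)) \<le> norm (\<bar>\<alpha> z\<bar> * (M (x + z) + M x))" by simp
  qed measurable
  moreover have "(LBINT z. \<bar>\<alpha> z\<bar> * (M (x + z) + M x)) \<le> 2 / r * M x" if x: "x \<in> G" for x
    using key[OF x] M0[of x] r by (intro integral_real_bounded) auto
  moreover have "f x powr (1 / p) \<le> M x" if "x \<in> G" for x
    using fq[OF that] f(2)[of x] that p by (auto simp: M_def intro!: powr_mono2)
  moreover have "integrable lborel (\<lambda>x. M x powr p)"
  proof (rule integrableI_bounded)
    have "(\<integral>\<^sup>+x. ennreal (norm (M x powr p)) \<partial>lborel) \<le> (\<integral>\<^sup>+x. Q x \<partial>lborel)"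
    proof (rule nn_integral_mono)
      fix x show "ennreal (norm (M x powr p)) \<le> Q x"
        using p q0[of x] Qq[of x] qpos[of x] by (cases "x \<in> G") (auto simp: M_def powr_powr)
    qed
    then show "(\<integral>\<^sup>+x. ennreal (norm (M x powr p)) \<partial>lborel) < \<infinity>" using QI by (rule order_le_less_trans)
  qed measurable
  \<comment> \<open>For bounded f the halving holds pointwise, so Q is at most \<open>2 * K\<close>
    everywhere and no exceptional set remains.\<close>
  moreover have "G = UNIV \<and> (\<forall>x. M x \<le> (2 * K) powr (1 / p))" if K: "\<And>x. f x \<le> K" for K
  proof -
    have K0: "K \<ge> 0" using K[of 0] f(2)[of 0] by linarith
    have PK: "P n x \<le> ennreal ((1/2)^n) * ennreal K" for n x
    proof (induction n arbitrary: x)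
      case (Suc n)
      have "P (Suc n) x \<le> (\<integral>\<^sup>+z. k z * (ennreal ((1/2)^n) * ennreal K + ennreal ((1/2)^n) * ennreal K) \<partial>lborel)"
        unfolding PSuc smear_def by (intro nn_integral_mono mult_left_mono add_mono Suc) auto
      also have "\<dots> = 2 * (\<integral>\<^sup>+z. k z \<partial>lborel) * (ennreal ((1/2)^n) * ennreal K)"
        by (simp only: mult_2[symmetric], subst nn_integral_multc) (measurable, simp only: mult_ac)
      also have "\<dots> \<le> ennreal (1/2) * (ennreal ((1/2)^n) * ennreal K)"
        by (intro mult_right_mono kint) auto
      also have "\<dots> = ennreal ((1/2)^Suc n) * ennreal K" by (rule half)
      finally show ?case .
    qed (simp add: P0 ennreal_leI K)
    have QK: "Q x \<le> ennreal (2 * K)" for x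
    proof -
      have "Q x \<le> (\<Sum>n. ennreal ((1/2)^n) * ennreal K)"
        unfolding Q_def by (intro suminf_le PK summableI)
      also have "\<dots> = 2 * ennreal K" by (simp only: ennreal_suminf_multc geo)
      finally show ?thesis using K0 by (simp add: ennreal_mult)
    qed
    have GU: "x \<in> G" for x using order_le_less_trans[OF QK[of x], of \<infinity>] by (simp add: G_def)
    have "q x \<le> 2 * K" for x using QK[of x] Qq[OF GU[of x]] K0 by simp
    then have "M x \<le> (2 * K) powr (1 / p)" for x
      using q0[of x] p GU[of x] by (auto simp: M_def intro!: powr_mono2)
    then show ?thesis using GU by auto
  qed
  moreover have "2 / r \<ge> 0" "x \<notin> G \<Longrightarrow> M x = 0" for x using r by (auto simp: M_def)
  ultimately show ?thesis
    using G GAE Mm M0 by (intro exI[of _ M] exI[of _ G] exI[of _ "2 / r"]) (auto simp: weight_def)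
qed

lemma weight_const:
  assumes alpha: "integrable lborel \<alpha>" and B: "B \<ge> 0"
  shows "weight \<alpha> UNIV (2 * (LBINT z. \<bar>\<alpha> z\<bar>)) (\<lambda>_. B)"
  using alpha B by (auto simp: weight_def intro!: integral_nonneg_AE)

section \<open>Lebesgue norms, domination and bounded representatives\<close>

lemma in_Lp_measurable: "in_Lp p f \<Longrightarrow> f \<in> borel_measurable borel"
  by (simp add: in_Lp_def)

lemma one_le_ereal_cases:
  assumes "1 \<le> (p::ereal)"
  obtains "p = \<infinity>" | r where "p = ereal r" "r \<ge> 1"
  using assms by (cases p) (auto simp: one_ereal_def)

lemma in_Linf_iff: "in_Lp \<infinity> f \<longleftrightarrow> f \<in> borel_measurable borel \<and> (\<exists>B. AE x in lborel. \<bar>f x\<bar> \<le> B)"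
proof (cases "f \<in> borel_measurable borel")
  case True
  then have m: "(\<lambda>x. ereal \<bar>f x\<bar>) \<in> borel_measurable lborel" by simp
  have "esssup lborel (\<lambda>x. ereal \<bar>f x\<bar>) < \<infinity> \<longleftrightarrow> (\<exists>B. AE x in lborel. \<bar>f x\<bar> \<le> B)"
  proof
    assume e: "esssup lborel (\<lambda>x. ereal \<bar>f x\<bar>) < \<infinity>"
    then obtain B where B: "esssup lborel (\<lambda>x. ereal \<bar>f x\<bar>) \<le> ereal B"
      by (cases "esssup lborel (\<lambda>x. ereal \<bar>f x\<bar>)") auto
    have "AE x in lborel. \<bar>f x\<bar> \<le> B"
      using esssup_AE[of "\<lambda>x. ereal \<bar>f x\<bar>" lborel]
    proof eventually_elim
      case (elim x)
      then have "ereal \<bar>f x\<bar> \<le> ereal B" using B by (rule order_trans)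
      then show ?case by simp
    qed
    then show "\<exists>B. AE x in lborel. \<bar>f x\<bar> \<le> B" by blast
  next
    assume "\<exists>B. AE x in lborel. \<bar>f x\<bar> \<le> B"
    then obtain B where "AE x in lborel. \<bar>f x\<bar> \<le> B" by blast
    then have "esssup lborel (\<lambda>x. ereal \<bar>f x\<bar>) \<le> ereal B" by (intro esssup_I m) simp
    then show "esssup lborel (\<lambda>x. ereal \<bar>f x\<bar>) < \<infinity>" by (rule order_le_less_trans) simp
  qed
  then show ?thesis using True by (simp add: in_Lp_def)
qed (simp add: in_Lp_def)

lemma esssup_nonneg:
  fixes f :: "real \<Rightarrow> real"
  assumes "f \<in> borel_measurable borel" shows "0 \<le> esssup lborel (\<lambda>x. ereal \<bar>f x\<bar>)"
proof -
  have "esssup lborel (\<lambda>x::real. 0::ereal) \<le> esssup lborel (\<lambda>x. ereal \<bar>f x\<bar>)"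
    by (intro esssup_mono) auto
  moreover have "esssup lborel (\<lambda>x::real. 0::ereal) = 0" by (rule esssup_const) simp
  ultimately show ?thesis by simp
qed

lemma Lp_norm_nonneg: "f \<in> borel_measurable borel \<Longrightarrow> 0 \<le> Lp_norm p f"
  using esssup_nonneg[of f] by (auto simp: Lp_norm_def real_of_ereal_pos)

text \<open>Monotonicity of the norms, by which a pointwise bound \<open>c * M\<close> becomes
  membership and a norm bound with the same factor c.\<close>

lemma in_Lp_dominated:
  assumes p: "1 \<le> p" and M: "in_Lp p M" and f: "f \<in> borel_measurable borel"
    and c: "c \<ge> 0" and le: "\<And>x. \<bar>f x\<bar> \<le> c * M x"
  shows "in_Lp p f" "Lp_norm p f \<le> c * Lp_norm p M"
proof -
  note Mm = in_Lp_measurable[OF M]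
  have leM: "\<bar>f x\<bar> \<le> c * \<bar>M x\<bar>" for x
    using le[of x] c mult_left_mono[OF abs_ge_self[of "M x"] c] by linarith
  have "in_Lp p f \<and> Lp_norm p f \<le> c * Lp_norm p M"
    using p
  proof (cases rule: one_le_ereal_cases)
    case 1
    define E where "E = esssup lborel (\<lambda>x. ereal \<bar>M x\<bar>)"
    have "E < \<infinity>" "0 \<le> E" using M esssup_nonneg[OF Mm] 1 by (auto simp: in_Lp_def E_def)
    then obtain e where e: "E = ereal e" "e \<ge> 0" by (cases E) auto
    have ae: "AE x in lborel. ereal \<bar>f x\<bar> \<le> ereal (c * e)"
      using esssup_AE[of "\<lambda>x. ereal \<bar>M x\<bar>" lborel]
    proof eventually_elim
      case (elim x)
      then have "\<bar>M x\<bar> \<le> e" using e by (simp add: E_def[symmetric])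
      then show ?case using leM[of x] mult_left_mono[OF _ c, of "\<bar>M x\<bar>" e] by simp
    qed
    have s: "esssup lborel (\<lambda>x. ereal \<bar>f x\<bar>) \<le> ereal (c * e)" using f ae by (intro esssup_I) auto
    have "real_of_ereal (esssup lborel (\<lambda>x. ereal \<bar>f x\<bar>)) \<le> c * e"
      using s esssup_nonneg[OF f] by (cases "esssup lborel (\<lambda>x. ereal \<bar>f x\<bar>)") auto
    then show ?thesis
      using f order_le_less_trans[OF s, of \<infinity>] 1 e by (simp add: in_Lp_def Lp_norm_def E_def[symmetric])
  next
    case (2 r)
    have Mi: "integrable lborel (\<lambda>x. \<bar>M x\<bar> powr r)" using M 2 by (simp add: in_Lp_def)
    have le': "\<bar>f x\<bar> powr r \<le> c powr r * \<bar>M x\<bar> powr r" for x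
      using powr_mono2[OF _ _ leM[of x], of r] 2 by (simp add: powr_mult)
    have fi: "integrable lborel (\<lambda>x. \<bar>f x\<bar> powr r)"
      by (rule integral_dominated_bound(1)[OF Mi]) (use f le' in auto)
    have "(LBINT x. \<bar>f x\<bar> powr r) \<le> c powr r * (LBINT x. \<bar>M x\<bar> powr r)"
      using integral_dominated_bound(2)[OF Mi, of "\<lambda>x. \<bar>f x\<bar> powr r" "c powr r"] f le' by auto
    then have "(LBINT x. \<bar>f x\<bar> powr r) powr (1 / r) \<le> (c powr r * (LBINT x. \<bar>M x\<bar> powr r)) powr (1 / r)"
      using 2 by (intro powr_mono2) (auto intro!: integral_nonneg_AE)
    also have "\<dots> = c * (LBINT x. \<bar>M x\<bar> powr r) powr (1 / r)"
      using c 2 by (simp add: powr_mult powr_powr)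
    finally show ?thesis using f fi 2 by (simp add: in_Lp_def Lp_norm_def)
  qed
  then show "in_Lp p f" "Lp_norm p f \<le> c * Lp_norm p M" by auto
qed

lemma Lp_AE_cong:
  assumes "f \<in> borel_measurable borel" "g \<in> borel_measurable borel" "AE x in lborel. f x = g x"
  shows "in_Lp p f \<longleftrightarrow> in_Lp p g" "Lp_norm p f = Lp_norm p g"
proof -
  have e: "esssup lborel (\<lambda>x. ereal \<bar>f x\<bar>) = esssup lborel (\<lambda>x. ereal \<bar>g x\<bar>)"
    using assms by (intro esssup_AE_cong) auto
  have ae: "AE x in lborel. \<bar>f x\<bar> powr r = \<bar>g x\<bar> powr r" for r
    using assms(3) by eventually_elim simp
  have i: "integrable lborel (\<lambda>x. \<bar>f x\<bar> powr r) \<longleftrightarrow> integrable lborel (\<lambda>x. \<bar>g x\<bar> powr r)"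
    "(LBINT x. \<bar>f x\<bar> powr r) = (LBINT x. \<bar>g x\<bar> powr r)" for r
    by (rule integrable_cong_AE[OF _ _ ae] integral_cong_AE[OF _ _ ae]; use assms(1,2) in simp)+
  show "in_Lp p f \<longleftrightarrow> in_Lp p g" "Lp_norm p f = Lp_norm p g"
    using assms e i by (auto simp: in_Lp_def Lp_norm_def)
qed

lemma le_one_plus_powr: "0 \<le> t \<Longrightarrow> 1 \<le> r \<Longrightarrow> t \<le> 1 + t powr r" for t r :: real
  using powr_mono[of 1 r t] by (cases "t \<le> 1") (auto intro: add_increasing2)

text \<open>Almost everywhere \<bar>f\<bar> is at most a constant plus an integrable function: the
  essential bound if \<open>p = \<infinity>\<close>, and \<open>1 + \<bar>f x\<bar> powr r\<close>
  otherwise. This makes Hoelder's inequality unnecessary.\<close>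

lemma in_Lp_uniformly_locally_integrable:
  assumes p: "1 \<le> p" and f: "in_Lp p f"
  shows "set_integrable lborel {x..y} f" "\<exists>K. \<forall>x. (LBINT s:{x..x+1}. \<bar>f s\<bar>) \<le> K"
proof -
  note fm = in_Lp_measurable[OF f]
  have "(\<forall>x y. set_integrable lborel {x..y} f) \<and> (\<exists>K. \<forall>x. (LBINT s:{x..x+1}. \<bar>f s\<bar>) \<le> K)"
  proof (intro conjI allI)
    obtain B g where B: "B \<ge> 0" and g: "integrable lborel g" "\<And>x. g x \<ge> 0" and le: "AE x in lborel. \<bar>f x\<bar> \<le> B + g x"
      using p
    proof (cases rule: one_le_ereal_cases)
      case 1
      then obtain B where "AE x in lborel. \<bar>f x\<bar> \<le> B" using f in_Linf_iff by auto
      then have "AE x in lborel. \<bar>f x\<bar> \<le> \<bar>B\<bar> + 0" by eventually_elim simp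
      then show thesis by (intro that[of "\<bar>B\<bar>" "\<lambda>_. 0"]) auto
    next
      case (2 r)
      then have "integrable lborel (\<lambda>x. \<bar>f x\<bar> powr r)" using f by (simp add: in_Lp_def)
      then show thesis using 2 by (intro that[of 1 "\<lambda>x. \<bar>f x\<bar> powr r"]) (auto intro!: le_one_plus_powr)
    qed
    have gi: "set_integrable lborel {x..y} g" for x y :: real
      unfolding set_integrable_def by (rule integrable_mult_indicator[OF _ g(1)]) simp
    have c: "set_integrable lborel {x..y} (\<lambda>_. B)" for x y :: real
      by (intro borel_integrable_atLeastAtMost') auto
    have Bg: "set_integrable lborel {x..y} (\<lambda>s. B + g s)" for x y
      by (rule set_integral_add(1)[OF c gi])
    have ae: "AE s in lborel. norm (indicator {x..y} s *\<^sub>R f s) \<le> norm (indicator {x..y} s *\<^sub>R (B + g s))" for x y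
      using le by eventually_elim (use B g(2) in \<open>auto simp: indicator_def\<close>)
    show fi: "set_integrable lborel {x..y} f" for x y
      unfolding set_integrable_def
      by (rule Bochner_Integration.integrable_bound[OF Bg[of x y, unfolded set_integrable_def] _ ae])
        (use fm in simp)
    show "\<exists>K. \<forall>x. (LBINT s:{x..x+1}. \<bar>f s\<bar>) \<le> K"
    proof (intro exI allI)
      fix x
      have "(LBINT s:{x..x+1}. \<bar>f s\<bar>) \<le> (LBINT s:{x..x+1}. B + g s)"
        using set_integrable_abs[OF fi[of x "x+1"]] Bg[of x "x+1"] unfolding set_integrable_def set_lebesgue_integral_def
        by (rule integral_mono_AE) (use le in \<open>eventually_elim, auto simp: indicator_def\<close>)
      also have "\<dots> = B + (LBINT s:{x..x+1}. g s)"
        by (subst set_integral_add(2)[OF c gi]) (simp add: set_lebesgue_integral_def)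
      also have "(LBINT s:{x..x+1}. g s) \<le> (LBINT s. g s)"
        unfolding set_lebesgue_integral_def using g
        by (intro integral_mono integrable_mult_indicator) (auto simp: indicator_def)
      finally show "(LBINT s:{x..x+1}. \<bar>f s\<bar>) \<le> B + (LBINT s. g s)" by simp
    qed
  qed
  then show "set_integrable lborel {x..y} f" "\<exists>K. \<forall>x. (LBINT s:{x..x+1}. \<bar>f s\<bar>) \<le> K" by auto
qed

text \<open>The one-dimensional Sobolev embedding: \<open>\<bar>u x\<bar>\<close> is at most
  \<open>\<bar>u s\<bar>\<close> plus the integral of \<bar>v\<bar> over [x, x + 1]; averaging over
  s in that interval gives a bound uniform in x.\<close>

lemma AC_in_Lp_bounded:
  assumes p: "1 \<le> p" and uv: "AC u v" and u: "in_Lp p u" and v: "in_Lp p v"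
  shows "\<exists>B. \<forall>x. \<bar>u x\<bar> \<le> B"
proof -
  obtain K1 K2 where K: "\<And>x. (LBINT s:{x..x+1}. \<bar>u s\<bar>) \<le> K1" "\<And>x. (LBINT s:{x..x+1}. \<bar>v s\<bar>) \<le> K2"
    using in_Lp_uniformly_locally_integrable(2)[OF p u] in_Lp_uniformly_locally_integrable(2)[OF p v] by blast
  have "\<bar>u x\<bar> \<le> K1 + K2" for x
  proof -
    have ui: "set_integrable lborel {x..x+1} (\<lambda>s. \<bar>u s\<bar>)"
      by (rule set_integrable_abs[OF in_Lp_uniformly_locally_integrable(1)[OF p u]])
    have vi: "set_integrable lborel {x..y} (\<lambda>s. \<bar>v s\<bar>)" for y
      by (rule set_integrable_abs[OF in_Lp_uniformly_locally_integrable(1)[OF p v]])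
    have c: "set_integrable lborel {x..x+1} (\<lambda>s. c)" for c :: real
      by (intro borel_integrable_atLeastAtMost') auto
    have "\<bar>u x\<bar> = (LBINT s:{x..x+1}. \<bar>u x\<bar>)" by (simp add: set_lebesgue_integral_def)
    also have "\<dots> \<le> (LBINT s:{x..x+1}. \<bar>u s\<bar> + K2)"
    proof (rule set_integral_mono[OF c set_integral_add(1)[OF ui c]])
      fix s assume s: "s \<in> {x..x+1}"
      have "\<bar>u s - u x\<bar> \<le> (LBINT t:{x..s}. \<bar>v t\<bar>)" using AC_bound[OF uv] s by simp
      also have "\<dots> \<le> (LBINT t:{x..x+1}. \<bar>v t\<bar>)"
        using s by (intro set_integral_mono_set vi) auto
      also have "\<dots> \<le> K2" by (rule K(2))
      finally show "\<bar>u x\<bar> \<le> \<bar>u s\<bar> + K2" by linarith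
    qed
    also have "\<dots> = (LBINT s:{x..x+1}. \<bar>u s\<bar>) + K2"
      by (subst set_integral_add(2)[OF ui c]) (simp add: set_lebesgue_integral_def)
    finally show ?thesis using K(1)[of x] by linarith
  qed
  then show ?thesis by blast
qed

lemma in_Linf_bounded_representative:
  assumes "in_Lp \<infinity> f"
  obtains f' B where "f' \<in> borel_measurable borel" "\<And>x. \<bar>f' x\<bar> \<le> B" "AE x in lborel. f' x = f x"
proof -
  obtain B where B: "AE x in lborel. \<bar>f x\<bar> \<le> B" and [measurable]: "f \<in> borel_measurable borel"
    using assms in_Linf_iff by blast
  show thesis
  proof (rule that[of "\<lambda>x. if \<bar>f x\<bar> \<le> \<bar>B\<bar> then f x else 0" "\<bar>B\<bar>"])
    show "AE x in lborel. (if \<bar>f x\<bar> \<le> \<bar>B\<bar> then f x else 0) = f x"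
      using B by eventually_elim auto
  qed auto
qed

lemma weight_in_Lp_exists:
  assumes alpha: "integrable lborel \<alpha>" and p: "1 \<le> p" and fg: "in_Lp p f" "in_Lp p g"
    and inf: "p = \<infinity> \<Longrightarrow> \<exists>B. \<forall>x. \<bar>f x\<bar> \<le> B \<and> \<bar>g x\<bar> \<le> B"
  obtains M G lam where "weight \<alpha> G lam M" "in_Lp p M" "\<And>x. x \<in> G \<Longrightarrow> \<bar>f x\<bar> \<le> M x \<and> \<bar>g x\<bar> \<le> M x"
    "(\<exists>B. \<forall>x. \<bar>f x\<bar> \<le> B \<and> \<bar>g x\<bar> \<le> B) \<Longrightarrow> G = UNIV \<and> (\<exists>R. \<forall>x. M x \<le> R)"
  using p
proof (cases rule: one_le_ereal_cases)
  case 1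
  obtain B where B: "\<And>x. \<bar>f x\<bar> \<le> B \<and> \<bar>g x\<bar> \<le> B" using inf[OF 1] by blast
  have B0: "B \<ge> 0" using B[of 0] by linarith
  have "in_Lp p (\<lambda>_. B)" using 1 by (auto simp: in_Linf_iff)
  then show thesis using B by (intro that[OF weight_const[OF alpha B0]]) auto
next
  case (2 r)
  \<comment> \<open>The Gaussian makes F strictly positive, as the division in the construction of
    the weight requires, while F stays integrable and stays bounded whenever f and g are.\<close>
  define F where "F x = \<bar>f x\<bar> powr r + \<bar>g x\<bar> powr r + std_normal_density x" for x
  have Fi: "integrable lborel F" using fg 2 unfolding F_def by (auto simp: in_Lp_def)
  have Fpos: "F x > 0" for x
    unfolding F_def by (intro add_nonneg_pos) (auto simp: normal_density_pos)
  obtain M G lam where M: "weight \<alpha> G lam M"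
    and FM: "\<forall>x\<in>G. F x powr (1 / r) \<le> M x"
    and Mi: "integrable lborel (\<lambda>x. M x powr r)"
    and K: "\<forall>K. (\<forall>x. F x \<le> K) \<longrightarrow> G = UNIV \<and> (\<forall>x. M x \<le> (2 * K) powr (1 / r))"
    using weight_powr_exists[OF alpha Fi Fpos 2(2)] by (elim exE conjE)
  have "\<bar>M x\<bar> = M x" for x using M by (simp add: weight_def)
  then have "in_Lp p M" using M Mi 2 by (simp add: in_Lp_def weight_def)
  moreover have "t \<le> M x" if "x \<in> G" "t \<ge> 0" "t powr r \<le> F x" for t x
  proof -
    have "t = (t powr r) powr (1 / r)" using that 2 by (simp add: powr_powr)
    also have "\<dots> \<le> F x powr (1 / r)" using that 2 by (intro powr_mono2) auto
    finally show ?thesis using FM that(1) by (meson order_trans)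
  qed
  then have "\<bar>f x\<bar> \<le> M x \<and> \<bar>g x\<bar> \<le> M x" if "x \<in> G" for x using that by (simp add: F_def)
  moreover have "G = UNIV \<and> (\<exists>R. \<forall>x. M x \<le> R)" if bd: "\<exists>B. \<forall>x. \<bar>f x\<bar> \<le> B \<and> \<bar>g x\<bar> \<le> B"
  proof -
    obtain B where B: "\<And>x. \<bar>f x\<bar> \<le> B \<and> \<bar>g x\<bar> \<le> B" using bd by blast
    have "std_normal_density x \<le> 1" for x :: real
    proof -
      have "1 \<le> sqrt (2 * pi)" using pi_ge_two by (intro real_le_rsqrt) auto
      then show ?thesis
        unfolding std_normal_density_def using mult_mono[of "1 / sqrt (2 * pi)" 1 "exp (- x\<^sup>2 / 2)" 1] by auto
    qed
    then have "F x \<le> B powr r + B powr r + 1" for x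
      unfolding F_def using B[of x] 2 by (intro add_mono powr_mono2) auto
    with K show ?thesis by blast
  qed
  ultimately show thesis using M by (intro that) auto
qed

section \<open>Global solutions in the four spaces\<close>

text \<open>The conditions of \<open>Cl\<close> as a relation between the two components, so that
  each space can be treated outside the locale.\<close>

definition admissible :: "bool \<Rightarrow> bool \<Rightarrow> bool \<Rightarrow> (real \<Rightarrow> real) \<Rightarrow> (real \<Rightarrow> real) \<Rightarrow> bool" where
  "admissible cu cv ac u v \<longleftrightarrow> u \<in> borel_measurable borel \<and> v \<in> borel_measurable borel
      \<and> (cu \<longrightarrow> continuous_on UNIV u) \<and> (cv \<longrightarrow> continuous_on UNIV v) \<and> (ac \<longrightarrow> AC u v)"

lemma weight_mono: "weight \<alpha> G lam M \<Longrightarrow> lam \<le> lam' \<Longrightarrow> weight \<alpha> G lam' M"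
proof -
  assume M: "weight \<alpha> G lam M" and le: "lam \<le> lam'"
  have "lam * M x \<le> lam' * M x" for x using M le by (intro mult_right_mono) (auto simp: weight_def)
  then show ?thesis using M le unfolding weight_def by (meson order_trans)
qed

lemma global_solution_exists:
  fixes \<alpha> w h Mu Mv :: "real \<Rightarrow> real"
  assumes alpha: "integrable lborel \<alpha>"
    and w: "loc_lipschitz w" "w 0 = 0" and h: "loc_lipschitz h"
    and growth: "\<And>\<eta>. \<bar>w \<eta>\<bar> \<le> a * \<bar>\<eta>\<bar> + b"
    and Mu: "weight \<alpha> UNIV l1 Mu" "\<And>x. Mu x \<le> R"
    and Mv: "weight \<alpha> G l2 Mv" "\<And>x y. set_integrable lborel {x..y} Mv"
    and cv: "cv \<Longrightarrow> cu \<and> G = UNIV \<and> (\<exists>K. \<forall>x. Mv x \<le> K)"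
    and ac: "\<And>x. ac \<Longrightarrow> (w has_real_derivative h x) (at x)"
    and phi: "admissible cu cv ac u0 v0" "\<And>x. \<bar>u0 x\<bar> \<le> Mu x" "\<And>x. \<bar>v0 x\<bar> \<le> Mv x"
    and psi: "admissible cu cv ac u1 v1" "\<And>x. \<bar>u1 x\<bar> \<le> Mu x" "\<And>x. \<bar>v1 x\<bar> \<le> Mv x"
    and X: "\<And>u v c. admissible cu cv ac u v \<Longrightarrow> c \<ge> 0 \<Longrightarrow> (\<And>x. \<bar>u x\<bar> \<le> c * Mu x) \<Longrightarrow> (\<And>x. \<bar>v x\<bar> \<le> c * Mv x)
         \<Longrightarrow> u \<in> fcarrier X \<and> \<bar>fnorm X u\<bar> \<le> c * K"
    and refl: "\<And>f. feq X f f" and init: "feq X u0 \<phi>" "feq X u1 \<psi>" and T: "T > 0"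
  shows "\<exists>u u1 u2. C2_curve X T u u1 u2 \<and> (\<forall>t\<in>{0..T}. feq X (u2 t) (peri_op \<alpha> w (u t)))
            \<and> feq X (u 0) \<phi> \<and> feq X (u1 0) \<psi>"
proof -
  have wu: "weight \<alpha> UNIV (max l1 l2) Mu" and wv: "weight \<alpha> G (max l1 l2) Mv"
    using weight_mono[OF Mu(1)] weight_mono[OF Mv(1)] by auto
  have gr: "\<bar>w \<eta>\<bar> \<le> \<bar>a\<bar> * \<bar>\<eta>\<bar> + \<bar>b\<bar>" for \<eta>
  proof -
    have "a * \<bar>\<eta>\<bar> \<le> \<bar>a\<bar> * \<bar>\<eta>\<bar>" by (intro mult_right_mono) auto
    then show ?thesis using growth[of \<eta>] by linarith
  qed
  \<comment> \<open>The locale wants nonnegative growth constants, a sup bound of at least 1 and one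
    weight constant for both components.\<close>
  interpret peridynamic \<alpha> w h Mu Mv G "\<bar>a\<bar>" "\<bar>b\<bar>" "max R 1" "max l1 l2" cu cv ac
  proof
    show "\<bar>w \<eta>\<bar> \<le> \<bar>a\<bar> * \<bar>\<eta>\<bar> + \<bar>b\<bar>" for \<eta> by (rule gr)
    show "Mu x \<le> max R 1" for x using Mu(2)[of x] by simp
    show "cv \<Longrightarrow> cu \<and> G = UNIV \<and> (\<exists>K. \<forall>x. Mv x \<le> K)" by (rule cv)
    show "(w has_real_derivative h x) (at x)" if ac for x by (rule ac[OF that])
  qed (use alpha w h Mv(2) wu wv in \<open>auto simp: weight_def\<close>)
  have o: "case_sum f g \<circ> Inl = f" "case_sum f g \<circ> Inr = g" for f g :: "real \<Rightarrow> real" by auto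
  have ClI: "U \<in> Cl \<longleftrightarrow> admissible cu cv ac (U \<circ> Inl) (U \<circ> Inr)" for U
    unfolding Cl_def admissible_def by blast
  show ?thesis
  proof (rule C2_curve_exists[OF T, where \<phi> = "case_sum u0 v0" and \<psi> = "case_sum u1 v1"])
    show "case_sum u0 v0 \<in> Cl" "case_sum u1 v1 \<in> Cl" unfolding ClI o by (fact phi psi)+
    show "\<bar>case_sum u0 v0 p\<bar> \<le> W p" for p using phi by (cases p) (auto simp: W_def)
    show "\<bar>case_sum u1 v1 p\<bar> \<le> W p" for p using psi by (cases p) (auto simp: W_def)
    show "U \<circ> Inl \<in> fcarrier X \<and> \<bar>fnorm X (U \<circ> Inl)\<bar> \<le> c * K"
      if U: "U \<in> Cl" and c: "c \<ge> 0" and le: "\<And>p. \<bar>U p\<bar> \<le> c * W p" for U c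
    proof (rule X[OF _ c])
      show "admissible cu cv ac (U \<circ> Inl) (U \<circ> Inr)" using U ClI by blast
      show "\<bar>(U \<circ> Inl) x\<bar> \<le> c * Mu x" for x using le[of "Inl x"] by (simp add: W_def)
      show "\<bar>(U \<circ> Inr) x\<bar> \<le> c * Mv x" for x using le[of "Inr x"] by (simp add: W_def)
    qed
    show "feq X f f" for f by (rule refl)
    show "feq X (case_sum u0 v0 \<circ> Inl) \<phi>" "feq X (case_sum u1 v1 \<circ> Inl) \<psi>" unfolding o by (fact init)+
  qed
qed

lemma bounded_range_obtain:
  assumes "bounded (range f)" "bounded (range g)"
  obtains B :: real where "B \<ge> 0" "\<And>x. \<bar>f x\<bar> \<le> B" "\<And>x. \<bar>g x\<bar> \<le> B"
proof -
  obtain B1 B2 where "\<And>x. \<bar>f x\<bar> \<le> B1" "\<And>x. \<bar>g x\<bar> \<le> B2"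
    using assms unfolding bounded_real by auto
  then show thesis by (intro that[of "\<bar>B1\<bar> + \<bar>B2\<bar>"]) (fastforce intro: order_trans)+
qed

lemma SUP_abs_le:
  fixes f :: "real \<Rightarrow> real"
  assumes "\<And>x. \<bar>f x\<bar> \<le> C" shows "\<bar>SUP x. \<bar>f x\<bar>\<bar> \<le> C"
proof -
  have "bdd_above (range (\<lambda>x. \<bar>f x\<bar>))" using assms by (intro bdd_aboveI[of _ C]) auto
  then have "\<bar>f 0\<bar> \<le> (SUP x. \<bar>f x\<bar>)" by (intro cSUP_upper) auto
  moreover have "(SUP x. \<bar>f x\<bar>) \<le> C" using assms by (intro cSUP_least) auto
  ultimately show ?thesis by linarith
qed

lemma set_integrable_const: "set_integrable lborel {x..y} (\<lambda>_::real. c::real)"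
  by (intro borel_integrable_atLeastAtMost') auto

lemma C1_fun_loc_lipschitz: "C1_fun w \<Longrightarrow> loc_lipschitz w"
  unfolding C1_fun_def using loc_lipschitz_C1 by blast

lemma C2_fun_loc_lipschitz:
  assumes "C2_fun w"
  obtains h where "loc_lipschitz w" "loc_lipschitz h" "\<And>x. (w has_real_derivative h x) (at x)"
proof -
  obtain h h' where h: "\<And>x. (w has_real_derivative h x) (at x)" "\<And>x. (h has_real_derivative h' x) (at x)"
    "continuous_on UNIV h'" using assms unfolding C2_fun_def by blast
  have "continuous_on UNIV h" using h(2) by (meson DERIV_continuous_on has_field_derivative_at_within)
  then show thesis by (intro that[of h] loc_lipschitz_C1[OF h(1)] loc_lipschitz_C1[OF h(2,3)] h(1))
qed

lemma loc_lipschitz_zero: "loc_lipschitz (\<lambda>_. 0)"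
  unfolding loc_lipschitz_def by (intro allI exI[of _ 0]) simp

context
  fixes \<alpha> w \<phi> \<psi> :: "real \<Rightarrow> real" and a b T :: real
  assumes alpha: "integrable lborel \<alpha>" and w0: "w 0 = 0"
    and growth: "\<And>\<eta>. \<bar>w \<eta>\<bar> \<le> a * \<bar>\<eta>\<bar> + b" and T: "T > 0"
begin

definition solvable :: "fspace \<Rightarrow> bool" where
  "solvable X \<longleftrightarrow> (\<exists>u u1 u2. C2_curve X T u u1 u2 \<and> (\<forall>t\<in>{0..T}. feq X (u2 t) (peri_op \<alpha> w (u t)))
            \<and> feq X (u 0) \<phi> \<and> feq X (u1 0) \<psi>)"

text \<open>Here the weight is a constant and the derivative component is switched off:
  \<open>h\<close>, the second component of the data and its weight are all 0.\<close>

lemma solvable_Cb: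
  assumes w: "C1_fun w" and init: "\<phi> \<in> fcarrier Cb_space" "\<psi> \<in> fcarrier Cb_space"
  shows "solvable Cb_space"
proof -
  have c: "continuous_on UNIV \<phi>" "continuous_on UNIV \<psi>" "bounded (range \<phi>)" "bounded (range \<psi>)"
    using init by (auto simp: Cb_space_def)
  obtain B where B: "B \<ge> 0" "\<And>x. \<bar>\<phi> x\<bar> \<le> B" "\<And>x. \<bar>\<psi> x\<bar> \<le> B" using bounded_range_obtain[OF c(3,4)] by blast
  show ?thesis
    unfolding solvable_def
  proof (rule global_solution_exists[OF alpha C1_fun_loc_lipschitz[OF w] w0 loc_lipschitz_zero growth
        weight_const[OF alpha B(1)] order_refl weight_const[OF alpha order_refl], where cu = True and cv = False and ac = False])
    show "admissible True False False \<phi> (\<lambda>_. 0)" "admissible True False False \<psi> (\<lambda>_. 0)"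
      using c by (auto simp: admissible_def intro: borel_measurable_continuous_onI)
    show "u \<in> fcarrier Cb_space \<and> \<bar>fnorm Cb_space u\<bar> \<le> c * B"
      if "admissible True False False u v" "\<And>x. \<bar>u x\<bar> \<le> c * B" for u v c
      using that SUP_abs_le[of u "c * B"] by (auto simp: Cb_space_def admissible_def bounded_real)
  qed (use B T in \<open>auto simp: Cb_space_def set_integrable_const\<close>)
qed

text \<open>A continuous density of an absolutely continuous function is its classical derivative,
  so the second component of the pair is \<open>deriv u\<close> and its constant weight bounds the
  second term of the norm.\<close>

lemma solvable_C1b:
  assumes w: "C2_fun w" and init: "\<phi> \<in> fcarrier C1b_space" "\<psi> \<in> fcarrier C1b_space"
  shows "solvable C1b_space"
proof -
  obtain h where h: "loc_lipschitz w" "loc_lipschitz h" "\<And>x. (w has_real_derivative h x) (at x)"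
    using C2_fun_loc_lipschitz[OF w] by blast
  have d: "f differentiable (at x)" "continuous_on UNIV (deriv f)" "bounded (range f)" "bounded (range (deriv f))"
    if "f \<in> fcarrier C1b_space" for f x
    using that by (auto simp: C1b_space_def)
  have ac: "AC f (deriv f)" if "f \<in> fcarrier C1b_space" for f
    using d[OF that] by (intro AC_C1) (auto simp: DERIV_deriv_iff_real_differentiable)
  have adm: "admissible True True True f (deriv f)" if "f \<in> fcarrier C1b_space" for f
    using d(2)[OF that] ac[OF that] AC_continuous[OF ac[OF that]]
    by (auto simp: admissible_def intro: borel_measurable_continuous_onI)
  obtain B where B: "B \<ge> 0" "\<And>x. \<bar>\<phi> x\<bar> \<le> B" "\<And>x. \<bar>\<psi> x\<bar> \<le> B"
    using bounded_range_obtain[OF d(3)[OF init(1)] d(3)[OF init(2)]] by blast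
  obtain B' where B': "B' \<ge> 0" "\<And>x. \<bar>deriv \<phi> x\<bar> \<le> B'" "\<And>x. \<bar>deriv \<psi> x\<bar> \<le> B'"
    using bounded_range_obtain[OF d(4)[OF init(1)] d(4)[OF init(2)]] by blast
  show ?thesis
    unfolding solvable_def
  proof (rule global_solution_exists[OF alpha h(1) w0 h(2) growth weight_const[OF alpha B(1)] order_refl
        weight_const[OF alpha B'(1)] set_integrable_const _ h(3) adm[OF init(1)] _ _ adm[OF init(2)]])
    show "u \<in> fcarrier C1b_space \<and> \<bar>fnorm C1b_space u\<bar> \<le> c * (B + B')"
      if u: "admissible True True True u v" "\<And>x. \<bar>u x\<bar> \<le> c * B" "\<And>x. \<bar>v x\<bar> \<le> c * B'" for u v c
    proof -
      have D: "(u has_real_derivative v x) (at x)" for x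
        using u(1) by (intro AC_has_derivative) (auto simp: admissible_def)
      then have dv: "deriv u = v" using DERIV_imp_deriv by blast
      have "\<bar>(SUP x. \<bar>u x\<bar>) + (SUP x. \<bar>v x\<bar>)\<bar> \<le> c * (B + B')"
        using SUP_abs_le[of u, OF u(2)] SUP_abs_le[of v, OF u(3)] unfolding distrib_left by linarith
      then show ?thesis
        using u has_real_derivative_imp_differentiable[OF D]
        by (auto simp: C1b_space_def admissible_def bounded_real dv)
    qed
  qed (use B B' T in \<open>auto simp: C1b_space_def\<close>)
qed

text \<open>The data are replaced by representatives bounded at every point. The weight is then
  bounded as well as in L^p, and controls both terms of the norm.\<close>

lemma solvable_LpLinf:
  assumes w: "C1_fun w" and p: "1 \<le> p"
    and init: "\<phi> \<in> fcarrier (LpLinf_space p)" "\<psi> \<in> fcarrier (LpLinf_space p)"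
  shows "solvable (LpLinf_space p)"
proof -
  have L: "in_Lp p \<phi>" "in_Lp p \<psi>" "in_Lp \<infinity> \<phi>" "in_Lp \<infinity> \<psi>" using init by (auto simp: LpLinf_space_def)
  obtain f B1 where f: "f \<in> borel_measurable borel" "\<And>x. \<bar>f x\<bar> \<le> B1" "AE x in lborel. f x = \<phi> x"
    using in_Linf_bounded_representative[OF L(3)] by blast
  obtain g B2 where g: "g \<in> borel_measurable borel" "\<And>x. \<bar>g x\<bar> \<le> B2" "AE x in lborel. g x = \<psi> x"
    using in_Linf_bounded_representative[OF L(4)] by blast
  have fg: "in_Lp p f" "in_Lp p g"
    using Lp_AE_cong(1)[OF f(1) in_Lp_measurable[OF L(1)] f(3)] Lp_AE_cong(1)[OF g(1) in_Lp_measurable[OF L(2)] g(3)] L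
    by auto
  have bd: "\<exists>B. \<forall>x. \<bar>f x\<bar> \<le> B \<and> \<bar>g x\<bar> \<le> B"
    using f(2) g(2) by (intro exI[of _ "max B1 B2"]) (auto simp: le_max_iff_disj)
  obtain M G lam where M: "weight \<alpha> G lam M" "in_Lp p M" "\<And>x. x \<in> G \<Longrightarrow> \<bar>f x\<bar> \<le> M x \<and> \<bar>g x\<bar> \<le> M x"
    and GR: "G = UNIV \<and> (\<exists>R. \<forall>x. M x \<le> R)"
    using weight_in_Lp_exists[OF alpha p fg bd] bd by metis
  then obtain R where R: "\<And>x. M x \<le> R" by blast
  have G: "G = UNIV" using GR by blast
  have M0: "M \<in> borel_measurable borel" "\<And>x. M x \<ge> 0" using M(1) by (auto simp: weight_def)
  have Minf: "in_Lp \<infinity> M"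
    unfolding in_Linf_iff using M0 R by (auto intro!: exI[of _ R])
  show ?thesis
    unfolding solvable_def
  proof (rule global_solution_exists[OF alpha C1_fun_loc_lipschitz[OF w] w0 loc_lipschitz_zero growth
        M(1)[unfolded G] R weight_const[OF alpha order_refl] set_integrable_const,
        where cu = False and cv = False and ac = False])
    show "admissible False False False f (\<lambda>_. 0)" "admissible False False False g (\<lambda>_. 0)"
      using f g by (auto simp: admissible_def)
    show "u \<in> fcarrier (LpLinf_space p) \<and> \<bar>fnorm (LpLinf_space p) u\<bar> \<le> c * (Lp_norm p M + Lp_norm \<infinity> M)"
      if u: "admissible False False False u v" "c \<ge> 0" "\<And>x. \<bar>u x\<bar> \<le> c * M x" for u v c
    proof -
      have um: "u \<in> borel_measurable borel" using u(1) by (simp add: admissible_def)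
      show ?thesis
        using in_Lp_dominated[OF p M(2) um u(2,3)] in_Lp_dominated[OF _ Minf um u(2,3)]
          Lp_norm_nonneg[OF um, of p] Lp_norm_nonneg[OF um, of \<infinity>]
        by (auto simp: LpLinf_space_def distrib_left)
    qed
    show "\<bar>f x\<bar> \<le> M x" "\<bar>g x\<bar> \<le> M x" for x using M(3) G by auto
  qed (use T f g in \<open>auto simp: LpLinf_space_def\<close>)
qed

text \<open>For \<open>p = \<infinity>\<close> the derivative is changed on a null set as well,
  since a constant weight must bound it at every point.\<close>

lemma W1p_representative:
  assumes p: "1 \<le> p" and f: "f \<in> fcarrier (W1p_space p)"
  shows "\<exists>u v B. AC u v \<and> (AE x in lborel. u x = f x) \<and> in_Lp p u \<and> in_Lp p v \<and> (\<forall>x. \<bar>u x\<bar> \<le> B)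
    \<and> (p = \<infinity> \<longrightarrow> (\<exists>B. \<forall>x. \<bar>v x\<bar> \<le> B))"
proof -
  obtain g where fg: "in_Lp p f" "in_Lp p g" "weak_deriv f g" using f by (auto simp: W1p_space_def)
  obtain u where u: "AC u g" "AE x in lborel. u x = f x"
    using weak_deriv_imp_AC[OF fg(3) in_Lp_uniformly_locally_integrable(1)[OF p fg(1)]
        in_Lp_uniformly_locally_integrable(1)[OF p fg(2)]] by blast
  have um: "u \<in> borel_measurable borel" using AC_continuous[OF u(1)] by (rule borel_measurable_continuous_onI)
  have uL: "in_Lp p u" using Lp_AE_cong(1)[OF um in_Lp_measurable[OF fg(1)] u(2)] fg(1) by blast
  obtain B where B: "\<And>x. \<bar>u x\<bar> \<le> B" using AC_in_Lp_bounded[OF p u(1) uL fg(2)] by blast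
  show ?thesis
  proof (cases "p = \<infinity>")
    case True
    obtain v B' where v: "v \<in> borel_measurable borel" "\<And>x. \<bar>v x\<bar> \<le> B'" "AE x in lborel. v x = g x"
      using in_Linf_bounded_representative fg(2) True by metis
    have "AE x in lborel. g x = v x" using v(3) by eventually_elim simp
    then have "AC u v" by (rule AC_cong_AE[OF u(1) _ v(1)])
    moreover have "in_Lp p v" using Lp_AE_cong(1)[OF v(1) in_Lp_measurable[OF fg(2)] v(3)] fg(2) by blast
    ultimately show ?thesis using v(2) u(2) uL B by blast
  next
    case False
    then show ?thesis using u uL fg(2) B by blast
  qed
qed

lemma solvable_W1p:
  assumes w: "C2_fun w" and p: "1 \<le> p"
    and init: "\<phi> \<in> fcarrier (W1p_space p)" "\<psi> \<in> fcarrier (W1p_space p)"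
  shows "solvable (W1p_space p)"
proof -
  obtain h where h: "loc_lipschitz w" "loc_lipschitz h" "\<And>x. (w has_real_derivative h x) (at x)"
    using C2_fun_loc_lipschitz[OF w] by blast
  obtain u0 v0 B0 where 0: "AC u0 v0" "AE x in lborel. u0 x = \<phi> x" "in_Lp p u0" "in_Lp p v0" "\<And>x. \<bar>u0 x\<bar> \<le> B0"
    "p = \<infinity> \<Longrightarrow> \<exists>B. \<forall>x. \<bar>v0 x\<bar> \<le> B" using W1p_representative[OF p init(1)] by blast
  obtain u1 v1 B1 where 1: "AC u1 v1" "AE x in lborel. u1 x = \<psi> x" "in_Lp p u1" "in_Lp p v1" "\<And>x. \<bar>u1 x\<bar> \<le> B1"
    "p = \<infinity> \<Longrightarrow> \<exists>B. \<forall>x. \<bar>v1 x\<bar> \<le> B" using W1p_representative[OF p init(2)] by blast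
  have bd: "\<exists>B. \<forall>x. \<bar>u0 x\<bar> \<le> B \<and> \<bar>u1 x\<bar> \<le> B"
    using 0(5) 1(5) by (intro exI[of _ "max B0 B1"]) (auto simp: le_max_iff_disj)
  have bdv: "\<exists>B. \<forall>x. \<bar>v0 x\<bar> \<le> B \<and> \<bar>v1 x\<bar> \<le> B" if i: "p = \<infinity>"
  proof -
    obtain C0 C1 where "\<And>x. \<bar>v0 x\<bar> \<le> C0" "\<And>x. \<bar>v1 x\<bar> \<le> C1" using 0(6)[OF i] 1(6)[OF i] by blast
    then show ?thesis by (intro exI[of _ "max C0 C1"]) (auto simp: le_max_iff_disj)
  qed
  obtain Mu G' l1 where Mu: "weight \<alpha> G' l1 Mu" "in_Lp p Mu" "\<And>x. x \<in> G' \<Longrightarrow> \<bar>u0 x\<bar> \<le> Mu x \<and> \<bar>u1 x\<bar> \<le> Mu x"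
    and GR: "G' = UNIV \<and> (\<exists>R. \<forall>x. Mu x \<le> R)"
    using weight_in_Lp_exists[OF alpha p 0(3) 1(3) bd] bd by metis
  then obtain R where R: "\<And>x. Mu x \<le> R" by blast
  have G': "G' = UNIV" using GR by blast
  obtain Mv G l2 where Mv: "weight \<alpha> G l2 Mv" "in_Lp p Mv" "\<And>x. x \<in> G \<Longrightarrow> \<bar>v0 x\<bar> \<le> Mv x \<and> \<bar>v1 x\<bar> \<le> Mv x"
    using weight_in_Lp_exists[OF alpha p 0(4) 1(4) bdv] by metis
  have G: "G \<in> sets borel" "AE x in lborel. x \<in> G" and Mv0: "\<And>x. Mv x \<ge> 0"
    using Mv(1) by (auto simp: weight_def)
  \<comment> \<open>The derivative of the data is set to 0 outside \<open>G\<close>, where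
    \<open>Mv\<close> is 0; the relation \<open>AC\<close> does not notice a null set.\<close>
  have adm: "admissible True False True u (\<lambda>x. indicator G x * v x)" if u: "AC u v" and v: "in_Lp p v" for u v
  proof -
    have [measurable]: "v \<in> borel_measurable borel" by (rule in_Lp_measurable[OF v])
    have m: "(\<lambda>x. indicator G x * v x) \<in> borel_measurable borel" using G(1) by measurable
    have "AE x in lborel. v x = indicator G x * v x" using G(2) by eventually_elim simp
    then have "AC u (\<lambda>x. indicator G x * v x)" by (rule AC_cong_AE[OF u _ m])
    then show ?thesis
      using AC_continuous[OF u] m by (auto simp: admissible_def intro: borel_measurable_continuous_onI)
  qed
  have le: "\<bar>indicator G x * v0 x\<bar> \<le> Mv x" "\<bar>indicator G x * v1 x\<bar> \<le> Mv x" for x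
    using Mv(3)[of x] Mv0[of x] by (auto simp: indicator_def)
  show ?thesis
    unfolding solvable_def
  proof (rule global_solution_exists[OF alpha h(1) w0 h(2) growth Mu(1)[unfolded G'] R Mv(1)
        in_Lp_uniformly_locally_integrable(1)[OF p Mv(2)] _ h(3) adm[OF 0(1,4)] _ le(1) adm[OF 1(1,4)] _ le(2)])
    show "u \<in> fcarrier (W1p_space p) \<and> \<bar>fnorm (W1p_space p) u\<bar> \<le> c * (Lp_norm p Mu + Lp_norm p Mv)"
      if u: "admissible True False True u v" and c: "c \<ge> 0"
        and leu: "\<And>x. \<bar>u x\<bar> \<le> c * Mu x" and lev: "\<And>x. \<bar>v x\<bar> \<le> c * Mv x" for u v c
    proof -
      have m: "u \<in> borel_measurable borel" "v \<in> borel_measurable borel" and AC: "AC u v"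
        using u by (auto simp: admissible_def)
      note uL = in_Lp_dominated[OF p Mu(2) m(1) c leu] and vL = in_Lp_dominated[OF p Mv(2) m(2) c lev]
      have ex: "\<exists>g. in_Lp p g \<and> weak_deriv u g" using vL(1) AC_weak_deriv[OF AC] by blast
      \<comment> \<open>The derivative that the norm selects. It agrees almost everywhere with the
        component v, which \<open>Mv\<close> dominates.\<close>
      define g where "g = (SOME g. in_Lp p g \<and> weak_deriv u g)"
      have g: "in_Lp p g" "weak_deriv u g" using someI_ex[OF ex] unfolding g_def by auto
      have "AE x in lborel. g x = v x"
        by (rule weak_deriv_unique[OF g(2) AC_weak_deriv[OF AC]
              in_Lp_uniformly_locally_integrable(1)[OF p g(1)] AC_integrable[OF AC]])
      then have "Lp_norm p g = Lp_norm p v" by (rule Lp_AE_cong(2)[OF in_Lp_measurable[OF g(1)] m(2)])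
      then have "fnorm (W1p_space p) u = Lp_norm p u + Lp_norm p v"
        by (simp add: W1p_space_def g_def)
      moreover have "u \<in> fcarrier (W1p_space p)" using uL(1) ex by (simp add: W1p_space_def)
      ultimately show ?thesis
        using uL(2) vL(2) Lp_norm_nonneg[OF m(1), of p] Lp_norm_nonneg[OF m(2), of p]
        by (simp add: distrib_left)
    qed
    show "\<bar>u0 x\<bar> \<le> Mu x" "\<bar>u1 x\<bar> \<le> Mu x" for x using Mu(3) G' by auto
  qed (use T 0(2) 1(2) in \<open>auto simp: W1p_space_def\<close>)
qed

end

theorem theorem4p2:
  fixes \<alpha> w \<phi> \<psi> :: "real \<Rightarrow> real" and X :: fspace and a b :: real
  assumes alpha: "integrable lborel \<alpha>"
    and w0: "w 0 = 0"
    and cases: "(C1_fun w \<and> X = Cb_space)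
             \<or> (C1_fun w \<and> (\<exists>p. 1 \<le> p \<and> X = LpLinf_space p))
             \<or> (C2_fun w \<and> X = C1b_space)
             \<or> (C2_fun w \<and> (\<exists>p. 1 \<le> p \<and> X = W1p_space p))"
    and init: "\<phi> \<in> fcarrier X" "\<psi> \<in> fcarrier X"
    and growth: "\<forall>\<eta>. \<bar>w \<eta>\<bar> \<le> a * \<bar>\<eta>\<bar> + b"
  shows "\<forall>T>0. \<exists>u u1 u2. C2_curve X T u u1 u2
            \<and> (\<forall>t\<in>{0..T}. feq X (u2 t) (peri_op \<alpha> w (u t)))
            \<and> feq X (u 0) \<phi> \<and> feq X (u1 0) \<psi>"
proof (intro allI impI)
  fix T :: real assume T: "T > 0"
  note g = growth[rule_format]
  have "solvable \<alpha> w \<phi> \<psi> T X"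
    using cases init solvable_Cb[OF alpha w0 g T] solvable_LpLinf[OF alpha w0 g T]
      solvable_C1b[OF alpha w0 g T] solvable_W1p[OF alpha w0 g T] by blast
  then show "\<exists>u u1 u2. C2_curve X T u u1 u2
            \<and> (\<forall>t\<in>{0..T}. feq X (u2 t) (peri_op \<alpha> w (u t)))
            \<and> feq X (u 0) \<phi> \<and> feq X (u1 0) \<psi>"
    by (simp add: solvable_def[OF alpha w0 g T])
qed

end
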